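(* Let $c_1,c_2,c_3$ be positive integers and let $P$ be the $(c_1,c_2,c_3)$-generalized double circle. Then $P$ is universal.
   Context: All point sets are in the plane and in general position (no three collinear). A triangulation of a point set is a maximal set of pairwise non-crossing segments with endpoints in the set. For point sets $P,Q$ and a bijection $f:P\to Q$, a compatible triangulation with respect to $f$ is a pair $(T_P,T_Q)$ of triangulations with $(p,p')\in T_P$ iff $(f(p),f(p'))\in T_Q$. A bijection $f_0$ from the convex hull vertices of $P$ to those of $Q$ is cyclic if for all hull vertices $p_1,p_2$ of $P$, $p_1p_2$ is a hull edge of $P$ iff $f_0(p_1)f_0(p_2)$ is a hull edge of $Q$. $P$ is universal if for every point set $Q$ with $|Q|=|P|$ and every cyclic bijection $f_0$ from the hull vertices of $P$ to those of $Q$, there is a bijection $f:P\to Q$ extending $f_0$ and a compatible triangulation of $(P,Q)$ with respect to $f$. A $(c_1,c_2,c_3)$-generalized double circle is a point set with $3+c_1+c_2+c_3$ points whose convex hull is the triangle $P_1P_2P_3$ (indices mod 3), such that for each $i$ there are $c_i$ points $A_{i,1},\dots,A_{i,c_i}$ placed along the edge $P_iP_{i+1}$, slightly offset towards the interior, the polygon $P_iA_{i,1}\dots A_{i,c_i}P_{i+1}$ is convex, and the closed chain $P_1A_{1,1}\dots A_{1,c_1}P_2\dots P_3A_{3,1}\dots A_{3,c_3}P_1$ is an unavoidable spanning cycle, i.e. each of its edges belongs to every triangulation of the point set. *)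

theory Defs
  imports "HOL-Analysis.Analysis"
begin

definition planar_point_set :: "(real^2) set \<Rightarrow> bool" where
  "planar_point_set P \<longleftrightarrow> finite P \<and>
     (\<forall>a\<in>P. \<forall>b\<in>P. \<forall>c\<in>P. a \<noteq> b \<and> b \<noteq> c \<and> a \<noteq> c \<longrightarrow> \<not> collinear {a, b, c})"

text \<open>A segment is represented by the unordered pair of its two distinct endpoints.\<close>

definition segments_of :: "(real^2) set \<Rightarrow> (real^2) set set" where
  "segments_of P = {{p, q} |p q. p \<in> P \<and> q \<in> P \<and> p \<noteq> q}"

text \<open>Two segments that only share an endpoint do not cross.\<close>

definition segments_cross :: "(real^2) set \<Rightarrow> (real^2) set \<Rightarrow> bool" where
  "segments_cross e e' \<longleftrightarrow> e \<noteq> e' \<and>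
     (\<exists>p q r s. e = {p, q} \<and> e' = {r, s} \<and> open_segment p q \<inter> open_segment r s \<noteq> {})"

definition noncrossing_segments :: "(real^2) set \<Rightarrow> (real^2) set set \<Rightarrow> bool" where
  "noncrossing_segments P T \<longleftrightarrow>
     T \<subseteq> segments_of P \<and> (\<forall>e\<in>T. \<forall>e'\<in>T. \<not> segments_cross e e')"

definition triangulation_on :: "(real^2) set \<Rightarrow> (real^2) set set \<Rightarrow> bool" where
  "triangulation_on P T \<longleftrightarrow> noncrossing_segments P T \<and>
     (\<forall>T'. noncrossing_segments P T' \<and> T \<subseteq> T' \<longrightarrow> T' = T)"

definition compatible_triangulation ::
  "(real^2) set \<Rightarrow> (real^2) set \<Rightarrow> (real^2 \<Rightarrow> real^2) \<Rightarrow>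
   (real^2) set set \<Rightarrow> (real^2) set set \<Rightarrow> bool" where
  "compatible_triangulation P Q f TP TQ \<longleftrightarrow>
     triangulation_on P TP \<and> triangulation_on Q TQ \<and>
     (\<forall>p\<in>P. \<forall>p'\<in>P. {p, p'} \<in> TP \<longleftrightarrow> {f p, f p'} \<in> TQ)"

definition hull_vertices :: "(real^2) set \<Rightarrow> (real^2) set" where
  "hull_vertices P = {p. p extreme_point_of (convex hull P)}"

definition hull_edge :: "(real^2) set \<Rightarrow> real^2 \<Rightarrow> real^2 \<Rightarrow> bool" where
  "hull_edge P p q \<longleftrightarrow> closed_segment p q edge_of (convex hull P)"

definition cyclic_bijection ::
  "(real^2) set \<Rightarrow> (real^2) set \<Rightarrow> (real^2 \<Rightarrow> real^2) \<Rightarrow> bool" where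
  "cyclic_bijection P Q f \<longleftrightarrow>
     bij_betw f (hull_vertices P) (hull_vertices Q) \<and>
     (\<forall>p\<in>hull_vertices P. \<forall>p'\<in>hull_vertices P. hull_edge P p p' \<longleftrightarrow> hull_edge Q (f p) (f p'))"

definition universal :: "(real^2) set \<Rightarrow> bool" where
  "universal P \<longleftrightarrow>
     (\<forall>Q f\<^sub>0. planar_point_set Q \<and> card Q = card P \<and> cyclic_bijection P Q f\<^sub>0 \<longrightarrow>
        (\<exists>f. bij_betw f P Q \<and> (\<forall>p\<in>hull_vertices P. f p = f\<^sub>0 p) \<and>
             (\<exists>TP TQ. compatible_triangulation P Q f TP TQ)))"

definition closed_chain_edges :: "(real^2) list \<Rightarrow> (real^2) set set" where
  "closed_chain_edges xs = {{xs ! k, xs ! (Suc k mod length xs)} |k. k < length xs}"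

text \<open>
  The points of the list, in this cyclic order (of either orientation), are the vertices of a
  convex polygon: every side is an edge of the convex hull.  A list of two points is allowed
  as a degenerate case.
\<close>

definition convex_polygon :: "(real^2) list \<Rightarrow> bool" where
  "convex_polygon xs \<longleftrightarrow> distinct xs \<and>
     (\<forall>k<length xs. hull_edge (set xs) (xs ! k) (xs ! (Suc k mod length xs)))"

definition unavoidable_spanning_cycle :: "(real^2) set \<Rightarrow> (real^2) list \<Rightarrow> bool" where
  "unavoidable_spanning_cycle P xs \<longleftrightarrow> distinct xs \<and> set xs = P \<and>
     (\<forall>T. triangulation_on P T \<longrightarrow> closed_chain_edges xs \<subseteq> T)"

text \<open>
  The list \<open>A\<^sub>i\<close> contains the points placed along the hull edge from \<open>P\<^sub>i\<close> to \<open>P\<^sub>i\<^sub>+\<^sub>1\<close>.  That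
  they lie only slightly inside of that edge is not a metric condition; it is expressed by
  the convexity of the three polygons together with the unavoidability of the closed chain:
  for each of the three polygons, they force every line through two of its vertices to have
  all points of \<open>P\<close> that are not vertices of it on one side.
\<close>

definition generalized_double_circle :: "nat \<Rightarrow> nat \<Rightarrow> nat \<Rightarrow> (real^2) set \<Rightarrow> bool" where
  "generalized_double_circle c\<^sub>1 c\<^sub>2 c\<^sub>3 P \<longleftrightarrow>
     planar_point_set P \<and> card P = 3 + c\<^sub>1 + c\<^sub>2 + c\<^sub>3 \<and>
     (\<exists>P\<^sub>1 P\<^sub>2 P\<^sub>3 A\<^sub>1 A\<^sub>2 A\<^sub>3.
        length A\<^sub>1 = c\<^sub>1 \<and> length A\<^sub>2 = c\<^sub>2 \<and> length A\<^sub>3 = c\<^sub>3 \<and>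
        hull_vertices P = {P\<^sub>1, P\<^sub>2, P\<^sub>3} \<and>
        set A\<^sub>1 \<union> set A\<^sub>2 \<union> set A\<^sub>3 \<subseteq> interior (convex hull {P\<^sub>1, P\<^sub>2, P\<^sub>3}) \<and>
        convex_polygon (P\<^sub>1 # A\<^sub>1 @ [P\<^sub>2]) \<and>
        convex_polygon (P\<^sub>2 # A\<^sub>2 @ [P\<^sub>3]) \<and>
        convex_polygon (P\<^sub>3 # A\<^sub>3 @ [P\<^sub>1]) \<and>
        unavoidable_spanning_cycle P (P\<^sub>1 # A\<^sub>1 @ P\<^sub>2 # A\<^sub>2 @ P\<^sub>3 # A\<^sub>3))"

end

theory Submission
  imports Defs "HOL-Analysis.Analysis" "HOL-Library.Sublist"
begin

text \<open>
  The three chains of \<open>P\<close> are so flat that every triangle with two vertices on one closed chain,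
  taken in order, and the third vertex off it is positively oriented, and so is every triangle with
  one vertex on each open chain, while three points of one closed chain form a clockwise triangle.
  A triangulation made of such triangles only can therefore be copied from any \<open>Q\<close> to \<open>P\<close>: a set of
  positively oriented triangles whose boundaries add up to the boundary of the hull tiles the hull,
  because it covers a generic point as often as its boundary winds around it.

  In \<open>Q\<close> we assign the interior points to the three sides such that the sum of the logarithms of
  the distances to the assigned sides is minimal. Exchanging two points shows that the classes are
  separated by lines through the corners. Sweeping a front between the hulls of two of
  the classes until the third class or a corner is met, we find a triangle with one vertex in each
  class, or an edge from a corner to the opposite class, that is not crossed by the hulls of the
  classes. What remains are strips between two separated classes, which are triangulated by
  removing one point at a time; the line through the point that becomes extreme separates the
  removed point from the rest of its class, and this allows to triangulate the pockets between the
  resulting chains and the hull edges as well.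
\<close>

section \<open>Tilings by oriented triangles\<close>

text \<open>The chains in \<open>Q\<close> are not given: an order of the points along them has to
  be found, and it decides which triples may be used. The order in which the strips remove their
  points is suitable; where a chain is composed of two halves from strips at different corners,
  these meet at a vertex of the central triangle or of the dividing edge. The logarithms come from
  the angular order at a corner: two points are ordered around it by the ratio of their distances to
  the two adjacent sides, and exchanging them changes a sum of logarithms by the logarithm of a
  quotient of such ratios. The transfer to \<open>P\<close> forgets the geometry of
  \<open>Q\<close>: boundary identities are preserved under relabelling, so only the signs of the
  triples have to be checked in \<open>P\<close>. The combinatorial work takes place over an
  abstract determinant function, because the given cyclic bijection may reverse the orientation and
  because nearly every argument has a left and a right version.\<close>

definition ori :: "real^2 \<Rightarrow> real^2 \<Rightarrow> real^2 \<Rightarrow> real" where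
  "ori a b c = (b$1 - a$1) * (c$2 - a$2) - (b$2 - a$2) * (c$1 - a$1)"

lemma ori_rotate: "ori a b c = ori b c a"
  by (simp add: ori_def algebra_simps)

lemma ori_rotate': "ori a b c = ori c a b"
  by (simp add: ori_def algebra_simps)

lemma ori_swap: "ori a b c = - ori b a c" "ori a b c = - ori a c b" "ori a b c = - ori c b a"
  by (simp_all add: ori_def algebra_simps)

lemma ori_same [simp]: "ori a a b = 0" "ori a b a = 0" "ori a b b = 0"
  by (simp_all add: ori_def algebra_simps)

lemma ori_affine: "ori a b ((1 - u) *\<^sub>R p + u *\<^sub>R q) = (1 - u) * ori a b p + u * ori a b q"
  by (simp add: ori_def algebra_simps)

lemma ori_add_scaleR: "ori a b (p + e *\<^sub>R (q - r)) = ori a b p + e * (ori a b q - ori a b r)"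
  by (simp add: ori_def algebra_simps)

lemma ori_four: "ori a b d + ori b c d + ori c a d = ori a b c"
  by (simp add: ori_def algebra_simps)

text \<open>The three-term Grassmann-Pluecker relation for the vectors from \<open>a\<close> to the
  other four points.\<close>

lemma ori_grassmann:
  "ori a b c * ori a d e - ori a b d * ori a c e + ori a b e * ori a c d = 0"
  by (simp add: ori_def algebra_simps)

lemma continuous_on_ori [continuous_intros]:
  "continuous_on S f \<Longrightarrow> continuous_on S (\<lambda>x. ori a b (f x))"
  unfolding ori_def by (intro continuous_intros)

lemma open_ori_pos: "open {x. ori a b x > 0}"
  by (intro open_Collect_less continuous_intros)

lemma collinear_iff_ori: "collinear {a, b, c} \<longleftrightarrow> ori a b c = 0"
proof -
  have vec: "x = y \<longleftrightarrow> x$1 = y$1 \<and> x$2 = y$2" for x y :: "real^2"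
    by (simp add: vec_eq_iff forall_2)
  have "collinear {a, b, c} \<longleftrightarrow> collinear {0, b - a, c - a}"
    using collinear_3[of b a c] by (simp add: insert_commute)
  also have "\<dots> \<longleftrightarrow> ori a b c = 0"
  proof (cases "b = a")
    case False
    show ?thesis
    proof
      assume "collinear {0, b - a, c - a}"
      then obtain k where "c - a = k *\<^sub>R (b - a) \<or> c - a = 0"
        using False unfolding collinear_lemma by auto
      then have "c$1 - a$1 = k * (b$1 - a$1) \<and> c$2 - a$2 = k * (b$2 - a$2)
          \<or> c$1 - a$1 = 0 \<and> c$2 - a$2 = 0"
        by (auto simp: vec)
      then show "ori a b c = 0" unfolding ori_def by (elim disjE conjE) (simp_all add: mult_ac)
    next
      assume 0: "ori a b c = 0"
      have "\<exists>k. c - a = k *\<^sub>R (b - a)"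
      proof (cases "b$1 = a$1")
        case True
        then have "b$2 \<noteq> a$2" using False vec by auto
        moreover have "c$1 = a$1" using 0 True calculation by (simp add: ori_def)
        ultimately have "c - a = ((c$2 - a$2) / (b$2 - a$2)) *\<^sub>R (b - a)"
          using True by (simp add: vec)
        then show ?thesis by blast
      next
        case f: False
        have "c$2 - a$2 = (c$1 - a$1) / (b$1 - a$1) * (b$2 - a$2)"
          using 0 f by (simp add: ori_def field_simps)
        then have "c - a = ((c$1 - a$1) / (b$1 - a$1)) *\<^sub>R (b - a)"
          using f by (auto simp: vec)
        then show ?thesis by blast
      qed
      then show "collinear {0, b - a, c - a}" unfolding collinear_lemma by auto
    qed
  qed simp
  finally show ?thesis .
qed

lemma planar_ori_nonzero:
  assumes "planar_point_set V" "a \<in> V" "b \<in> V" "c \<in> V" "a \<noteq> b" "b \<noteq> c" "a \<noteq> c"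
  shows "ori a b c \<noteq> 0"
  using assms unfolding planar_point_set_def collinear_iff_ori by blast

lemma planar_finite: "planar_point_set V \<Longrightarrow> finite V"
  by (simp add: planar_point_set_def)

lemma ori_zero_on_segment: "m \<in> open_segment p q \<Longrightarrow> ori p q m = 0"
  by (auto simp: in_segment ori_affine)

text \<open>Along \<open>pq\<close> the function \<open>ori r s\<close> is affine and vanishes at
  the parameter \<open>?u\<close>; likewise \<open>ori p q\<close> along \<open>rs\<close> at
  \<open>?w\<close>. Multiplying by the common denominator \<open>D\<close> shows that both points
  coincide, and the opposite signs place both parameters strictly between 0 and 1.\<close>

lemma segments_meetI:
  assumes "ori p q r * ori p q s < 0" "ori r s p * ori r s q < 0"
  shows "open_segment p q \<inter> open_segment r s \<noteq> {}"
proof -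
  let ?u = "ori r s p / (ori r s p - ori r s q)" and ?w = "ori p q r / (ori p q r - ori p q s)"
  have d: "ori r s p - ori r s q \<noteq> 0" "ori p q r - ori p q s \<noteq> 0"
    using assms by (auto simp: mult_less_0_iff)
  have 01: "0 < x / (x - y) \<and> x / (x - y) < 1" if "x * y < 0" for x y :: real
    using that by (auto simp: mult_less_0_iff divide_simps)
  have e: "ori p q r - ori p q s = - (ori r s p - ori r s q)"
    by (simp add: ori_def algebra_simps)
  define D where "D = ori r s p - ori r s q"
  have D: "D \<noteq> 0" using d D_def by simp
  have u: "?u = ori r s p / D" by (simp add: D_def)
  have "?w = ori p q r / (- D)" unfolding e D_def ..
  then have w: "?w = - ori p q r / D" by simp
  have "D *\<^sub>R ((1 - ?u) *\<^sub>R p + ?u *\<^sub>R q) = (D - ori r s p) *\<^sub>R p + ori r s p *\<^sub>R q"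
    unfolding u using D by (simp add: scaleR_add_right algebra_simps)
  also have "\<dots> = (D + ori p q r) *\<^sub>R r - ori p q r *\<^sub>R s"
    unfolding D_def by (simp add: vec_eq_iff forall_2 ori_def algebra_simps)
  also have "\<dots> = D *\<^sub>R ((1 - ?w) *\<^sub>R r + ?w *\<^sub>R s)"
    unfolding w using D by (simp add: scaleR_add_right algebra_simps)
  finally have "(1 - ?u) *\<^sub>R p + ?u *\<^sub>R q = (1 - ?w) *\<^sub>R r + ?w *\<^sub>R s" using D by simp
  moreover have "p \<noteq> q" "r \<noteq> s" using assms by auto
  ultimately show ?thesis using 01[OF assms(1)] 01[OF assms(2)]
    unfolding disjoint_iff in_segment(2) by blast
qed

lemma segments_meetD:
  assumes V: "planar_point_set V" "p \<in> V" "q \<in> V" "r \<in> V" "s \<in> V" "p \<noteq> q" "r \<noteq> s" "{p, q} \<noteq> {r, s}"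
    and m: "m \<in> open_segment p q" "m \<in> open_segment r s"
  shows "distinct [p, q, r, s] \<and> ori p q r * ori p q s < 0 \<and> ori r s p * ori r s q < 0"
proof -
  obtain u where u: "0 < u" "u < 1" "m = (1 - u) *\<^sub>R p + u *\<^sub>R q" using m(1) by (auto simp: in_segment)
  obtain w where w: "0 < w" "w < 1" "m = (1 - w) *\<^sub>R r + w *\<^sub>R s" using m(2) by (auto simp: in_segment)
  have z: "(1 - w) * ori p q r + w * ori p q s = 0" "(1 - u) * ori r s p + u * ori r s q = 0"
    using ori_zero_on_segment[OF m(1)] ori_zero_on_segment[OF m(2)] u w by (metis ori_affine)+
  have nz: "x \<in> V \<Longrightarrow> y \<in> V \<Longrightarrow> z \<in> V \<Longrightarrow> ori x y z = 0 \<Longrightarrow> x = y \<or> y = z \<or> x = z" for x y z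
    using planar_ori_nonzero[OF V(1)] by blast
  have d: "p \<noteq> r" "p \<noteq> s" "q \<noteq> r" "q \<noteq> s"
  proof -
    show "p \<noteq> r"
    proof
      assume "p = r"
      then have "ori p q s = 0" using z w by auto
      then show False using nz V \<open>p = r\<close> by blast
    qed
    show "p \<noteq> s"
    proof
      assume "p = s"
      then have "ori p q r = 0" using z w by auto
      then show False using nz V \<open>p = s\<close> by blast
    qed
    show "q \<noteq> r"
    proof
      assume "q = r"
      then have "ori p q s = 0" using z w by auto
      then show False using nz V \<open>q = r\<close> by blast
    qed
    show "q \<noteq> s"
    proof
      assume "q = s"
      then have "ori p q r = 0" using z w by auto
      then show False using nz V \<open>q = s\<close> by blast
    qed
  qed
  have sgn: "x * y < 0" if "(1 - t) * x + t * y = 0" "0 < t" "t < 1" "x \<noteq> 0" "y \<noteq> 0" for x y t :: real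
  proof (rule ccontr)
    assume "\<not> ?thesis"
    then have "x > 0 \<and> y > 0 \<or> x < 0 \<and> y < 0" using that by (auto simp: mult_less_0_iff)
    then show False
    proof
      assume "x > 0 \<and> y > 0"
      then have "(1 - t) * x > 0" "t * y > 0" using that by auto
      then show False using that by linarith
    next
      assume "x < 0 \<and> y < 0"
      then have "(1 - t) * x < 0" "t * y < 0" using that by (auto simp: mult_pos_neg)
      then show False using that by linarith
    qed
  qed
  have "ori p q r * ori p q s < 0" using z(1) w nz V d by (intro sgn[of w]) auto
  moreover have "ori r s p * ori r s q < 0" using z(2) u nz V d by (intro sgn[of u]) auto
  ultimately show ?thesis using d V by simp
qed

section \<open>Signed angles and the winding number of a triangle\<close>

definition skew :: "('a \<Rightarrow> 'a \<Rightarrow> real) \<Rightarrow> bool" where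
  "skew \<phi> \<longleftrightarrow> (\<forall>a b. \<phi> a b = - \<phi> b a)"

fun bd :: "('a \<Rightarrow> 'a \<Rightarrow> real) \<Rightarrow> 'a \<times> 'a \<times> 'a \<Rightarrow> real" where
  "bd \<phi> (a, b, c) = \<phi> a b + \<phi> b c + \<phi> c a"

text \<open>The boundary of the formal sum of triangles \<open>D\<close> is tested against skew edge functions;
  this spares us formal sums of edges.\<close>

definition bounds :: "('a \<times> 'a \<times> 'a) list \<Rightarrow> 'a \<times> 'a \<times> 'a \<Rightarrow> bool" where
  "bounds D h \<longleftrightarrow> (\<forall>\<phi>. skew \<phi> \<longrightarrow> (\<Sum>t\<leftarrow>D. bd \<phi> t) = bd \<phi> h)"

fun inside :: "real^2 \<Rightarrow> (real^2) \<times> (real^2) \<times> (real^2) \<Rightarrow> bool" where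
  "inside x (a, b, c) \<longleftrightarrow> ori a b x > 0 \<and> ori b c x > 0 \<and> ori c a x > 0"

fun cinside :: "real^2 \<Rightarrow> (real^2) \<times> (real^2) \<times> (real^2) \<Rightarrow> bool" where
  "cinside x (a, b, c) \<longleftrightarrow> ori a b x \<ge> 0 \<and> ori b c x \<ge> 0 \<and> ori c a x \<ge> 0"

fun ccw :: "(real^2) \<times> (real^2) \<times> (real^2) \<Rightarrow> bool" where
  "ccw (a, b, c) \<longleftrightarrow> ori a b c > 0"

definition cpx :: "real^2 \<Rightarrow> complex" where "cpx p = Complex (p$1) (p$2)"

definition angle_at :: "real^2 \<Rightarrow> real^2 \<Rightarrow> real^2 \<Rightarrow> real" where
  "angle_at x a b = Arg ((cpx b - cpx x) / (cpx a - cpx x))"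

text \<open>The signed angle under which \<open>x\<close> sees the step from \<open>a\<close> to
  \<open>b\<close>. The principal argument alone is not antisymmetric at straight angles, so a
  clockwise step copies the value of the reversed step and a degenerate one gets 0; the boundary
  identity can then be tested with it.\<close>

definition turn :: "real^2 \<Rightarrow> real^2 \<Rightarrow> real^2 \<Rightarrow> real" where
  "turn x a b = (if ori x a b > 0 then angle_at x a b else if ori x a b < 0 then - angle_at x b a else 0)"

lemma skew_turn: "skew (turn x)"
  unfolding skew_def turn_def using ori_swap(2)[of x] by (smt (verit))

lemma angle_at_bounds:
  assumes "ori x a b > 0" shows "0 < angle_at x a b" "angle_at x a b < pi"
proof -
  have ne: "cpx a \<noteq> cpx x"
    using assms by (auto simp: cpx_def ori_def)
  have "Im ((cpx b - cpx x) / (cpx a - cpx x)) = ori x a b / (cmod (cpx a - cpx x))\<^sup>2"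
    by (simp add: Im_divide cmod_power2 cpx_def ori_def algebra_simps)
  then have "Im ((cpx b - cpx x) / (cpx a - cpx x)) > 0" using assms ne by simp
  then show "0 < angle_at x a b" "angle_at x a b < pi"
    unfolding angle_at_def using Arg_lt_pi by auto
qed

lemma turn_bounds:
  "ori x a b > 0 \<Longrightarrow> 0 < turn x a b \<and> turn x a b < pi"
  "ori x a b < 0 \<Longrightarrow> - pi < turn x a b \<and> turn x a b < 0"
  using angle_at_bounds[of x a b] angle_at_bounds[of x b a] ori_swap(2)[of x a b]
  unfolding turn_def by auto

lemma cis_turn:
  assumes "ori x a b \<noteq> 0"
  shows "cis (turn x a b) = sgn (cpx b - cpx x) / sgn (cpx a - cpx x)"
proof -
  have ne: "cpx a - cpx x \<noteq> 0" "cpx b - cpx x \<noteq> 0"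
    using assms by (auto simp: cpx_def ori_def)
  have c: "cis (Arg z) = sgn z" if "z \<noteq> 0" for z using that cis_Arg by blast
  show ?thesis
  proof (cases "ori x a b > 0")
    case True
    then show ?thesis using ne by (simp add: turn_def angle_at_def c sgn_divide)
  next
    case False
    then have "ori x a b < 0" using assms by auto
    then have "cis (turn x a b) = inverse (sgn ((cpx a - cpx x) / (cpx b - cpx x)))"
      using ne by (simp add: turn_def angle_at_def flip: cis_inverse add: c)
    then show ?thesis by (simp add: sgn_divide)
  qed
qed

text \<open>The three angles compose to a full rotation, so their sum is a multiple of
  \<open>2 * pi\<close>. Each lies strictly between \<open>- pi\<close> and \<open>pi\<close>, and
  at least one is positive because the three signed areas at \<open>x\<close> add up to
  \<open>ori a b c\<close>. This leaves 0 and \<open>2 * pi\<close>; a negative angle excludes the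
  latter, three positive ones the former.\<close>

lemma bd_turn:
  assumes abc: "ori a b c > 0" and nz: "ori a b x \<noteq> 0" "ori b c x \<noteq> 0" "ori c a x \<noteq> 0"
  shows "bd (turn x) (a, b, c) = (if inside x (a, b, c) then 2 * pi else 0)"
proof -
  have nz': "ori x a b \<noteq> 0" "ori x b c \<noteq> 0" "ori x c a \<noteq> 0" using nz ori_rotate'[of a b x] ori_rotate'[of b c x] ori_rotate'[of c a x] by simp_all
  have ne: "sgn (cpx a - cpx x) \<noteq> 0" "sgn (cpx b - cpx x) \<noteq> 0" "sgn (cpx c - cpx x) \<noteq> 0"
    using nz' by (auto simp: cpx_def ori_def sgn_zero_iff)
  define s where "s = turn x a b + turn x b c + turn x c a"
  have "cis s = cis (turn x a b) * cis (turn x b c) * cis (turn x c a)"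
    by (simp add: s_def cis_mult)
  also have "\<dots> = 1" using nz' ne by (simp add: cis_turn)
  finally have "cos s = 1" by (metis cis.sel(1) one_complex.sel(1))
  then obtain n :: int where n: "s = of_int n * 2 * pi" using cos_one_2pi_int by blast
  have sum: "ori x a b + ori x b c + ori x c a > 0"
    using abc ori_four[of a b x c] by (simp add: ori_rotate'[of a b x] ori_rotate'[of b c x] ori_rotate'[of c a x])
  have range: "- 2 * pi < s" "s < 3 * pi" and pos: "inside x (a, b, c) \<longleftrightarrow> s > 0 \<and> s \<ge> 2 * pi"
  proof -
    note B = turn_bounds[of x a b] turn_bounds[of x b c] turn_bounds[of x c a]
    have in1: "inside x (a, b, c) \<longleftrightarrow> ori x a b > 0 \<and> ori x b c > 0 \<and> ori x c a > 0"
      using ori_rotate'[of a b x] ori_rotate'[of b c x] ori_rotate'[of c a x] by simp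
    show "- 2 * pi < s" "s < 3 * pi" unfolding s_def using B nz' sum by linarith+
    have "\<not> inside x (a, b, c) \<Longrightarrow> s < 2 * pi" unfolding s_def in1 using B nz' pi_gt_zero by linarith
    moreover have "inside x (a, b, c) \<Longrightarrow> s > 0" unfolding s_def in1 using B by linarith
    moreover have "s > 0 \<Longrightarrow> s \<ge> 2 * pi"
    proof -
      assume "s > 0"
      then have "n > 0" using n by (simp add: zero_less_mult_iff)
      then have "real_of_int n * pi \<ge> 1 * pi" by (intro mult_right_mono) auto
      then show ?thesis using n by simp
    qed
    ultimately show "inside x (a, b, c) \<longleftrightarrow> s > 0 \<and> s \<ge> 2 * pi" by fastforce
  qed
  have "n > - 1"
  proof (rule ccontr)
    assume "\<not> n > - 1"
    then have "real_of_int n * pi \<le> - 1 * pi" by (intro mult_right_mono) auto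
    then show False using range n by simp
  qed
  moreover have "n < 2"
  proof (rule ccontr)
    assume "\<not> n < 2"
    then have "real_of_int n * pi \<ge> 2 * pi" by (intro mult_right_mono) auto
    then show False using range n by simp
  qed
  ultimately have "n = 0 \<or> n = 1" by auto
  then have "s = 0 \<or> s = 2 * pi" using n by auto
  then show ?thesis using pos by (auto simp: s_def[symmetric])
qed

text \<open>The lines are avoided one at a time: what is left of the open set off one line is again
  open and non-empty.\<close>

lemma generic_point_exists:
  assumes "finite L" "open U" "U \<noteq> {}" "\<And>a b. (a, b) \<in> L \<Longrightarrow> a \<noteq> b"
  shows "\<exists>x\<in>U. \<forall>(a, b)\<in>L. ori a b x \<noteq> 0"
  using assms
proof (induction arbitrary: U rule: finite_induct)
  case (insert l L)
  obtain a b where l: "l = (a, b)" "a \<noteq> b" using insert.prems(3) by (metis insertI1 surj_pair)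
  have op: "open {x. ori a b x \<noteq> 0}"
    by (intro open_Collect_neq continuous_intros)
  have "U \<inter> {x. ori a b x \<noteq> 0} \<noteq> {}"
  proof -
    obtain u where u: "u \<in> U" using insert.prems by auto
    \<comment> \<open>A normal vector of the line: \<open>ori a b\<close> grows along it with slope
      the squared length of \<open>b - a\<close>, so two nearby points cannot both be zeros.\<close>
    define v :: "real^2" where "v = vector [- (b$2 - a$2), b$1 - a$1]"
    have v: "v$1 = - (b$2 - a$2)" "v$2 = b$1 - a$1" by (simp_all add: v_def)
    have "((\<lambda>e. u + e *\<^sub>R v) \<longlongrightarrow> u + 0 *\<^sub>R v) (at_right 0)" by (intro tendsto_intros)
    then have ev: "eventually (\<lambda>e. u + e *\<^sub>R v \<in> U) (at_right (0::real))"
      using topological_tendstoD[OF _ insert.prems(1)] u by simp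
    then obtain e0 where e0: "e0 > 0" "\<And>e. 0 < e \<Longrightarrow> e < e0 \<Longrightarrow> u + e *\<^sub>R v \<in> U"
      unfolding eventually_at_right_field by blast
    have f: "ori a b (u + e *\<^sub>R v) = ori a b u + e * ((b$1 - a$1)^2 + (b$2 - a$2)^2)" for e
      by (simp add: ori_def v algebra_simps power2_eq_square)
    have "(b$1 - a$1)^2 + (b$2 - a$2)^2 \<noteq> 0"
      using l(2) by (auto simp: sum_power2_eq_zero_iff vec_eq_iff forall_2)
    then have "ori a b (u + (e0/2) *\<^sub>R v) \<noteq> ori a b u" using f[of "e0/2"] e0 by simp
    then have "ori a b u \<noteq> 0 \<or> ori a b (u + (e0/2) *\<^sub>R v) \<noteq> 0" by auto
    then show ?thesis using u e0(2)[of "e0/2"] e0(1) by auto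
  qed
  then obtain x where "x \<in> U \<inter> {x. ori a b x \<noteq> 0}" "\<forall>(a, b)\<in>L. ori a b x \<noteq> 0"
    using insert.IH[of "U \<inter> {x. ori a b x \<noteq> 0}"] insert.prems op by (auto intro: open_Int)
  then show ?case using l by auto
qed auto

section \<open>Triangles with a prescribed boundary form a triangulation\<close>

fun corners :: "'a \<times> 'a \<times> 'a \<Rightarrow> 'a set" where
  "corners (a, b, c) = {a, b, c}"

fun sides :: "'a \<times> 'a \<times> 'a \<Rightarrow> 'a set set" where
  "sides (a, b, c) = {{a, b}, {b, c}, {c, a}}"

fun turned :: "'a \<times> 'a \<times> 'a \<Rightarrow> 'a \<times> 'a \<times> 'a" where
  "turned (a, b, c) = (b, c, a)"

lemma open_inside: "open {x. inside x t}"
  by (cases t) (auto intro!: open_Collect_conj open_Collect_less continuous_intros)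

lemma closed_cinside: "closed {x. cinside x t}"
  by (cases t) (auto intro!: closed_Collect_conj closed_Collect_le continuous_intros)

lemma eventually_ori_pos:
  assumes "ori a b m > 0"
  shows "eventually (\<lambda>e. ori a b (m + e *\<^sub>R v) > 0) (at_right 0)"
proof -
  have "((\<lambda>e. m + e *\<^sub>R v) \<longlongrightarrow> m + 0 *\<^sub>R v) (at_right 0)" by (intro tendsto_intros)
  then show ?thesis
    using topological_tendstoD[OF _ open_ori_pos[of a b], of _ m] assms by simp
qed

locale tiling =
  fixes V :: "(real^2) set" and D :: "((real^2) \<times> (real^2) \<times> (real^2)) list"
    and h :: "(real^2) \<times> (real^2) \<times> (real^2)"
  assumes planar: "planar_point_set V"
    and corners_V: "\<And>t. t \<in> set D \<Longrightarrow> corners t \<subseteq> V" "corners h \<subseteq> V"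
    and D_ccw: "\<And>t. t \<in> set D \<Longrightarrow> ccw t" "ccw h"
    and V_hull: "\<And>p. p \<in> V \<Longrightarrow> cinside p h"
    and D_bounds: "bounds D h"
    and D_all: "V \<subseteq> \<Union> (corners ` set D)"
begin

text \<open>Testing the boundary identity with \<open>turn x\<close> counts \<open>2 * pi\<close>
  for every triangle around \<open>x\<close>, while the boundary of \<open>h\<close> contributes
  \<open>2 * pi\<close> or 0.\<close>

lemma count_inside:
  assumes "\<forall>a\<in>V. \<forall>b\<in>V. a \<noteq> b \<longrightarrow> ori a b x \<noteq> 0"
  shows "length (filter (inside x) D) = (if inside x h then 1 else 0)"
proof -
  have bd1: "bd (turn x) t = (if inside x t then 2 * pi else 0)" if "ccw t" "corners t \<subseteq> V" for t
  proof -
    obtain a b c where t: "t = (a, b, c)" by (cases t)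
    have "a \<noteq> b" "b \<noteq> c" "c \<noteq> a" using that t by auto
    then show ?thesis using bd_turn[of a b c x] that assms unfolding t by simp
  qed
  have "(\<Sum>t\<leftarrow>D. bd (turn x) t) = (\<Sum>t\<leftarrow>D. if inside x t then 2 * pi else 0)"
    using bd1 corners_V D_ccw by (intro arg_cong[where f = sum_list] map_cong) auto
  also have "\<dots> = 2 * pi * length (filter (inside x) D)"
    by (induction D) (auto simp: algebra_simps)
  finally have "2 * pi * length (filter (inside x) D) = (if inside x h then 2 * pi else 0)"
    using D_bounds skew_turn[of x] bd1[of h] corners_V D_ccw unfolding bounds_def by metis
  then show ?thesis by (auto split: if_splits)
qed

lemma generic: "open U \<Longrightarrow> U \<noteq> {} \<Longrightarrow> \<exists>x\<in>U. \<forall>a\<in>V. \<forall>b\<in>V. a \<noteq> b \<longrightarrow> ori a b x \<noteq> 0"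
  using generic_point_exists[of "{(a, b). a \<in> V \<and> b \<in> V \<and> a \<noteq> b}" U]
    finite_subset[of "{(a, b). a \<in> V \<and> b \<in> V \<and> a \<noteq> b}" "V \<times> V"] planar_finite[OF planar]
  by fastforce

lemma disjoint_insides:
  assumes "s \<in> set D" "t \<in> set D" "inside x s" "inside x t"
  shows "s = t"
proof (rule ccontr)
  assume "s \<noteq> t"
  obtain y where y: "inside y s" "inside y t" "\<forall>a\<in>V. \<forall>b\<in>V. a \<noteq> b \<longrightarrow> ori a b y \<noteq> 0"
    using generic[of "{y. inside y s} \<inter> {y. inside y t}"] assms by (auto intro: open_inside)
  then have "{s, t} \<subseteq> set (filter (inside y) D)" using assms by auto
  then have "card {s, t} \<le> length (filter (inside y) D)"
    by (meson List.finite_set card_length card_mono le_trans)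
  then show False using count_inside[OF y(3)] \<open>s \<noteq> t\<close> by (auto split: if_splits)
qed

text \<open>A point outside all closed triangles has a neighbourhood outside them. Moved slightly
  towards the centroid of \<open>h\<close> and then into generic position, it would be inside
  \<open>h\<close> but in no triangle, against the count.\<close>

lemma covered:
  assumes "cinside x h"
  shows "\<exists>t\<in>set D. cinside x t"
proof (rule ccontr)
  assume no: "\<not> ?thesis"
  define U where "U = (\<Inter>t\<in>set D. - {y. cinside y t})"
  have U: "open U" "x \<in> U"
    unfolding U_def using no closed_cinside by (auto intro!: open_INT)
  obtain a b c where h: "h = (a, b, c)" by (cases h)
  define g where "g = (1/3) *\<^sub>R (a + b + c)"
  have g: "ori a b g > 0" "ori b c g > 0" "ori c a g > 0"
  proof -
    have c: "c$1 = 3 * g$1 - a$1 - b$1" "c$2 = 3 * g$2 - a$2 - b$2"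
      by (simp_all add: g_def field_simps)
    have "ori a b c = 3 * ori a b g" "ori a b c = 3 * ori b c g" "ori a b c = 3 * ori c a g"
      by (simp_all add: ori_def c algebra_simps)
    then show "ori a b g > 0" "ori b c g > 0" "ori c a g > 0" using D_ccw(2) by (simp_all add: h)
  qed
  have "((\<lambda>e. x + e *\<^sub>R (g - x)) \<longlongrightarrow> x + 0 *\<^sub>R (g - x)) (at_right 0)" by (intro tendsto_intros)
  then have "eventually (\<lambda>e. x + e *\<^sub>R (g - x) \<in> U) (at_right (0::real))"
    using topological_tendstoD[OF _ U(1)] U(2) by simp
  moreover have "eventually (\<lambda>e. e \<in> {0<..<1}) (at_right (0::real))"
    by (rule eventually_at_right_real) simp
  ultimately have "eventually (\<lambda>e. e \<in> {0<..<1} \<and> x + e *\<^sub>R (g - x) \<in> U) (at_right (0::real))"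
    by eventually_elim auto
  then obtain e where e: "0 < e" "e < 1" "x + e *\<^sub>R (g - x) \<in> U"
    using eventually_happens'[OF trivial_limit_at_right_real] by force
  have "inside (x + e *\<^sub>R (g - x)) h"
  proof -
    have "p + e * (q - p) > 0" if "p \<ge> 0" "q > 0" for p q :: real
    proof -
      have "p + e * (q - p) = (1 - e) * p + e * q" by (simp add: algebra_simps)
      then show ?thesis using that e by (simp add: add_nonneg_pos)
    qed
    then show ?thesis using assms g unfolding h by (simp add: ori_add_scaleR)
  qed
  then obtain y where y: "y \<in> U" "inside y h" "\<forall>a\<in>V. \<forall>b\<in>V. a \<noteq> b \<longrightarrow> ori a b y \<noteq> 0"
    using generic[of "U \<inter> {y. inside y h}"] U(1) e(3) open_inside[of h] by (auto intro: open_Int)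
  have "length (filter (inside y) D) = 1" using count_inside[OF y(3)] y(2) by simp
  then obtain t where "t \<in> set D" "inside y t"
    by (metis filter_empty_conv list.size(3) zero_neq_one)
  moreover have "cinside y t" using \<open>inside y t\<close> by (cases t) auto
  ultimately show False using y(1) by (auto simp: U_def)
qed

text \<open>Membership up to rotation, so that any vertex or side can be put first.\<close>

definition tri :: "real^2 \<Rightarrow> real^2 \<Rightarrow> real^2 \<Rightarrow> bool" where
  "tri a b c \<longleftrightarrow> (a, b, c) \<in> set D \<or> (b, c, a) \<in> set D \<or> (c, a, b) \<in> set D"

lemma tri_rotate: "tri a b c \<Longrightarrow> tri b c a" unfolding tri_def by blast

lemma triD:
  assumes "tri a b c"
  shows "ori a b c > 0" "a \<in> V" "b \<in> V" "c \<in> V" "distinct [a, b, c]"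
proof -
  show o: "ori a b c > 0"
    using assms D_ccw(1) ori_rotate[of a b c] ori_rotate'[of a b c] unfolding tri_def by fastforce
  show "a \<in> V" "b \<in> V" "c \<in> V" using assms corners_V(1) unfolding tri_def by fastforce+
  show "distinct [a, b, c]" using o by auto
qed

lemma tri_unique:
  assumes "tri a b c" "tri a' b' c'" "inside x (a, b, c)" "inside x (a', b', c')"
  shows "{a, b, c} = {a', b', c'}"
proof -
  have "\<exists>t\<in>set D. inside x t \<and> corners t = {a, b, c}"
    if abc: "tri a b c" "inside x (a, b, c)" for a b c
  proof -
    obtain t where "t \<in> set D" "t = (a, b, c) \<or> t = (b, c, a) \<or> t = (c, a, b)"
      using abc(1) unfolding tri_def by auto
    then show ?thesis using abc(2) by (intro bexI[of _ t]) auto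
  qed
  from this[OF assms(1,3)] this[OF assms(2,4)] show ?thesis using disjoint_insides by metis
qed

lemma tri_vertex: "p \<in> V \<Longrightarrow> \<exists>u w. tri p u w"
proof -
  assume "p \<in> V"
  then obtain t where "t \<in> set D" "p \<in> corners t" using D_all by auto
  moreover obtain a b c where "t = (a, b, c)" by (cases t)
  ultimately have "tri a b c" "p = a \<or> p = b \<or> p = c" by (auto simp: tri_def)
  then show ?thesis using tri_rotate by blast
qed

text \<open>A point of \<open>V\<close> strictly inside a triangle is a corner of some other
  triangle by \<open>D_all\<close>, and near that point the two interiors overlap.\<close>

lemma tri_empty:
  assumes p: "p \<in> V" and t: "tri a b c" and c: "cinside p (a, b, c)"
  shows "p \<in> {a, b, c}"
proof (rule ccontr)
  assume np: "p \<notin> {a, b, c}"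
  have ins: "inside p (a, b, c)"
    using c np triD[OF t] p planar_ori_nonzero[OF planar, of a b p] planar_ori_nonzero[OF planar, of b c p]
      planar_ori_nonzero[OF planar, of c a p] by (auto simp: order_less_le)
  obtain u w where uw: "tri p u w" using tri_vertex[OF p] by blast
  define v where "v = (u - p) + (w - p)"
  have q: "ori p u (p + e *\<^sub>R v) = e * ori p u w" "ori w p (p + e *\<^sub>R v) = e * ori p u w"
     "ori u w (p + e *\<^sub>R v) = (1 - 2 * e) * ori p u w" for e
    by (simp_all add: v_def ori_def algebra_simps)
  have "eventually (\<lambda>e. e \<in> {0<..<1/2}) (at_right (0::real))"
    by (rule eventually_at_right_real) simp
  moreover have "eventually (\<lambda>e. inside (p + e *\<^sub>R v) (a, b, c)) (at_right (0::real))"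
    using ins by (auto intro!: eventually_conj eventually_ori_pos)
  ultimately have "eventually (\<lambda>e. e \<in> {0<..<1/2} \<and> inside (p + e *\<^sub>R v) (a, b, c)) (at_right (0::real))"
    by eventually_elim auto
  then obtain e where e: "0 < e" "e < 1/2" "inside (p + e *\<^sub>R v) (a, b, c)"
    using eventually_happens'[OF trivial_limit_at_right_real] by force
  have "inside (p + e *\<^sub>R v) (p, u, w)" using e triD(1)[OF uw] by (simp add: q)
  then show False using tri_unique[OF t uw e(3)] np by auto
qed

definition edges :: "(real^2) set set" where "edges = \<Union> (sides ` set D)"

lemma edges_tri: "e \<in> edges \<longleftrightarrow> (\<exists>a b c. e = {a, b} \<and> tri a b c)"
proof
  assume "e \<in> edges"
  then obtain a b c where "(a, b, c) \<in> set D" "e \<in> sides (a, b, c)" by (auto simp: edges_def)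
  then show "\<exists>a b c. e = {a, b} \<and> tri a b c" by (auto simp: tri_def)
next
  assume "\<exists>a b c. e = {a, b} \<and> tri a b c"
  then show "e \<in> edges" by (force simp: edges_def tri_def)
qed

text \<open>Where two edges cross, the triangles to the left of them share interior points, hence
  have the same three corners; but the ends of the two edges are four different points.\<close>

lemma edges_noncrossing: "noncrossing_segments V edges"
  unfolding noncrossing_segments_def
proof (intro conjI ballI notI subsetI)
  fix e assume "e \<in> edges"
  then show "e \<in> segments_of V" unfolding edges_tri segments_of_def using triD by fastforce
next
  fix e e' assume e: "e \<in> edges" and e': "e' \<in> edges" and x: "segments_cross e e'"
  obtain p q w where pq: "e = {p, q}" "tri p q w" using e edges_tri by auto
  obtain r s w' where rs: "e' = {r, s}" "tri r s w'" using e' edges_tri by auto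
  have "open_segment p q \<inter> open_segment r s \<noteq> {}" "{p, q} \<noteq> {r, s}"
    using x pq rs unfolding segments_cross_def by (auto simp: doubleton_eq_iff open_segment_commute)
  then obtain m where m: "m \<in> open_segment p q" "m \<in> open_segment r s" by auto
  note a = triD[OF pq(2)] and b = triD[OF rs(2)]
  have c: "distinct [p, q, r, s]" "ori p q r * ori p q s < 0" "ori r s p * ori r s q < 0"
    using segments_meetD[OF planar a(2,3) b(2,3) _ _ \<open>{p, q} \<noteq> {r, s}\<close> m] a b by auto
  obtain r' where r': "r' \<in> {r, s}" "ori p q r' > 0" using c(2) by (auto simp: mult_less_0_iff)
  obtain p' where p': "p' \<in> {p, q}" "ori r s p' > 0" using c(3) by (auto simp: mult_less_0_iff)
  have z: "ori p q p' = 0" "ori r s r' = 0" using r' p' by auto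
  have mz: "ori p q m = 0" "ori r s m = 0" using m by (auto intro: ori_zero_on_segment)
  have mpos: "ori q w m > 0 \<and> ori w p m > 0" if mp: "m \<in> open_segment p q" "ori p q w > 0" for p q w
  proof -
    obtain u where u: "0 < u" "u < 1" "m = (1 - u) *\<^sub>R p + u *\<^sub>R q" using mp(1) by (auto simp: in_segment)
    have "ori q w p = ori p q w" "ori w p q = ori p q w" using ori_rotate ori_rotate' by metis+
    then show ?thesis using u mp(2) by (simp add: ori_affine)
  qed
  \<comment> \<open>From the crossing point \<open>m\<close> this direction leads to the left of
    both edges: \<open>r'\<close> is to the left of \<open>pq\<close> and on the line
    \<open>rs\<close>, \<open>p'\<close> is to the left of \<open>rs\<close> and on the line
    \<open>pq\<close>.\<close>
  define v where "v = r' + p' - m - m"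
  have dir: "ori p q (m + e *\<^sub>R v) = e * ori p q r'" "ori r s (m + e *\<^sub>R v) = e * ori r s p'" for e
  proof -
    have "ori a b (m + e *\<^sub>R v) = ori a b m + e * (ori a b r' + ori a b p' - 2 * ori a b m)" for a b
      by (simp add: v_def ori_def algebra_simps)
    then show "ori p q (m + e *\<^sub>R v) = e * ori p q r'" "ori r s (m + e *\<^sub>R v) = e * ori r s p'"
      using z mz by auto
  qed
  have "eventually (\<lambda>e. e \<in> {0<..<1}) (at_right (0::real))"
    by (rule eventually_at_right_real) simp
  moreover have "eventually (\<lambda>e. ori q w (m + e *\<^sub>R v) > 0 \<and> ori w p (m + e *\<^sub>R v) > 0) (at_right (0::real))"
    using mpos[OF m(1) a(1)] by (auto intro!: eventually_conj eventually_ori_pos)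
  moreover have "eventually (\<lambda>e. ori s w' (m + e *\<^sub>R v) > 0 \<and> ori w' r (m + e *\<^sub>R v) > 0) (at_right (0::real))"
    using mpos[OF m(2) b(1)] by (auto intro!: eventually_conj eventually_ori_pos)
  ultimately have "eventually (\<lambda>e. inside (m + e *\<^sub>R v) (p, q, w) \<and> inside (m + e *\<^sub>R v) (r, s, w')) (at_right (0::real))"
    by eventually_elim (use r' p' in \<open>auto simp: dir\<close>)
  then obtain e where "inside (m + e *\<^sub>R v) (p, q, w) \<and> inside (m + e *\<^sub>R v) (r, s, w')"
    using eventually_happens'[OF trivial_limit_at_right_real] by blast
  then have "{p, q, w} = {r, s, w'}" using tri_unique pq rs by blast
  then show False using c(1) by auto
qed

text \<open>Just after leaving \<open>p\<close>, a further segment \<open>pq\<close> runs through a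
  closed triangle with corner \<open>p\<close>. Since that triangle contains no other point of
  \<open>V\<close>, the segment is one of the two sides at \<open>p\<close> or crosses the side
  opposite to \<open>p\<close>.\<close>

lemma edges_maximal:
  assumes T: "noncrossing_segments V T" "edges \<subseteq> T"
  shows "T \<subseteq> edges"
proof
  fix e assume eT: "e \<in> T"
  then obtain p q where pq: "e = {p, q}" "p \<in> V" "q \<in> V" "p \<noteq> q"
    using T(1) unfolding noncrossing_segments_def segments_of_def by blast
  let ?x = "\<lambda>e. p + e *\<^sub>R (q - p)"
  \<comment> \<open>Near \<open>p\<close> only the triangles containing \<open>p\<close> are met,
    because the others are closed and finitely many.\<close>
  have "eventually (\<lambda>e. \<forall>t\<in>set D. cinside (?x e) t \<longrightarrow> cinside p t) (at_right (0::real))"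
  proof (intro eventually_ball_finite ballI)
    fix t assume "t \<in> set D"
    show "eventually (\<lambda>e. cinside (?x e) t \<longrightarrow> cinside p t) (at_right (0::real))"
    proof (cases "cinside p t")
      case False
      have "(?x \<longlongrightarrow> p + 0 *\<^sub>R (q - p)) (at_right 0)" by (intro tendsto_intros)
      then have "eventually (\<lambda>e. ?x e \<in> - {y. cinside y t}) (at_right (0::real))"
        using topological_tendstoD[of ?x p, of _ "- {y. cinside y t}"] False closed_cinside[of t] by auto
      then show ?thesis by eventually_elim auto
    qed auto
  qed auto
  moreover have "eventually (\<lambda>e. e \<in> {0<..<1}) (at_right (0::real))"
    by (rule eventually_at_right_real) simp
  ultimately have "eventually (\<lambda>e. e \<in> {0<..<1} \<and> (\<forall>t\<in>set D. cinside (?x e) t \<longrightarrow> cinside p t)) (at_right (0::real))"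
    by eventually_elim auto
  then obtain e' where e': "0 < e'" "e' < 1" "\<forall>t\<in>set D. cinside (?x e') t \<longrightarrow> cinside p t"
    using eventually_happens'[OF trivial_limit_at_right_real] by force
  have "cinside (?x e') h"
  proof -
    have "x + e' * (y - x) \<ge> 0" if "x \<ge> 0" "y \<ge> 0" for x y :: real
    proof -
      have "x + e' * (y - x) = (1 - e') * x + e' * y" by (simp add: algebra_simps)
      then show ?thesis using that e' by simp
    qed
    then show ?thesis using V_hull[OF pq(2)] V_hull[OF pq(3)]
      by (cases h) (auto simp: ori_add_scaleR)
  qed
  then obtain t where t: "t \<in> set D" "cinside (?x e') t" "cinside p t" using covered e'(3) by blast
  obtain a b c where abc: "t = (a, b, c)" by (cases t)
  then have "p \<in> {a, b, c}" using tri_empty[of p a b c] t pq by (auto simp: tri_def)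
  then have "\<exists>u w. tri p u w \<and> cinside (?x e') (p, u, w)"
    using t abc unfolding tri_def by auto
  then obtain u w where uw: "tri p u w" "cinside (?x e') (p, u, w)" by blast
  have "ori p u (?x e') = e' * ori p u q" "ori w p (?x e') = e' * ori w p q"
    by (simp_all add: ori_add_scaleR)
  then have nn: "ori p u q \<ge> 0" "ori w p q \<ge> 0" using uw(2) e' by (auto simp: zero_le_mult_iff)
  note d = triD[OF uw(1)]
  show "e \<in> edges"
  proof (cases "q = u \<or> q = w")
    case True
    then have "e = {p, u} \<or> e = {w, p}" using pq(1) by auto
    moreover have "tri w p u" using tri_rotate[OF tri_rotate[OF uw(1)]] .
    ultimately show ?thesis using uw(1) unfolding edges_tri by metis
  next
    case False
    then have pos: "ori p u q > 0" "ori w p q > 0"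
      using nn planar_ori_nonzero[OF planar, of p u q] planar_ori_nonzero[OF planar, of w p q] d pq by fastforce+
    have "q \<notin> {p, u, w}" using False pq by auto
    then have "\<not> cinside q (p, u, w)" using tri_empty[OF pq(3) uw(1)] by blast
    then have "ori u w q < 0" using pos by auto
    moreover have "ori u w p > 0" "ori p q u < 0" "ori p q w > 0"
      using d(1) ori_rotate[of p u w] ori_swap(2)[of p u q] pos(1) pos(2) ori_rotate[of w p q] by auto
    ultimately have "open_segment p q \<inter> open_segment u w \<noteq> {}"
      by (intro segments_meetI) (auto simp: mult_pos_neg mult_neg_pos)
    moreover have "{p, q} \<noteq> {u, w}" using d by auto
    ultimately have "segments_cross e {u, w}" using pq(1) unfolding segments_cross_def by metis
    moreover have "{u, w} \<in> edges" using tri_rotate[OF uw(1)] unfolding edges_tri by auto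
    then have "{u, w} \<in> T" using T(2) by auto
    ultimately show ?thesis using T(1) eT unfolding noncrossing_segments_def by blast
  qed
qed

theorem triangulation: "triangulation_on V edges"
  unfolding triangulation_on_def using edges_noncrossing edges_maximal by blast

end

section \<open>Strips and pockets\<close>

fun walk :: "('a \<Rightarrow> 'a \<Rightarrow> real) \<Rightarrow> 'a list \<Rightarrow> real" where
  "walk \<phi> (x # y # zs) = \<phi> x y + walk \<phi> (y # zs)"
| "walk \<phi> _ = 0"

lemma walk_append: "walk \<phi> (xs @ y # zs) = walk \<phi> (xs @ [y]) + walk \<phi> (y # zs)"
proof (induction xs)
  case IH: (Cons x xs)
  show ?case
  proof (cases xs)
    case (Cons x' xs')
    then show ?thesis using IH.IH by simp
  qed simp
qed simp

lemma walk_snoc: "walk \<phi> (xs @ [x, y]) = walk \<phi> (xs @ [x]) + \<phi> x y"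
  using walk_append[of \<phi> xs x "[y]"] by simp

lemma walk_rev: "skew \<phi> \<Longrightarrow> walk \<phi> (rev xs) = - walk \<phi> xs"
proof (induction \<phi> xs rule: walk.induct)
  case (1 \<phi> x y zs)
  have "\<phi> y x = - \<phi> x y" using 1(2) unfolding skew_def by blast
  then show ?case using 1 walk_snoc[of \<phi> "rev zs" y x] by simp
qed auto

fun fan :: "'a \<Rightarrow> 'a list \<Rightarrow> ('a \<times> 'a \<times> 'a) list" where
  "fan p (x # y # zs) = (x, y, p) # fan p (y # zs)"
| "fan p _ = []"

lemma skew_same [simp]: "skew \<phi> \<Longrightarrow> \<phi> x x = 0"
proof -
  assume "skew \<phi>"
  then have "\<phi> x x = - \<phi> x x" unfolding skew_def by blast
  then show "\<phi> x x = 0" by simp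
qed

lemma skew_eq: "skew \<phi> \<Longrightarrow> \<phi> c q = - \<phi> q c" unfolding skew_def by blast

lemma sum_fan:
  "skew \<phi> \<Longrightarrow> xs \<noteq> [] \<Longrightarrow> (\<Sum>t\<leftarrow>fan p xs. bd \<phi> t) = walk \<phi> xs + \<phi> (last xs) p + \<phi> p (hd xs)"
proof (induction p xs rule: fan.induct)
  case (1 p x y zs)
  have "\<phi> y p = - \<phi> p y" using 1(2) unfolding skew_def by blast
  then show ?case using 1 by simp
next
  case ("2_2" p v)
  have "\<phi> v p = - \<phi> p v" using "2_2"(1) unfolding skew_def by blast
  then show ?case by simp
qed auto

lemma set_fan: "t \<in> set (fan p xs) \<Longrightarrow> \<exists>i. Suc i < length xs \<and> t = (xs ! i, xs ! Suc i, p)"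
proof (induction p xs rule: fan.induct)
  case (1 p x y zs)
  then consider "t = (x, y, p)" | i where "Suc i < length (y # zs)" "t = ((y # zs) ! i, (y # zs) ! Suc i, p)"
    by auto
  then show ?case
  proof cases
    case 1 then show ?thesis by (intro exI[of _ 0]) auto
  next
    case 2 then show ?thesis by (intro exI[of _ "Suc i"]) auto
  qed
qed auto

lemma subseq_set: "subseq xs ys \<Longrightarrow> set xs \<subseteq> set ys"
  by (induction xs ys rule: list_emb.induct) auto

lemma subseq_distinct: "subseq xs ys \<Longrightarrow> distinct ys \<Longrightarrow> distinct xs"
  by (induction xs ys rule: list_emb.induct) (auto dest: subseq_set)

lemma subseq_appendR: "subseq (xs @ ys) zs \<Longrightarrow> subseq ys zs"
  by (induction xs) (auto dest: subseq_Cons')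

lemma subseq_nth: "i < length xs \<Longrightarrow> subseq [xs ! i] xs"
  by (simp add: subseq_singleton_left)

lemma subseq_nth2: "i < j \<Longrightarrow> j < length xs \<Longrightarrow> subseq [xs ! i, xs ! j] xs"
proof (induction xs arbitrary: i j)
  case (Cons x xs)
  then obtain j' where j: "j = Suc j'" by (cases j) auto
  show ?case
  proof (cases i)
    case 0
    then show ?thesis using Cons.prems j subseq_nth[of j' xs] by simp
  next
    case (Suc i')
    then show ?thesis using Cons.prems Cons.IH[of i' j'] j by (auto dest: subseq_Cons')
  qed
qed simp

lemma subseq_nth3:
  "i < j \<Longrightarrow> j < k \<Longrightarrow> k < length xs \<Longrightarrow> subseq [xs ! i, xs ! j, xs ! k] xs"
proof (induction xs arbitrary: i j k)
  case (Cons x xs)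
  then obtain j' k' where j: "j = Suc j'" "k = Suc k'" by (cases j; cases k) auto
  show ?case
  proof (cases i)
    case 0
    then show ?thesis using Cons.prems j subseq_nth2[of j' k' xs] by simp
  next
    case (Suc i')
    then show ?thesis using Cons.prems Cons.IH[of i' j' k'] j by (auto dest: subseq_Cons')
  qed
qed simp

text \<open>Only identities of the orientation determinant are assumed, so every result below also holds
  for the mirror image \<open>- d\<close>.\<close>

locale chiro =
  fixes d :: "'a \<Rightarrow> 'a \<Rightarrow> 'a \<Rightarrow> real"
  assumes rot: "d a b c = d b c a"
    and sw: "d a b c = - d b a c"
    and four: "d a b p + d b c p + d c a p = d a b c"
    and gr: "d a b c * d a p e - d a b p * d a c e + d a b e * d a c p = 0"
    and lin: "d a b c * d w e p = d b c p * d w e a + d c a p * d w e b + d a b p * d w e c"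
    and cross: "- d c w w' * d a w' w * d q a c + d c w w' * d a w' c * d q a w
       + d c w a * d a w' w * d q w' c - d c w a * d a w' c * d q w' w = 0"
begin

section \<open>Angular order and tangents for an abstract determinant function\<close>

lemma rot': "d a b c = d c a b" using rot by metis
lemma sw2: "d a b c = - d a c b" using rot sw by metis
lemma sw3: "d a b c = - d c b a" using rot sw by metis

lemma same [simp]: "d a a b = 0" "d a b b = 0" "d a b a = 0"
  using sw[of a a b] sw2[of a b b] sw3[of a b a] by linarith+

definition gp :: "'a set \<Rightarrow> bool" where
  "gp V \<longleftrightarrow> (\<forall>a\<in>V. \<forall>b\<in>V. \<forall>c\<in>V. a \<noteq> b \<and> b \<noteq> c \<and> a \<noteq> c \<longrightarrow> d a b c \<noteq> 0)"

lemma gpD: "gp V \<Longrightarrow> a \<in> V \<Longrightarrow> b \<in> V \<Longrightarrow> c \<in> V \<Longrightarrow> a \<noteq> b \<Longrightarrow> b \<noteq> c \<Longrightarrow> a \<noteq> c \<Longrightarrow> d a b c \<noteq> 0"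
  unfolding gp_def by blast

lemma gp_subset: "gp V \<Longrightarrow> W \<subseteq> V \<Longrightarrow> gp W"
  unfolding gp_def by blast

text \<open>Around \<open>a\<close>, the points on one side of the line \<open>ar\<close> are
  ordered linearly by angle; in the Grassmann-Pluecker relation all other factors have known
  signs.\<close>

lemma trans_left:
  assumes "d a r x > 0" "d a r y > 0" "d a r z > 0" "d a x y > 0" "d a y z > 0"
  shows "d a x z > 0"
proof -
  have "d a r y * d a x z = d a r x * d a y z + d a r z * d a x y"
    using gr[of a r x y z] sw2[of a y x] by (smt (verit) gr)
  moreover have "d a r x * d a y z + d a r z * d a x y > 0" using assms by (intro add_pos_pos mult_pos_pos)
  ultimately show ?thesis using assms(2) by (metis zero_less_mult_pos)
qed

lemma trans_right:
  assumes "d a x r > 0" "d a y r > 0" "d a z r > 0" "d a x y > 0" "d a y z > 0"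
  shows "d a x z > 0"
proof -
  have "d a y r * d a x z = d a x r * d a y z + d a z r * d a x y"
    using gr[of a r x y z] sw2[of a r] by (smt (verit) mult_minus_left)
  moreover have "d a x r * d a y z + d a z r * d a x y > 0" using assms by (intro add_pos_pos mult_pos_pos)
  ultimately show ?thesis using assms(2) by (metis zero_less_mult_pos)
qed

text \<open>The first point met by a ray from \<open>e\<close> that starts along \<open>er\<close>
  and turns clockwise. All points lie in an open half-plane, where the angular order at
  \<open>e\<close> is linear and has an extreme element.\<close>

lemma first_hit:
  assumes "finite T" "T \<noteq> {}" "\<And>p. p \<in> T \<Longrightarrow> d e r p < 0" "gp (insert e T)" "e \<notin> T"
  shows "\<exists>w\<in>T. \<forall>p\<in>T - {w}. d e w p < 0"
  using assms
proof (induction T rule: finite_ne_induct)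
  case (insert x T)
  then obtain w where w: "w \<in> T" "\<forall>p\<in>T - {w}. d e w p < 0"
    using gp_subset[of "insert e (insert x T)" "insert e T"] by auto
  have wx: "w \<noteq> x" using w(1) insert by auto
  have nz: "d e w x \<noteq> 0"
    using insert.prems w wx by (intro gpD[OF insert.prems(2)]) auto
  show ?case
  proof (cases "d e w x < 0")
    case True
    then show ?thesis using w by (intro bexI[of _ w]) auto
  next
    case False
    then have xw: "d e x w < 0" using nz sw2[of e w x] by linarith
    have "d e x p < 0" if p: "p \<in> T" for p
    proof (cases "p = w")
      case False
      then have pw: "d e p w > 0" using w p sw2[of e p w] by auto
      have wx': "d e w x > 0" using xw sw2[of e w x] by simp
      have "d e p x > 0"
        using trans_right[of e p r w x] pw wx' insert.prems(1)[of p] insert.prems(1)[of w] insert.prems(1)[of x]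
          sw2[of e p r] sw2[of e w r] sw2[of e x r] p w by simp
      then show ?thesis using sw2[of e x p] by simp
    qed (use xw in auto)
    then show ?thesis using insert.hyps by (intro bexI[of _ x]) auto
  qed
qed auto

text \<open>While \<open>as\<close> grows, each new point is separated from all former ones by a line through the
  last one, hence it sees the last one from outside their hull.\<close>

definition peeled :: "'a \<Rightarrow> 'a list \<Rightarrow> bool" where
  "peeled q as \<longleftrightarrow> (\<forall>xs x y ys. as = xs @ x # y # ys \<longrightarrow>
     (\<exists>w. (\<forall>p\<in>insert q (set xs). d w x p < 0) \<and> d w x y > 0))"

lemma peeled_snoc:
  assumes "peeled q as" "as \<noteq> []" "\<forall>p\<in>insert q (set (butlast as)). d w (last as) p < 0" "d w (last as) y > 0"
  shows "peeled q (as @ [y])"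
  unfolding peeled_def
proof (intro allI impI)
  fix xs x z ys assume e: "as @ [y] = xs @ x # z # ys"
  show "\<exists>w. (\<forall>p\<in>insert q (set xs). d w x p < 0) \<and> d w x z > 0"
  proof (cases ys rule: rev_cases)
    case Nil
    then have "as = xs @ [x]" "z = y" using e by auto
    then show ?thesis using assms by auto
  next
    case (snoc ys' u)
    then have "as = xs @ x # z # ys'" using e by simp
    then show ?thesis using assms(1) unfolding peeled_def by blast
  qed
qed

lemma neg_chiro: "chiro (\<lambda>a b c. - d a b c)"
proof
  fix a b c p e w q w'
  show "- d a b c = - d b c a" by (rule arg_cong[OF rot])
  show "- d a b c = - (- d b a c)" by (rule arg_cong[OF sw])
  show "- d a b p + - d b c p + - d c a p = - d a b c" using four[of a b p c] by linarith
  show "- d a b c * - d a p e - (- d a b p) * - d a c e + - d a b e * - d a c p = 0"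
    using gr[of a b c p e] by simp
  show "- d a b c * - d w e p = - d b c p * - d w e a + - d c a p * - d w e b + - d a b p * - d w e c"
    using lin[of a b c w e p] by simp
  show "- (- d c w w') * - d a w' w * - d q a c + - d c w w' * - d a w' c * - d q a w
       + - d c w a * - d a w' w * - d q w' c - (- d c w a) * - d a w' c * - d q w' w = 0"
    using cross[of c w w' a q] by simp
qed

text \<open>The region between two paths from \<open>q\<close>, closed by the outer edge
  \<open>ac\<close>. The lists hold the points of either side in the reverse order of their removal,
  since this order makes the paths \<open>peeled\<close>.\<close>

definition is_strip :: "'a \<Rightarrow> 'a set \<Rightarrow> 'a set \<Rightarrow> 'a \<Rightarrow> 'a \<Rightarrow> 'a list \<Rightarrow> 'a list \<Rightarrow> ('a \<times> 'a \<times> 'a) list \<Rightarrow> bool" where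
  "is_strip q A B a c as bs D \<longleftrightarrow>
     distinct as \<and> set as = A \<and> as \<noteq> [] \<and> last as = a \<and>
     distinct bs \<and> set bs = B \<and> bs \<noteq> [] \<and> last bs = c \<and>
     (\<forall>\<phi>. skew \<phi> \<longrightarrow> (\<Sum>t\<leftarrow>D. bd \<phi> t) = walk \<phi> (q # as) + \<phi> a c - walk \<phi> (q # bs)) \<and>
     (\<forall>x y z. (x, y, z) \<in> set D \<longrightarrow> d x y z > 0 \<and>
        (subseq [x, y] (q # as) \<and> z \<in> B \<or> subseq [z, y] (q # bs) \<and> x \<in> A)) \<and>
     A \<union> B \<subseteq> \<Union> (corners ` set D) \<and>
     peeled q as \<and> chiro.peeled (\<lambda>a b c. - d a b c) q bs"

lemma is_stripD:
  assumes "is_strip q A B a c as bs D"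
  shows "distinct as" "set as = A" "as \<noteq> []" "last as = a"
     "distinct bs" "set bs = B" "bs \<noteq> []" "last bs = c"
     "\<And>\<phi>. skew \<phi> \<Longrightarrow> (\<Sum>t\<leftarrow>D. bd \<phi> t) = walk \<phi> (q # as) + \<phi> a c - walk \<phi> (q # bs)"
     "\<And>x y z. (x, y, z) \<in> set D \<Longrightarrow> d x y z > 0 \<and>
        (subseq [x, y] (q # as) \<and> z \<in> B \<or> subseq [z, y] (q # bs) \<and> x \<in> A)"
     "A \<union> B \<subseteq> \<Union> (corners ` set D)" "peeled q as" "chiro.peeled (\<lambda>a b c. - d a b c) q bs"
  using assms unfolding is_strip_def by (elim conjE; simp)+

text \<open>Draw the tangents from \<open>c\<close> and from \<open>a\<close> to the remaining
  points. If the one from \<open>c\<close> touches \<open>A\<close>, the point \<open>a\<close> can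
  be cut off by a triangle and the tangent becomes the outer edge; symmetrically, if the one from
  \<open>a\<close> touches \<open>B\<close>, the point \<open>c\<close> can be cut off.\<close>

lemma strip:
  assumes "finite A" "finite B" "a \<in> A" "c \<in> B" "gp (insert q (A \<union> B))"
    and "\<And>x y. x \<in> A \<Longrightarrow> y \<in> B \<Longrightarrow> d q x y > 0"
    and "\<And>p. p \<in> A \<union> B - {a, c} \<Longrightarrow> d c a p < 0"
  shows "\<exists>as bs D. is_strip q A B a c as bs D"
  using assms
proof (induction "card A + card B" arbitrary: A B a c rule: less_induct)
  case less
  note prems = less.prems
  interpret neg: chiro "\<lambda>a b c. - d a b c" by (rule neg_chiro)
  have disj: "x \<noteq> y" if "x \<in> A" "y \<in> B" for x y using prems(6)[OF that] by auto
  have q: "q \<notin> A" "q \<notin> B" using prems(3,4,6) by fastforce+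
  have ac: "d c a q < 0" using prems(6)[OF prems(3,4)] sw3[of c a q] by simp
  define T where "T = A \<union> B - {a, c}"
  have T: "finite T" using prems by (simp add: T_def)
  show ?case
  proof (cases "T = {}")
    case True
    then have AB: "A = {a}" "B = {c}" using prems(3,4) disj by (auto simp: T_def)
    have "peeled q [a]" "neg.peeled q [c]"
      unfolding peeled_def neg.peeled_def by (auto simp: Cons_eq_append_conv)
    then show ?thesis using AB prems(6)[OF prems(3,4)] unfolding is_strip_def
      by (intro exI[of _ "[a]"] exI[of _ "[c]"] exI[of _ "[(q, a, c)]"])
        (auto dest: skew_eq[of _ c q])
  next
    case False
    have gpT: "gp (insert x T)" if "x \<in> A \<union> B" for x
      using that by (intro gp_subset[OF prems(5)]) (auto simp: T_def)
    obtain w where w: "w \<in> T" "\<forall>p\<in>T - {w}. d c w p < 0"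
      using first_hit[OF T False, of c a] prems gpT[of c] by (auto simp: T_def)
    have neg_gp: "neg.gp V \<longleftrightarrow> gp V" for V unfolding neg.gp_def gp_def by auto
    have "d a c p > 0" if "p \<in> T" for p using prems(7)[of p] that sw[of c a p] by (auto simp: T_def)
    then obtain w' where w': "w' \<in> T" "\<forall>p\<in>T - {w'}. d a w' p > 0"
      using neg.first_hit[OF T False, of a c] gpT[of a] prems(3) neg_gp by (auto simp: T_def)
    \<comment> \<open>Otherwise the segments \<open>cw\<close> in \<open>B\<close> and
      \<open>aw'\<close> in \<open>A\<close> cross, although \<open>q\<close> sees all of
      \<open>A\<close> before all of \<open>B\<close>. The identity \<open>cross\<close> expands
      \<open>d q m m = 0\<close> for their common point \<open>m\<close>, and the signs make all
      four terms positive.\<close>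
    have "w \<in> A \<or> w' \<in> B"
    proof (rule ccontr)
      assume "\<not> ?thesis"
      then have m: "w \<in> B" "w' \<in> A" "w \<noteq> c" "w' \<noteq> a" "w \<noteq> w'"
        using w(1) w'(1) disj by (auto simp: T_def)
      have 1: "- d c w w' > 0" using w(2) w'(1) m by auto
      have 2: "d a w' w > 0" using w'(2) w(1) m by auto
      have 3: "d c w a > 0" using prems(7)[of w] w(1) sw2[of c a w] by (auto simp: T_def)
      have 4: "- d a w' c > 0" using prems(7)[of w'] w'(1) rot[of c a w'] by (auto simp: T_def)
      have "(- d c w w') * d a w' w * d q a c > 0" "(- d c w w') * (- d a w' c) * d q a w > 0"
        "d c w a * d a w' w * d q w' c > 0" "d c w a * (- d a w' c) * d q w' w > 0"
        by (intro mult_pos_pos 1 2 3 4 prems(6) prems(3,4) m)+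
      then show False using cross[of c w w' a q] by simp
    qed
    then show ?thesis
    proof
      assume wA: "w \<in> A"
      then have wa: "w \<noteq> a" using w(1) by (auto simp: T_def)
      have sz: "card (A - {a}) + card B < card A + card B"
        using prems(1,3) card_gt_0_iff[of A] by (auto simp: card_Diff_singleton)
      have front: "d c w p < 0" if "p \<in> A - {a} \<union> B - {w, c}" for p
        using w(2) that disj prems(3) by (auto simp: T_def)
      have "\<exists>as bs D. is_strip q (A - {a}) B w c as bs D"
        using w wA wa prems front by (intro less.hyps[OF sz]) (auto simp: T_def intro: gp_subset[OF prems(5)])
      then obtain as bs D where "is_strip q (A - {a}) B w c as bs D" by blast
      note I = is_stripD[OF this]
      have split: "as = butlast as @ [w]" using I(3,4) by (metis append_butlast_last_id)
      have "d c a w < 0" using prems(7)[of w] w(1) by (auto simp: T_def)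
      then have waw: "d w a c > 0" "d c w a > 0" using rot[of c a w] sw[of a w c] sw2[of c a w] by auto
      have e: "as @ [a] = butlast as @ [w, a]" by (subst split) simp
      \<comment> \<open>The tangent \<open>cw\<close> is the required line through the last point
        \<open>w\<close>: it separates \<open>a\<close> from \<open>q\<close> and all earlier
        points.\<close>
      have pl: "peeled q (as @ [a])"
      proof (rule peeled_snoc[OF I(12,3), of c])
        show "\<forall>p\<in>insert q (set (butlast as)). d c (last as) p < 0"
        proof
          fix p assume "p \<in> insert q (set (butlast as))"
          moreover have "d c w q < 0" using prems(6)[OF wA prems(4)] sw3[of c w q] by simp
          moreover have "d c w p < 0" if p: "p \<in> set (butlast as)"
          proof -
            have "p \<in> A - {a}" using p I(2) in_set_butlastD by fast
            moreover have "w \<notin> set (butlast as)" using I(1) split by (metis distinct_append not_distinct_conv_prefix)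
            ultimately show ?thesis using w(2) prems(4) disj p by (auto simp: T_def)
          qed
          ultimately show "d c (last as) p < 0" using I(4) by auto
        qed
        show "d c (last as) a > 0" using waw I(4) by simp
      qed
      have sum: "(\<Sum>t\<leftarrow>D @ [(w, a, c)]. bd \<phi> t) = walk \<phi> (q # as @ [a]) + \<phi> a c - walk \<phi> (q # bs)"
        if "skew \<phi>" for \<phi>
        using I(9)[OF that] walk_snoc[of \<phi> "q # butlast as" w a] split skew_eq[OF that, of c w] by (simp add: e)
      have sub: "subseq [w, a] (q # as @ [a])"
      proof -
        have "subseq ((q # butlast as) @ [w, a]) (q # as @ [a])" by (simp add: e)
        then show ?thesis by (rule subseq_appendR)
      qed
      have old: "d x y z > 0 \<and> (subseq [x, y] (q # as @ [a]) \<and> z \<in> B \<or> subseq [z, y] (q # bs) \<and> x \<in> A)"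
        if "(x, y, z) \<in> set D" for x y z
        using I(10)[OF that] subseq_rev_drop_many[of "[x, y]" "q # as" "[a]"] by auto
      have "is_strip q A B a c (as @ [a]) bs (D @ [(w, a, c)])"
        unfolding is_strip_def
      proof (intro conjI)
        show "\<forall>\<phi>. skew \<phi> \<longrightarrow> (\<Sum>t\<leftarrow>D @ [(w, a, c)]. bd \<phi> t) = walk \<phi> (q # as @ [a]) + \<phi> a c - walk \<phi> (q # bs)"
          using sum by blast
        show "\<forall>x y z. (x, y, z) \<in> set (D @ [(w, a, c)]) \<longrightarrow> d x y z > 0 \<and>
          (subseq [x, y] (q # as @ [a]) \<and> z \<in> B \<or> subseq [z, y] (q # bs) \<and> x \<in> A)"
          using old sub waw prems(4) by (metis Un_iff empty_iff insert_iff list.set prod.inject set_append)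
        show "A \<union> B \<subseteq> \<Union> (corners ` set (D @ [(w, a, c)]))" using I(11) by auto
      qed (use I(1-8,13) prems(3) pl in simp_all, blast?)
      then show ?thesis by blast
    next
      assume wB: "w' \<in> B"
      then have wc: "w' \<noteq> c" using w'(1) by (auto simp: T_def)
      have sz: "card A + card (B - {c}) < card A + card B"
        using prems(2,4) card_gt_0_iff[of B] by (auto simp: card_Diff_singleton)
      have front: "d w' a p < 0" if "p \<in> A \<union> (B - {c}) - {a, w'}" for p
        using w'(2) that disj prems(4) sw[of w' a p] by (auto simp: T_def)
      have "\<exists>as bs D. is_strip q A (B - {c}) a w' as bs D"
        using w' wB wc prems front by (intro less.hyps[OF sz]) (auto simp: T_def intro: gp_subset[OF prems(5)])
      then obtain as bs D where "is_strip q A (B - {c}) a w' as bs D" by blast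
      note I = is_stripD[OF this]
      have split: "bs = butlast bs @ [w']" using I(7,8) by (metis append_butlast_last_id)
      have "d c a w' < 0" using prems(7)[of w'] w'(1) by (auto simp: T_def)
      then have waw: "d a c w' > 0" "- d a w' c > 0"
        using rot[of c a w'] sw[of c a w'] sw[of w' a c] by auto
      have e: "bs @ [c] = butlast bs @ [w', c]" by (subst split) simp
      have pl: "neg.peeled q (bs @ [c])"
      proof (rule neg.peeled_snoc[OF I(13,7), of a])
        show "\<forall>p\<in>insert q (set (butlast bs)). - d a (last bs) p < 0"
        proof
          fix p assume "p \<in> insert q (set (butlast bs))"
          moreover have "d a w' q > 0" using prems(6)[OF prems(3) wB] rot[of q a w'] by simp
          moreover have "d a w' p > 0" if p: "p \<in> set (butlast bs)"
          proof -
            have "p \<in> B - {c}" using p I(6) in_set_butlastD by fast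
            moreover have "w' \<notin> set (butlast bs)" using I(5) split by (metis distinct_append not_distinct_conv_prefix)
            ultimately show ?thesis using w'(2) prems(3) disj p by (auto simp: T_def)
          qed
          ultimately show "- d a (last bs) p < 0" using I(8) by auto
        qed
        show "- d a (last bs) c > 0" using waw I(8) by simp
      qed
      have sum: "(\<Sum>t\<leftarrow>D @ [(a, c, w')]. bd \<phi> t) = walk \<phi> (q # as) + \<phi> a c - walk \<phi> (q # bs @ [c])"
        if "skew \<phi>" for \<phi>
        using I(9)[OF that] walk_snoc[of \<phi> "q # butlast bs" w' c] split skew_eq[OF that, of a w']
          skew_eq[OF that, of c w'] by (simp add: e)
      have sub: "subseq [w', c] (q # bs @ [c])"
      proof -
        have "subseq ((q # butlast bs) @ [w', c]) (q # bs @ [c])" by (simp add: e)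
        then show ?thesis by (rule subseq_appendR)
      qed
      have old: "d x y z > 0 \<and> (subseq [x, y] (q # as) \<and> z \<in> B \<or> subseq [z, y] (q # bs @ [c]) \<and> x \<in> A)"
        if "(x, y, z) \<in> set D" for x y z
        using I(10)[OF that] subseq_rev_drop_many[of "[z, y]" "q # bs" "[c]"] by auto
      have "is_strip q A B a c as (bs @ [c]) (D @ [(a, c, w')])"
        unfolding is_strip_def
      proof (intro conjI)
        show "\<forall>\<phi>. skew \<phi> \<longrightarrow> (\<Sum>t\<leftarrow>D @ [(a, c, w')]. bd \<phi> t) = walk \<phi> (q # as) + \<phi> a c - walk \<phi> (q # bs @ [c])"
          using sum by blast
        show "\<forall>x y z. (x, y, z) \<in> set (D @ [(a, c, w')]) \<longrightarrow> d x y z > 0 \<and>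
          (subseq [x, y] (q # as) \<and> z \<in> B \<or> subseq [z, y] (q # bs @ [c]) \<and> x \<in> A)"
          using old sub waw prems(3) by (metis Un_iff empty_iff insert_iff list.set prod.inject set_append)
        show "A \<union> B \<subseteq> \<Union> (corners ` set (D @ [(a, c, w')]))" using I(11) by auto
      qed (use I(1-8,12) prems(4) pl in simp_all, blast?)
      then show ?thesis by blast
    qed
  qed
qed

section \<open>Convex funnels and star-shaped paths\<close>

definition cvx :: "'a list \<Rightarrow> bool" where
  "cvx F \<longleftrightarrow> (\<forall>i j k. i < j \<longrightarrow> j < k \<longrightarrow> k < length F \<longrightarrow> d (F ! i) (F ! j) (F ! k) > 0)"

lemma cvxD: "cvx F \<Longrightarrow> i < j \<Longrightarrow> j < k \<Longrightarrow> k < length F \<Longrightarrow> d (F ! i) (F ! j) (F ! k) > 0"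
  unfolding cvx_def by blast

text \<open>Otherwise \<open>p\<close> would lie in the cone at \<open>e\<close> spanned by the start of the chain and the vertex
  where the visible edges stop, so no line through \<open>e\<close> could separate \<open>p\<close> from the chain.\<close>

lemma visible_suffix:
  assumes F: "cvx F" and k: "Suc (Suc k) < length F" and e: "e = last F"
    and w: "\<And>f. f \<in> set F - {e} \<Longrightarrow> d w e f < 0" "d w e p > 0"
    and r: "\<And>f. f \<in> set (tl F) \<Longrightarrow> d (hd F) f r > 0" "d (hd F) p r > 0"
    and neg: "d (F ! k) (F ! Suc k) p < 0" and nz: "d (F ! Suc k) (F ! Suc (Suc k)) p \<noteq> 0"
    and dist: "distinct F"
  shows "d (F ! Suc k) (F ! Suc (Suc k)) p < 0"
proof (rule ccontr)
  let ?b = "F ! Suc k" and ?f = "F ! k" and ?g = "F ! Suc (Suc k)" and ?h = "F ! 0"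
  assume "\<not> ?thesis"
  then have pos: "d ?b ?g p > 0" using nz by linarith
  define n where "n = length F - 1"
  have eF: "e = F ! n" "n < length F" "Suc (Suc k) \<le> n"
    using e k last_conv_nth[of F] by (cases "F = []"; auto simp: n_def)+
  have bp: "d ?b ?f p > 0" using neg sw[of ?f ?b p] by simp
  have bgf: "d ?b ?g ?f > 0" using cvxD[OF F, of k "Suc k" "Suc (Suc k)"] k rot[of ?f ?b ?g] by simp
  have hbp: "d ?h ?b p < 0"
  proof (cases "k = 0")
    case False
    have "d ?b ?h p > 0"
    proof (rule trans_left[of ?b ?g ?h ?f p])
      show "d ?b ?g ?h > 0" using cvxD[OF F, of 0 "Suc k" "Suc (Suc k)"] k rot[of ?h ?b ?g] by simp
      show "d ?b ?h ?f > 0" using cvxD[OF F, of 0 k "Suc k"] k False rot[of ?b ?h ?f] by simp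
    qed (use bgf pos bp in auto)
    then show ?thesis using sw[of ?h ?b p] by simp
  qed (use neg in simp)
  have bep: "d ?b e p > 0"
  proof (cases "Suc (Suc k) = n")
    case False
    then have n: "Suc (Suc k) < n" using eF by simp
    show ?thesis
    proof (rule trans_left[of ?b ?g e ?f p])
      show "d ?b ?g e > 0" using cvxD[OF F, of "Suc k" "Suc (Suc k)" n] eF n by simp
      show "d ?b e ?f > 0" using cvxD[OF F, of k "Suc k" n] eF n rot[of ?f ?b e] by simp
    qed (use bgf pos bp in auto)
  qed (use pos eF in simp)
  have hbe: "d ?h ?b e > 0" using cvxD[OF F, of 0 "Suc k" n] eF by simp
  have hd: "hd F = ?h" using k by (cases F) auto
  have tl: "F ! i \<in> set (tl F)" if "0 < i" "i < length F" for i
    using that by (cases F) (auto simp: nth_Cons')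
  have "d ?h p e > 0"
  proof (rule trans_right[of ?h p r ?b e])
    show "d ?h p ?b > 0" using hbp sw2[of ?h p ?b] by simp
  qed (use r hd tl eF k hbe in auto)
  then have 1: "d e ?h p > 0" using rot[of ?h p e] rot[of p e ?h] by simp
  have 2: "d e p ?b > 0" using bep rot[of ?b e p] by simp
  have 3: "d e ?h ?b > 0" using hbe rot[of ?h ?b e] rot[of ?b e ?h] by simp
  have ne: "F ! i \<noteq> e" if "i < n" for i
    using that eF dist nth_eq_iff_index_eq by fastforce
  have mem: "?h \<in> set F" "?b \<in> set F" using k by (auto intro!: nth_mem)
  have 4: "d e w ?h > 0" "d e w ?b > 0" "d e w p < 0"
    using w(1)[of ?h] w(1)[of ?b] w(2) ne[of 0] ne[of "Suc k"] eF k
      sw[of e w ?h] sw[of e w ?b] sw[of e w p] mem by auto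
  have "d e w ?h * d e p ?b > 0" "d e w p * d e ?h ?b < 0" "d e w ?b * d e ?h p > 0"
    using 1 2 3 4 by (auto intro: mult_pos_pos mult_neg_pos)
  then show False using gr[of e w ?h p ?b] by linarith
qed

text \<open>The edges that have \<open>p\<close> on their right form a final segment of the chain,
  starting at \<open>j\<close>. Going straight from \<open>F ! j\<close> to \<open>p\<close> keeps
  the chain convex, and the edges given up are those over which a fan with apex \<open>p\<close> can
  be placed.\<close>

lemma extend_cvx:
  assumes F: "cvx F" "length F \<ge> 2" "distinct F" and e: "e = last F"
    and w: "\<And>f. f \<in> set F - {e} \<Longrightarrow> d w e f < 0" "d w e p > 0"
    and r: "\<And>f. f \<in> set (tl F) \<Longrightarrow> d (hd F) f r > 0" "d (hd F) p r > 0"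
    and gp: "gp (insert p (set F))" and p: "p \<notin> set F"
  shows "\<exists>j<length F. cvx (take (Suc j) F @ [p]) \<and>
           (\<forall>i. j \<le> i \<longrightarrow> Suc i < length F \<longrightarrow> d (F ! i) (F ! Suc i) p < 0)"
proof -
  let ?E = "\<lambda>i. d (F ! i) (F ! Suc i) p"
  have ne: "F ! i \<noteq> F ! j" if "i < j" "j < length F" for i j
    using that F(3) nth_eq_iff_index_eq by fastforce
  have nz: "d (F ! i) (F ! j) p \<noteq> 0" if "i < j" "j < length F" for i j
    using that p ne[OF that] by (intro gpD[OF gp]) auto
  have step: "?E (Suc i) < 0" if "?E i < 0" "Suc (Suc i) < length F" for i
    using visible_suffix[OF F(1) that(2) e w r that(1) _ F(3)] nz[of "Suc i" "Suc (Suc i)"] that by auto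
  define j where "j = (LEAST i. i = length F - 1 \<or> ?E i < 0)"
  have j: "j = length F - 1 \<or> ?E j < 0" unfolding j_def by (rule LeastI[of _ "length F - 1"]) simp
  have jl: "j \<le> length F - 1" unfolding j_def by (rule Least_le) simp
  have below: "?E i > 0" if "i < j" for i
  proof -
    have "\<not> (i = length F - 1 \<or> ?E i < 0)" using not_less_Least[of i] that j_def by auto
    moreover have "?E i \<noteq> 0" using that jl F(2) by (intro nz) auto
    ultimately show ?thesis by linarith
  qed
  have above: "?E i < 0" if "j \<le> i" "Suc i < length F" for i
    using that
  proof (induction i)
    case 0 then show ?case using j by auto
  next
    case (Suc i)
    then show ?case using j step[of i] by (cases "j \<le> i") (auto simp: le_Suc_eq)
  qed
  have we: "d w e f \<le> 0" if "f \<in> set F" for f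
    using w(1)[of f] that by (cases "f = e") auto
  have pos: "d (F ! i) (F ! k) p > 0" if "i < k" "k \<le> j" for i k
    using that
  proof (induction k)
    case (Suc k)
    show ?case
    proof (cases "i = k")
      case True
      then show ?thesis using below Suc by auto
    next
      case False
      then have ik: "i < k" "Suc k < length F" using Suc jl F(2) by auto
      have IH: "d (F ! i) (F ! k) p > 0" using Suc ik by simp
      show ?thesis
      proof (rule ccontr)
        assume "\<not> ?thesis"
        then have a: "d (F ! Suc k) (F ! i) p > 0"
          using nz[of i "Suc k"] ik sw[of "F ! Suc k" "F ! i" p] by simp
        have b: "?E k > 0" using below Suc by simp
        have c: "d (F ! i) (F ! k) (F ! Suc k) > 0" using cvxD[OF F(1)] ik by simp
        \<comment> \<open>Here \<open>p\<close> would be a combination, with non-negative weights,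
          of three points of \<open>F\<close>; none of these is to the left of \<open>we\<close>,
          but \<open>p\<close> is. \<open>lin\<close> expresses \<open>d w e p\<close> in these
          barycentric coordinates.\<close>
        have "d (F ! i) (F ! k) (F ! Suc k) * d w e p > 0" using c w(2) by simp
        moreover have "?E k * d w e (F ! i) \<le> 0" "d (F ! Suc k) (F ! i) p * d w e (F ! k) \<le> 0"
          "d (F ! i) (F ! k) p * d w e (F ! Suc k) \<le> 0"
          using a b IH we[of "F ! i"] we[of "F ! k"] we[of "F ! Suc k"] ik by (auto intro: mult_nonneg_nonpos)
        ultimately show False using lin[of "F ! i" "F ! k" "F ! Suc k" w e p] by linarith
      qed
    qed
  qed simp
  have "cvx (take (Suc j) F @ [p])"
    unfolding cvx_def
  proof (intro allI impI)
    fix i k l assume a: "i < k" "k < l" "l < length (take (Suc j) F @ [p])"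
    have len: "length (take (Suc j) F) = Suc j" using jl F(2) by simp
    show "d ((take (Suc j) F @ [p]) ! i) ((take (Suc j) F @ [p]) ! k) ((take (Suc j) F @ [p]) ! l) > 0"
    proof (cases "l = Suc j")
      case True
      then show ?thesis using a len pos[of i k] by (simp add: nth_append)
    next
      case False
      then show ?thesis using a len cvxD[OF F(1), of i k l] by (simp add: nth_append)
    qed
  qed
  then show ?thesis using above jl F(2) by (intro exI[of _ j]) auto
qed

definition is_funnel :: "'a \<Rightarrow> 'a list \<Rightarrow> 'a list \<Rightarrow> ('a \<times> 'a \<times> 'a) list \<Rightarrow> bool" where
  "is_funnel q as F T \<longleftrightarrow> cvx (q # F) \<and> F \<noteq> [] \<and> last F = last as \<and> subseq F as \<and>
     (\<forall>\<phi>. skew \<phi> \<longrightarrow> (\<Sum>t\<leftarrow>T. bd \<phi> t) = walk \<phi> (q # as) - walk \<phi> (q # F)) \<and>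
     (\<forall>x y z. (x, y, z) \<in> set T \<longrightarrow> d x y z < 0 \<and> subseq [x, y, z] (q # as))"

lemma is_funnelD:
  assumes "is_funnel q as F T"
  shows "cvx (q # F)" "F \<noteq> []" "last F = last as" "subseq F as"
     "\<And>\<phi>. skew \<phi> \<Longrightarrow> (\<Sum>t\<leftarrow>T. bd \<phi> t) = walk \<phi> (q # as) - walk \<phi> (q # F)"
     "\<And>x y z. (x, y, z) \<in> set T \<Longrightarrow> d x y z < 0 \<and> subseq [x, y, z] (q # as)"
  using assms unfolding is_funnel_def by (elim conjE; simp)+

text \<open>The points are appended one by one. Peeling supplies the line through the last vertex
  that an extension of the convex chain needs; the side condition on \<open>r\<close> supplies the
  linear angular order at \<open>q\<close>.\<close>

lemma funnel:
  assumes "peeled q as" "as \<noteq> []" "distinct (q # as)" "gp (insert q (set as))" "\<And>x. x \<in> set as \<Longrightarrow> d q x r > 0"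
  shows "\<exists>F T. is_funnel q as F T"
  using assms
proof (induction as rule: rev_induct)
  case (snoc p as)
  show ?case
  proof (cases "as = []")
    case True
    then show ?thesis by (intro exI[of _ "[p]"] exI[of _ "[]"]) (auto simp: cvx_def is_funnel_def)
  next
    case False
    define e where "e = last as"
    have as: "as = butlast as @ [e]" using False by (simp add: e_def)
    have "peeled q as" using snoc.prems(1) unfolding peeled_def by (metis append.assoc append_Cons)
    then have "\<exists>F T. is_funnel q as F T"
      using snoc.prems by (intro snoc.IH False gp_subset[OF snoc.prems(4)]) auto
    then obtain F T where "is_funnel q as F T" by blast
    note I = is_funnelD[OF this]
    have ep: "as @ [p] = butlast as @ e # p # []" using arg_cong[OF as, of "\<lambda>l. l @ [p]"] by simp
    then obtain w where w: "\<forall>x\<in>insert q (set (butlast as)). d w e x < 0" "d w e p > 0"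
      using snoc.prems(1)[unfolded peeled_def, rule_format, OF ep] by blast
    have Fas: "set F \<subseteq> set as" using I(4) by (rule subseq_set)
    have dF: "distinct (q # F)" using snoc.prems(3) I(4) Fas subseq_distinct by auto
    have "\<exists>j<length (q # F). cvx (take (Suc j) (q # F) @ [p]) \<and>
           (\<forall>i. j \<le> i \<longrightarrow> Suc i < length (q # F) \<longrightarrow> d ((q # F) ! i) ((q # F) ! Suc i) p < 0)"
    proof (rule extend_cvx[OF I(1) _ dF, of e w p r])
      show "2 \<le> length (q # F)" using I(2) by (cases F) auto
      show "e = last (q # F)" using I(2,3) by (simp add: e_def)
      show "d w e f < 0" if "f \<in> set (q # F) - {e}" for f
        using that w(1) Fas arg_cong[OF as, of set] by auto
      show "gp (insert p (set (q # F)))" using Fas by (intro gp_subset[OF snoc.prems(4)]) auto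
    qed (use w(2) snoc.prems Fas in auto)
    then obtain j where j: "j < length (q # F)" "cvx (take (Suc j) (q # F) @ [p])"
      "\<And>i. j \<le> i \<Longrightarrow> Suc i < length (q # F) \<Longrightarrow> d ((q # F) ! i) ((q # F) ! Suc i) p < 0" by blast
    define G where "G = drop j (q # F)"
    have G: "G \<noteq> []" "hd G = (q # F) ! j" "last G = e"
      using j(1) I(2,3) by (auto simp: G_def hd_drop_conv_nth e_def simp del: drop_Cons)
    have sub: "subseq (q # F) (q # as)" using I(4) by simp
    have spl: "q # F = take j (q # F) @ G" "take (Suc j) (q # F) = take j (q # F) @ [hd G]"
      using j(1) G(2) take_Suc_conv_app_nth[of j "q # F"] by (auto simp: G_def simp del: take_Suc_Cons drop_Cons)
    have "walk \<phi> (q # as @ [p]) = walk \<phi> (q # as) + \<phi> e p" for \<phi>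
      using walk_snoc[of \<phi> "q # butlast as" e p] as by (simp add: ep del: append_assoc)
    moreover have "walk \<phi> (q # F) = walk \<phi> (take j (q # F) @ [hd G]) + walk \<phi> G" for \<phi>
      using walk_append[of \<phi> "take j (q # F)" "hd G" "tl G"] spl(1) G(1) by simp
    moreover have "walk \<phi> (take j (q # F) @ [hd G, p]) = walk \<phi> (take j (q # F) @ [hd G]) + \<phi> (hd G) p" for \<phi>
      by (rule walk_snoc)
    moreover have "q # take j F @ [p] = take j (q # F) @ [hd G, p]"
      using arg_cong[OF spl(2), of "\<lambda>l. l @ [p]"] by simp
    then have "walk \<phi> (q # take j F @ [p]) = walk \<phi> (take j (q # F) @ [hd G, p])" for \<phi> by (simp only:)
    ultimately have sum: "(\<Sum>t\<leftarrow>T @ fan p G. bd \<phi> t) = walk \<phi> (q # as @ [p]) - walk \<phi> (q # take j F @ [p])"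
      if "skew \<phi>" for \<phi>
      using I(5)[OF that] sum_fan[OF that G(1), of p] G(3) skew_eq[OF that, of p "hd G"] by simp
    have fan: "d x y z < 0 \<and> subseq [x, y, z] (q # as @ [p])" if t: "(x, y, z) \<in> set (fan p G)" for x y z
    proof -
      obtain i where i: "Suc i < length G" "x = G ! i" "y = G ! Suc i" "z = p"
        using set_fan[OF t] by auto
      then have "x = (q # F) ! (j + i)" "y = (q # F) ! Suc (j + i)" "Suc (j + i) < length (q # F)"
        using j(1) by (auto simp: G_def simp del: drop_Cons nth_Cons_Suc)
      moreover have "subseq [x, y] (q # as)"
        using subseq_order.order_trans[OF subseq_nth2[of "j + i" "Suc (j + i)" "q # F"] sub] calculation by simp
      then have "subseq ([x, y] @ [p]) ((q # as) @ [p])" by (metis subseq_append)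
      ultimately show ?thesis using j(3)[of "j + i"] i(4) by simp
    qed
    have "subseq (take j F) as" using I(4) subseq_order.order_trans[OF _ I(4)] by (metis append_take_drop_id subseq_rev_drop_many subseq_order.refl)
    then have "subseq (take j F @ [p]) (as @ [p])" by simp
    then show ?thesis unfolding is_funnel_def using j(2) sum fan I(6) subseq_rev_drop_many[of _ "q # as" "[p]"]
      by (intro exI[of _ "take j F @ [p]"] exI[of _ "T @ fan p G"]) auto
  qed
qed simp

text \<open>The path is seen in angular order from \<open>a\<close>, above the base that joins its
  ends. An inner vertex \<open>q\<close> of maximal height is an ear: if it lay beyond the segment
  between its neighbours \<open>p\<close> and \<open>r\<close>, seen from \<open>a\<close>, the
  height would fall on the way from \<open>a\<close> through \<open>pr\<close> to \<open>q\<close>,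
  so \<open>p\<close> or \<open>r\<close> would be higher than \<open>q\<close>. Cutting off ears
  leaves the base.\<close>

lemma mountain:
  assumes "length M \<ge> 2" "distinct M" "sorted_wrt (\<lambda>x y. d a x y > 0) M" "gp (set M)"
    "\<And>x. x \<in> set M \<Longrightarrow> x \<noteq> hd M \<Longrightarrow> x \<noteq> last M \<Longrightarrow> d (hd M) (last M) x > 0"
  shows "\<exists>T. (\<forall>\<phi>. skew \<phi> \<longrightarrow> (\<Sum>t\<leftarrow>T. bd \<phi> t) = walk \<phi> M - \<phi> (hd M) (last M)) \<and>
     (\<forall>x y z. (x, y, z) \<in> set T \<longrightarrow> d x y z < 0 \<and> subseq [x, y, z] M)"
  using assms
proof (induction "length M" arbitrary: M rule: less_induct)
  case less
  note prems = less.prems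
  define n where "n = length M"
  define H where "H = (\<lambda>x. d (hd M) (last M) x)"
  have ne: "M \<noteq> []" using prems(1) by auto
  have hl: "hd M = M ! 0" "last M = M ! (n - 1)"
    using ne by (auto simp: n_def hd_conv_nth last_conv_nth)
  show ?case
  proof (cases "n = 2")
    case True
    then obtain x y where "M = [x, y]" by (auto simp: n_def numeral_2_eq_2 length_Suc_conv)
    then show ?thesis by (intro exI[of _ "[]"]) auto
  next
    case False
    then have n: "n \<ge> 3" using prems(1) by (simp add: n_def)
    define S where "S = {1..n - 2}"
    have S: "finite S" "S \<noteq> {}" using n by (auto simp: S_def)
    have "Max ((\<lambda>i. H (M ! i)) ` S) \<in> (\<lambda>i. H (M ! i)) ` S" using S by (intro Max_in) auto
    then obtain j where j: "j \<in> S" "Max ((\<lambda>i. H (M ! i)) ` S) = H (M ! j)" by auto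
    have jmax: "H (M ! i) \<le> H (M ! j)" if "i \<in> S" for i
      using that S j(2) by (metis Max_ge finite_imageI imageI)
    have j': "1 \<le> j" "j \<le> n - 2" "Suc j < n" using j(1) n by (auto simp: S_def)
    define p q r where "p = M ! (j - 1)" and "q = M ! j" and "r = M ! Suc j"
    define G K where "G = take (j - 1) M" and "K = drop (Suc (Suc j)) M"
    have M: "M = G @ p # q # r # K"
    proof -
      have "M = G @ drop (j - 1) M" by (simp add: G_def)
      also have "drop (j - 1) M = p # drop j M" using Cons_nth_drop_Suc[of "j - 1" M] j' by (simp add: p_def n_def)
      also have "drop j M = q # drop (Suc j) M" using Cons_nth_drop_Suc[of j M] j' by (simp add: q_def n_def)
      also have "drop (Suc j) M = r # K" using Cons_nth_drop_Suc[of "Suc j" M] j' by (simp add: r_def K_def n_def)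
      finally show ?thesis .
    qed
    define M' where "M' = G @ p # r # K"
    have Hpos: "H (M ! i) > 0" if "i \<in> S" for i
    proof -
      have i: "0 < i" "i < n - 1" "n - 1 < length M" using that n by (auto simp: S_def n_def)
      then have "M ! i \<noteq> M ! 0" "M ! i \<noteq> M ! (n - 1)"
        using prems(2) nth_eq_iff_index_eq[of M i 0] nth_eq_iff_index_eq[of M i "n - 1"] ne by auto
      then show ?thesis using prems(5)[of "M ! i"] i hl by (auto simp: H_def)
    qed
    have H0: "H (hd M) = 0" "H (last M) = 0" by (auto simp: H_def)
    have Hall: "0 \<le> H (M ! i) \<and> H (M ! i) \<le> H q" if "i < n" for i
    proof -
      have "i = 0 \<or> i = n - 1 \<or> i \<in> S" using that by (auto simp: S_def)
      then consider "i = 0" | "i = n - 1" | "i \<in> S" by blast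
      then show ?thesis
        using Hpos[of i] Hpos[of j] jmax[of i] j(1) H0 hl by cases (auto simp: q_def)
    qed
    have srt: "d a (M ! i) (M ! k) > 0" if "i < k" "k < n" for i k
      using sorted_wrt_nth_less[OF prems(3)] that by (simp add: n_def)
    have apq: "d a p q > 0" "d a q r > 0" "d a p r > 0"
      using srt[of "j - 1" j] srt[of j "Suc j"] srt[of "j - 1" "Suc j"] j' by (auto simp: p_def q_def r_def)
    \<comment> \<open>The view from \<open>a\<close> in angular order makes the difference of the
      two heights a sum of two positive determinants.\<close>
    have Ha: "H a > H q"
    proof -
      have "d a (hd M) q > 0" "d (last M) a q > 0"
        using srt[of 0 j] srt[of j "n - 1"] j' hl rot[of "last M" a q] by (auto simp: q_def)
      moreover have "d (hd M) (last M) a = d a (hd M) (last M)" using rot' by metis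
      ultimately show ?thesis using four[of a "hd M" q "last M"] by (simp add: H_def)
    qed
    have "d p q r \<le> 0"
    proof (rule ccontr)
      assume "\<not> ?thesis"
      then have pos: "d p q r > 0" by simp
      \<comment> \<open>The height of \<open>q\<close> in its barycentric coordinates with respect
        to \<open>a\<close>, \<open>p\<close>, \<open>r\<close>; under the assumption, the weight of
        \<open>a\<close> is negative.\<close>
      have e: "d a p r * H q = d p r q * H a + d a q r * H p + d a p q * H r"
        using lin[of a p r "hd M" "last M" q] rot[of r a q] by (simp add: H_def)
      have s: "d a p q + d a q r - d a p r = d p q r"
        using four[of p q a r] rot[of a p q] rot[of a q r] rot[of r p a] rot[of p a r] sw[of p a r] by simp
      have "d a q r * H p \<le> d a q r * H q" "d a p q * H r \<le> d a p q * H q"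
        using Hall[of "j - 1"] Hall[of "Suc j"] apq j' by (auto simp: p_def r_def intro!: mult_left_mono)
      then have "d a p r * H q \<le> - d p q r * H a + (d a p q + d a q r) * H q"
        using e sw2[of p r q] by (simp add: algebra_simps)
      then have "d p q r * H a \<le> (d a p q + d a q r - d a p r) * H q" by (simp add: algebra_simps)
      then have "d p q r * H a \<le> d p q r * H q" unfolding s .
      then show False using pos Ha by simp
    qed
    moreover have "d p q r \<noteq> 0" 
    proof (rule gpD[OF prems(4)])
      show "p \<in> set M" "q \<in> set M" "r \<in> set M" by (subst M, simp)+
      have "distinct (G @ p # q # r # K)" using prems(2) M by simp
      then show "p \<noteq> q" "q \<noteq> r" "p \<noteq> r" by auto
    qed
    ultimately have ear: "d p q r < 0" by simp
    have hl': "hd M' = hd M" "last M' = last M" unfolding M'_def by (subst M, cases G; simp)+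
    have set: "set M' \<subseteq> set M" unfolding M'_def by (subst M) auto
    have sub: "subseq M' M" unfolding M'_def by (subst M) (simp add: subseq_append' list_emb_Cons)
    have "\<exists>T. (\<forall>\<phi>. skew \<phi> \<longrightarrow> (\<Sum>t\<leftarrow>T. bd \<phi> t) = walk \<phi> M' - \<phi> (hd M') (last M')) \<and>
     (\<forall>x y z. (x, y, z) \<in> set T \<longrightarrow> d x y z < 0 \<and> subseq [x, y, z] M')"
    proof (rule less.hyps)
      show "length M' < length M" unfolding M'_def by (subst M) simp
      show "2 \<le> length M'" unfolding M'_def by simp
      show "distinct M'" using prems(2) M by (simp add: M'_def)
      have "sorted_wrt (\<lambda>x y. 0 < d a x y) (G @ p # q # r # K)" using prems(3) M by simp
      then show "sorted_wrt (\<lambda>x y. 0 < d a x y) M'" unfolding M'_def sorted_wrt_append by auto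
      show "gp (set M')" using gp_subset[OF prems(4) set] .
    qed (use prems(5) set hl' in auto)
    then obtain T where T: "\<And>\<phi>. skew \<phi> \<Longrightarrow> (\<Sum>t\<leftarrow>T. bd \<phi> t) = walk \<phi> M' - \<phi> (hd M) (last M)"
      "\<And>x y z. (x, y, z) \<in> set T \<Longrightarrow> d x y z < 0 \<and> subseq [x, y, z] M'"
      using hl' by auto
    have "(\<Sum>t\<leftarrow>(p, q, r) # T. bd \<phi> t) = walk \<phi> M - \<phi> (hd M) (last M)" if "skew \<phi>" for \<phi>
    proof -
      have "walk \<phi> M = walk \<phi> (G @ [p]) + (\<phi> p q + (\<phi> q r + walk \<phi> (r # K)))"
        using walk_append[of \<phi> G p "q # r # K"] M by simp
      moreover have "walk \<phi> M' = walk \<phi> (G @ [p]) + (\<phi> p r + walk \<phi> (r # K))"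
        using walk_append[of \<phi> G p "r # K"] by (simp add: M'_def)
      moreover have "\<phi> r p = - \<phi> p r" using skew_eq[OF that] .
      ultimately show ?thesis using T(1)[OF that] by simp
    qed
    moreover have "subseq [p, q, r] M"
      using subseq_nth3[of "j - 1" j "Suc j" M] j' by (simp add: p_def q_def r_def n_def)
    moreover have "d x y z < 0 \<and> subseq [x, y, z] M" if "(x, y, z) \<in> set T" for x y z
      using T(2)[OF that] sub subseq_order.order_trans by blast
    ultimately show ?thesis using ear by (intro exI[of _ "(p, q, r) # T"]) auto
  qed
qed

end

section \<open>Pockets between a chain and its hull edge\<close>

fun reversed :: "'a \<times> 'a \<times> 'a \<Rightarrow> 'a \<times> 'a \<times> 'a" where
  "reversed (x, y, z) = (z, y, x)"

lemma bd_reversed: "skew \<phi> \<Longrightarrow> bd \<phi> (reversed t) = - bd \<phi> t"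
proof -
  assume s: "skew \<phi>"
  obtain x y z where "t = (x, y, z)" by (cases t)
  then show ?thesis using skew_eq[OF s, of y x] skew_eq[OF s, of z y] skew_eq[OF s, of x z] by simp
qed

lemma sum_reversed: "skew \<phi> \<Longrightarrow> (\<Sum>t\<leftarrow>map reversed T. bd \<phi> t) = - (\<Sum>t\<leftarrow>T. bd \<phi> t)"
  by (induction T) (simp_all add: bd_reversed)

lemma in_reversed: "(x, y, z) \<in> set (map reversed T) \<longleftrightarrow> (z, y, x) \<in> set T"
  by force

lemma subseq_rev: "subseq xs ys \<Longrightarrow> subseq (rev xs) (rev ys)"
  by (induction xs ys rule: list_emb.induct) (auto simp: subseq_rev_drop_many)

context chiro begin

text \<open>Funnels over both halves of the chain leave two convex paths that meet at
  \<open>a\<close>. A triangle with the last funnel vertices \<open>f\<close> and \<open>g\<close>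
  cuts \<open>a\<close> off, and what remains is a path seen in angular order from \<open>a\<close>,
  so that ears can be cut off above the base \<open>q1 q2\<close>. The hypothesis \<open>srt\<close>
  restricts itself to points after \<open>q1\<close> and before \<open>q2\<close> around
  \<open>a\<close>, which the funnel vertices are by convexity.\<close>

lemma chain_pocket:
  assumes as: "peeled q1 as" "as \<noteq> []" "last as = a" and bs: "chiro.peeled (\<lambda>a b c. - d a b c) q2 bs" "bs \<noteq> []" "last bs = a"
    and L: "L = (q1 # as) @ tl (rev (q2 # bs))" "distinct L" "gp (set L)"
    and half: "\<And>x. x \<in> set as \<Longrightarrow> d q1 x r1 > 0" "\<And>x. x \<in> set bs \<Longrightarrow> d q2 r2 x > 0"
    and base: "\<And>x. x \<in> set L - {q1, q2} \<Longrightarrow> d q1 q2 x > 0"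
    and srt: "\<And>f g. f \<in> insert q1 (set as - {a}) \<Longrightarrow> g \<in> insert q2 (set bs - {a}) \<Longrightarrow>
        f = q1 \<or> d a q1 f > 0 \<Longrightarrow> g = q2 \<or> d a g q2 > 0 \<Longrightarrow> d a f g > 0"
  shows "\<exists>T. (\<forall>\<phi>. skew \<phi> \<longrightarrow> (\<Sum>t\<leftarrow>T. bd \<phi> t) = \<phi> q1 q2 - walk \<phi> L) \<and>
     (\<forall>x y z. (x, y, z) \<in> set T \<longrightarrow> d x y z > 0 \<and> subseq [z, y, x] L)"
proof -
  interpret neg: chiro "\<lambda>a b c. - d a b c" by (rule neg_chiro)
  have neg_gp: "neg.gp V \<longleftrightarrow> gp V" for V unfolding neg.gp_def gp_def by auto
  have as': "as = butlast as @ [a]" and bs': "bs = butlast bs @ [a]"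
    using as bs by (metis append_butlast_last_id)+
  define as0 bs0 where "as0 = butlast as" and "bs0 = butlast bs"
  have asE: "as = as0 @ [a]" and bsE: "bs = bs0 @ [a]" using as' bs' by (simp_all add: as0_def bs0_def)
  have LE: "L = q1 # as0 @ a # rev bs0 @ [q2]" using L(1) by (simp add: asE bsE)
  have dL: "distinct (q1 # as0 @ a # rev bs0 @ [q2])" using L(2) LE by simp
  have "\<exists>F T. is_funnel q1 as F T"
    using dL half(1) by (intro funnel[OF as(1,2)] gp_subset[OF L(3)]) (auto simp: LE asE)
  then obtain F T1 where "is_funnel q1 as F T1" by blast
  note F = is_funnelD[OF this]
  have "\<exists>G T. neg.is_funnel q2 bs G T"
  proof (rule neg.funnel[OF bs(1,2)])
    show "distinct (q2 # bs)" using dL by (auto simp: bsE)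
    show "neg.gp (insert q2 (set bs))" unfolding neg_gp by (intro gp_subset[OF L(3)]) (auto simp: LE bsE)
    show "0 < - d q2 x r2" if "x \<in> set bs" for x using half(2)[OF that] sw2[of q2 x r2] by simp
  qed
  then obtain G T2 where "neg.is_funnel q2 bs G T2" by blast
  note G = neg.is_funnelD[OF this]
  define F0 G0 where "F0 = q1 # butlast F" and "G0 = q2 # butlast G"
  have FE: "q1 # F = F0 @ [a]" and GE: "q2 # G = G0 @ [a]"
    using F(2,3) G(2,3) as(3) bs(3) by (simp_all add: F0_def G0_def) (metis append_butlast_last_id)+
  have subF: "subseq F0 (q1 # as0)"
  proof -
    have "subseq (F0 @ [a]) ((q1 # as0) @ [a])" using F(4) by (simp flip: FE add: asE)
    then show ?thesis using subseq_append by blast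
  qed
  have subG: "subseq G0 (q2 # bs0)"
  proof -
    have "subseq (G0 @ [a]) ((q2 # bs0) @ [a])" using G(4) by (simp flip: GE add: bsE)
    then show ?thesis using subseq_append by blast
  qed
  define M where "M = F0 @ rev G0"
  have subM: "subseq M L"
  proof -
    have "subseq (rev G0) (a # rev (q2 # bs0))" using subseq_rev[OF subG] by (rule list_emb_Cons)
    then have "subseq (F0 @ rev G0) ((q1 # as0) @ a # rev (q2 # bs0))" using subF by (intro list_emb_append_mono)
    then show ?thesis by (simp add: M_def LE)
  qed
  have srtF: "sorted_wrt (\<lambda>x y. d a x y > 0) F0"
    unfolding sorted_wrt_iff_nth_less
  proof (intro allI impI)
    fix i j assume "i < j" "j < length F0"
    then have "d (F0 ! i) (F0 ! j) a > 0" using cvxD[OF F(1)[unfolded FE], of i j "length F0"] by (simp add: nth_append)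
    then show "d a (F0 ! i) (F0 ! j) > 0" using rot[of a] by simp
  qed
  have srtG: "sorted_wrt (\<lambda>x y. d a y x > 0) G0"
    unfolding sorted_wrt_iff_nth_less
  proof (intro allI impI)
    fix i j assume "i < j" "j < length G0"
    then have "- d (G0 ! i) (G0 ! j) a > 0" using neg.cvxD[OF G(1)[unfolded GE], of i j "length G0"] by (simp add: nth_append)
    then show "d a (G0 ! j) (G0 ! i) > 0" using rot[of a "G0 ! j" "G0 ! i"] sw[of "G0 ! j" "G0 ! i" a] by simp
  qed
  have cr: "d a f g > 0" if fg: "f \<in> set F0" "g \<in> set G0" for f g
  proof (rule srt)
    show "f \<in> insert q1 (set as - {a})" using fg(1) subseq_set[OF subF] dL by (auto simp: asE)
    show "g \<in> insert q2 (set bs - {a})" using fg(2) subseq_set[OF subG] dL by (auto simp: bsE)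
    show "f = q1 \<or> d a q1 f > 0" using fg(1) srtF by (auto simp: F0_def)
    show "g = q2 \<or> d a g q2 > 0" using fg(2) srtG by (auto simp: G0_def)
  qed
  have "\<exists>T. (\<forall>\<phi>. skew \<phi> \<longrightarrow> (\<Sum>t\<leftarrow>T. bd \<phi> t) = walk \<phi> M - \<phi> (hd M) (last M)) \<and>
     (\<forall>x y z. (x, y, z) \<in> set T \<longrightarrow> d x y z < 0 \<and> subseq [x, y, z] M)"
  proof (rule mountain)
    show "2 \<le> length M" by (simp add: M_def F0_def G0_def)
    show "distinct M" using subseq_distinct[OF subM L(2)] .
    show "gp (set M)" using gp_subset[OF L(3) subseq_set[OF subM]] .
    show "sorted_wrt (\<lambda>x y. d a x y > 0) M"
      unfolding M_def sorted_wrt_append using srtF srtG cr by (auto simp: sorted_wrt_rev)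
    have h: "hd M = q1" "last M = q2" by (simp_all add: M_def F0_def G0_def)
    show "d (hd M) (last M) x > 0" if "x \<in> set M" "x \<noteq> hd M" "x \<noteq> last M" for x
      using that base[of x] subseq_set[OF subM] h by auto
  qed
  moreover have h: "hd M = q1" "last M = q2" by (simp_all add: M_def F0_def G0_def)
  ultimately obtain T3 where T3: "\<And>\<phi>. skew \<phi> \<Longrightarrow> (\<Sum>t\<leftarrow>T3. bd \<phi> t) = walk \<phi> M - \<phi> q1 q2"
     "\<And>x y z. (x, y, z) \<in> set T3 \<Longrightarrow> d x y z < 0 \<and> subseq [x, y, z] M" by auto
  define f g where "f = last F0" and "g = last G0"
  have fg: "F0 = butlast F0 @ [f]" "G0 = butlast G0 @ [g]" by (simp_all add: f_def g_def F0_def G0_def)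
  have agf: "d g a f > 0" using cr[of f g] rot[of g a f] by (simp add: f_def g_def F0_def G0_def)
  have sub0: "subseq [f, a, g] L"
  proof -
    have "f \<in> set (q1 # as0)" "g \<in> set (q2 # bs0)" 
      using subseq_set[OF subF] subseq_set[OF subG] last_in_set[of F0] last_in_set[of G0]
      by (auto simp: f_def g_def F0_def G0_def simp del: last.simps)
    then have "subseq [f] (q1 # as0)" "subseq [g] (rev (q2 # bs0))" by (auto simp only: subseq_singleton_left set_rev)
    then have "subseq ([f] @ [a] @ [g]) ((q1 # as0) @ [a] @ rev (q2 # bs0))" by (intro list_emb_append_mono) auto
    then show ?thesis by (simp add: LE)
  qed
  \<comment> \<open>\<open>T1\<close> and \<open>T3\<close> are clockwise and have to be reversed.
    \<open>T2\<close> was found in the mirror image, where clockwise means counterclockwise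
    here.\<close>
  define T where "T = map reversed T1 @ T2 @ [(g, a, f)] @ map reversed T3"
  have "(\<Sum>t\<leftarrow>T. bd \<phi> t) = \<phi> q1 q2 - walk \<phi> L" if s: "skew \<phi>" for \<phi>
  proof -
    have 1: "walk \<phi> L = walk \<phi> (q1 # as) - walk \<phi> (q2 # bs)"
      using walk_append[of \<phi> "q1 # as0" a "rev (q2 # bs0)"] walk_rev[OF s, of "q2 # bs"]
      by (simp add: LE asE bsE)
    have 2: "walk \<phi> (q1 # F) = walk \<phi> F0 + \<phi> f a"
      using walk_snoc[of \<phi> "butlast F0" f a] fg(1) FE by (metis append.assoc append_Cons append_Nil)
    have 3: "walk \<phi> (q2 # G) = walk \<phi> G0 + \<phi> g a"
      using walk_snoc[of \<phi> "butlast G0" g a] fg(2) GE by (metis append.assoc append_Cons append_Nil)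
    have revG: "rev G0 = g # rev (butlast G0)" using arg_cong[OF fg(2), of rev] by simp
    have 4: "walk \<phi> M = walk \<phi> F0 + \<phi> f g - walk \<phi> G0"
    proof -
      have "M = butlast F0 @ f # rev G0" using fg(1) by (metis M_def append.assoc append_Cons append_Nil)
      then have "walk \<phi> M = walk \<phi> F0 + walk \<phi> (f # rev G0)" using walk_append[of \<phi> "butlast F0" f "rev G0"] fg(1) by simp
      also have "walk \<phi> (f # rev G0) = \<phi> f g + walk \<phi> (rev G0)" by (simp add: revG)
      finally show ?thesis using walk_rev[OF s, of G0] by simp
    qed
    show ?thesis
      using F(5)[OF s] G(5)[OF s] T3(1)[OF s] 1 2 3 4 sum_reversed[OF s, of T1] sum_reversed[OF s, of T3]
        skew_eq[OF s, of a f]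
      by (simp add: T_def)
  qed
  moreover have "d x y z > 0 \<and> subseq [z, y, x] L" if t: "(x, y, z) \<in> set T" for x y z
  proof -
    consider "(z, y, x) \<in> set T1" | "(x, y, z) \<in> set T2" | "(x, y, z) = (g, a, f)" | "(z, y, x) \<in> set T3"
      using t unfolding T_def set_append Un_iff in_reversed by auto
    then show ?thesis
    proof cases
      case 1
      have "subseq (q1 # as) L" unfolding L(1) by (rule subseq_rev_drop_many[OF subseq_order.refl])
      then show ?thesis
        using F(6)[OF 1] sw3[of x y z] subseq_order.order_trans[of "[z, y, x]" "q1 # as" L] by simp
    next
      case 2
      have "subseq (rev (q2 # bs)) L" 
        using list_emb_append2[OF subseq_order.refl, of "rev (q2 # bs)" "q1 # as0"] by (simp add: LE bsE)
      moreover have "subseq [z, y, x] (rev (q2 # bs))" using G(6)[OF 2] subseq_rev[of "[x, y, z]" "q2 # bs"] by simp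
      ultimately show ?thesis
        using G(6)[OF 2] subseq_order.order_trans[of "[z, y, x]" "rev (q2 # bs)" L] by simp
    next
      case 3
      then show ?thesis using agf sub0 by simp
    next
      case 4
      then show ?thesis
        using T3(2)[OF 4] sw3[of x y z] subM subseq_order.order_trans[of "[z, y, x]" M L] by simp
    qed
  qed
  ultimately show ?thesis by blast
qed

text \<open>\<open>h\<close> vanishes on a line through \<open>a\<close> with \<open>q1\<close> and
  \<open>q2\<close> on different sides. In the coordinates \<open>X\<close>, \<open>Y\<close> along
  the directions to \<open>q1\<close> and \<open>q2\<close>, and up to the factor
  \<open>d a q1 q2\<close>, \<open>h\<close> has the coefficients \<open>h q1\<close> and
  \<open>h q2\<close>, and \<open>d a f g\<close> is the determinant of the coordinates of
  \<open>f\<close> and \<open>g\<close>. The signs of \<open>h f\<close> and \<open>h g\<close>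
  compare the slopes of both points with that of the line.\<close>

lemma sort_split:
  assumes D: "d a q1 q2 > 0" and h: "h = (\<lambda>p. s * d a c p + t * d a b p)" "h q1 > 0" "h q2 < 0"
    and f: "h f \<ge> 0" "f = q1 \<or> d a q1 f > 0" and g: "h g \<le> 0" "g = q2 \<or> d a g q2 > 0"
    and nz: "d a f g \<noteq> 0"
  shows "d a f g > 0"
proof -
  define X where "X = (\<lambda>p. d a p q2)"
  define Y where "Y = (\<lambda>p. d a q1 p)"
  have e: "d a q1 q2 * h p = h q1 * X p + h q2 * Y p" for p
  proof -
    have "d a v p * d a q1 q2 = d a v q1 * X p + d a v q2 * Y p" for v
      using gr[of a v p q1 q2] sw2[of a p q1] by (simp add: X_def Y_def)
    from this[of c] this[of b] show ?thesis unfolding h(1) by algebra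
  qed
  have Yf: "Y f \<ge> 0" and Xg: "X g \<ge> 0" using f g by (auto simp: X_def Y_def)
  have "h q1 * X f + h q2 * Y f \<ge> 0" using e[of f] D f(1) by (metis mult_nonneg_nonneg less_imp_le)
  then have 1: "h q1 * X f \<ge> - h q2 * Y f" by simp
  have "h q1 * X g + h q2 * Y g \<le> 0" using e[of g] D g(1) by (metis mult_nonneg_nonpos less_imp_le)
  then have 2: "- h q2 * Y g \<ge> h q1 * X g" by simp
  have "(- h q2 * Y f) * (h q1 * X g) \<le> (h q1 * X f) * (- h q2 * Y g)"
  proof (rule mult_mono[OF 1 2])
    have "- h q2 * Y f \<ge> 0" using Yf h(3) by (simp add: mult_nonpos_nonneg)
    then show "0 \<le> h q1 * X f" using 1 by linarith
  qed (use Xg h(2) in simp)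
  moreover have xy: "d a q1 q2 * d a f g = X f * Y g - Y f * X g"
    using gr[of a f g q1 q2] sw2[of a f q1] sw2[of a g q1] by (simp add: X_def Y_def algebra_simps)
  moreover have "h q1 * (- h q2) * (X f * Y g - Y f * X g) =
      (h q1 * X f) * (- h q2 * Y g) - (- h q2 * Y f) * (h q1 * X g)" by algebra
  ultimately have "h q1 * (- h q2) * (X f * Y g - Y f * X g) \<ge> 0" by linarith
  then have "h q1 * (- h q2) * (d a q1 q2 * d a f g) \<ge> 0" unfolding xy .
  moreover have "h q1 * (- h q2) > 0" using h(2,3) by (simp add: mult_pos_neg)
  ultimately have "d a q1 q2 * d a f g \<ge> 0" by (metis zero_le_mult_iff not_less)
  then show ?thesis using D nz by (smt (verit) mult_pos_neg)
qed

text \<open>\<open>A\<close> goes to the strip at \<open>q1\<close>, whose outer edge is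
  \<open>ca\<close>, and \<open>C\<close> to the strip at \<open>q2\<close>, whose outer edge is
  \<open>ab\<close>. The last clause is the sorting condition for the pocket of this class.\<close>

definition cut_at :: "'a \<Rightarrow> 'a \<Rightarrow> 'a \<Rightarrow> 'a \<Rightarrow> 'a \<Rightarrow> 'a set \<Rightarrow> 'a set \<Rightarrow> 'a set \<Rightarrow> bool" where
  "cut_at a b c q1 q2 S A C \<longleftrightarrow>
     S = insert a (A \<union> C) \<and> a \<notin> A \<union> C \<and> A \<inter> C = {} \<and> (\<forall>p\<in>A. d c a p < 0) \<and> (\<forall>p\<in>C. d a b p < 0) \<and>
     (\<forall>f g. f \<in> insert q1 A \<longrightarrow> g \<in> insert q2 C \<longrightarrow> f = q1 \<or> d a q1 f > 0 \<longrightarrow> g = q2 \<or> d a g q2 > 0 \<longrightarrow> d a f g > 0)"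

lemma cut_atD:
  assumes "cut_at a b c q1 q2 S A C"
  shows "S = insert a (A \<union> C)" "a \<notin> A \<union> C" "A \<inter> C = {}" "\<And>p. p \<in> A \<Longrightarrow> d c a p < 0" "\<And>p. p \<in> C \<Longrightarrow> d a b p < 0"
    "\<And>f g. f \<in> insert q1 A \<Longrightarrow> g \<in> insert q2 C \<Longrightarrow>
        f = q1 \<or> d a q1 f > 0 \<Longrightarrow> g = q2 \<or> d a g q2 > 0 \<Longrightarrow> d a f g > 0"
  using assms unfolding cut_at_def by (elim conjE, assumption | blast)+

text \<open>The cut follows a line through \<open>a\<close> that passes between \<open>b\<close> and \<open>c\<close> and separates \<open>q1\<close>
  from \<open>q2\<close>; it is the zero set of a non-negative combination of the lines \<open>ac\<close> and \<open>ab\<close>.\<close>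

lemma corner_split:
  assumes q: "d a q1 q2 > 0" and c: "d a c q1 > 0" and b: "d a b q2 < 0" and abc: "d a b c > 0"
    and S: "a \<in> S" "\<And>p. p \<in> S \<Longrightarrow> \<not> (d a b p > 0 \<and> d c a p > 0)"
    and gp: "gp (insert b (insert c (insert q1 (insert q2 S))))" and b': "b \<notin> S" "c \<notin> S" "q1 \<notin> S" "q2 \<notin> S"
  shows "\<exists>A C. cut_at a b c q1 q2 S A C"
proof -
  define P Q R N where "P = d a c q1" and "Q = d a b q1" and "R = d a c q2" and "N = d a b q2"
  have "d a c b * d a q1 q2 - P * N + R * Q = 0"
    using gr[of a c b q1 q2] by (simp add: P_def Q_def R_def N_def)
  moreover have "d a c b * d a q1 q2 < 0" using abc q sw2[of a c b] by (simp add: mult_neg_pos)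
  ultimately have PN: "P * N < R * Q" by linarith
  have "\<exists>s t. s \<ge> 0 \<and> t \<ge> 0 \<and> s * P + t * Q > 0 \<and> s * R + t * N < 0"
  proof -
    consider "R < 0" | "Q > 0" | "R \<ge> 0" "Q \<le> 0" by linarith
    then show ?thesis
    proof cases
      case 1 then show ?thesis using c by (intro exI[of _ 1] exI[of _ 0]) (simp add: P_def)
    next
      case 2 then show ?thesis using b by (intro exI[of _ 0] exI[of _ 1]) (simp add: N_def)
    next
      \<comment> \<open>Neither of the lines \<open>ac\<close> and \<open>ab\<close> alone separates
        \<open>q1\<close> from \<open>q2\<close>. These weights make the values at \<open>q1\<close>
        and \<open>q2\<close> opposite to each other, and the Grassmann-Pluecker relation gives
        their sign.\<close>
      case 3
      have "(- N - Q) * P + (P + R) * Q = R * Q - P * N" "(- N - Q) * R + (P + R) * N = P * N - R * Q"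
        by (simp_all add: algebra_simps)
      then show ?thesis using PN 3 c b by (intro exI[of _ "- N - Q"] exI[of _ "P + R"]) (auto simp: P_def N_def)
    qed
  qed
  then obtain s t where st: "s \<ge> 0" "t \<ge> 0" "s * P + t * Q > 0" "s * R + t * N < 0" by blast
  define h where "h = (\<lambda>p. s * d a c p + t * d a b p)"
  have h12: "h q1 > 0" "h q2 < 0" using st by (simp_all add: h_def P_def Q_def R_def N_def)
  have st0: "s > 0 \<or> t > 0" using st by (auto simp: order_less_le)
  have ac: "a \<noteq> c" "a \<noteq> b" "b \<noteq> c" using abc by auto
  have nz: "d a c p \<noteq> 0 \<and> d a b p \<noteq> 0" if "p \<in> S - {a}" for p
    using that ac b' S(1)
    by (intro conjI gpD[OF gp]) auto
  define A C where "A = {p \<in> S - {a}. h p \<ge> 0}" and "C = {p \<in> S - {a}. h p < 0}"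
  have front: "d c a p < 0" if "p \<in> A" for p
  proof (rule ccontr)
    assume "\<not> ?thesis"
    then have 1: "d a c p < 0" "d c a p > 0" using nz[of p] that sw[of a c p] by (auto simp: A_def)
    then have 2: "d a b p < 0" using S(2)[of p] nz[of p] that by (force simp: A_def)
    have "s * d a c p \<le> 0" "t * d a b p \<le> 0" "s * d a c p < 0 \<or> t * d a b p < 0"
      using 1 2 st st0 by (auto simp: mult_nonneg_nonpos mult_pos_neg)
    then have "h p < 0" by (auto simp: h_def)
    then show False using that by (simp add: A_def)
  qed
  have front': "d a b p < 0" if "p \<in> C" for p
  proof (rule ccontr)
    assume "\<not> ?thesis"
    then have 1: "d a b p > 0" using nz[of p] that by (auto simp: C_def)
    then have 2: "d a c p > 0" using S(2)[of p] nz[of p] that sw[of a c p] by (force simp: C_def)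
    then have "h p \<ge> 0" using 1 st by (simp add: h_def)
    then show False using that by (simp add: C_def)
  qed
  have "d a f g > 0" if "f \<in> insert q1 A" "g \<in> insert q2 C" "f = q1 \<or> d a q1 f > 0" "g = q2 \<or> d a g q2 > 0" for f g
  proof (rule sort_split[OF q h_def h12 _ that(3) _ that(4)])
    show "h f \<ge> 0" "h g \<le> 0" using that h12 by (auto simp: A_def C_def)
    have "f \<noteq> g" "f \<noteq> a" "g \<noteq> a" using that b' S(1) h12 by (auto simp: A_def C_def)
    then show "d a f g \<noteq> 0" using that S(1) by (intro gpD[OF gp]) (auto simp: A_def C_def)
  qed
  moreover have "S = insert a (A \<union> C)" "a \<notin> A \<union> C" "A \<inter> C = {}" using S(1) by (auto simp: A_def C_def)
  ultimately have "cut_at a b c q1 q2 S A C" unfolding cut_at_def using front front' by simp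
  then show ?thesis by blast
qed

end

text \<open>The triangles that occur: either two vertices on one closed chain and the third one off it,
  or all three on one closed chain (and then clockwise along it), or one vertex on each open chain.\<close>

fun inner :: "'a list \<Rightarrow> 'a \<times> 'a \<times> 'a \<Rightarrow> bool" where
  "inner L (x, y, z) \<longleftrightarrow> subseq [x, y] L \<and> z \<notin> set L \<or> subseq [y, z] L \<and> x \<notin> set L \<or> subseq [z, x] L \<and> y \<notin> set L"

fun pocket :: "'a list \<Rightarrow> 'a \<times> 'a \<times> 'a \<Rightarrow> bool" where
  "pocket L (x, y, z) \<longleftrightarrow> subseq [z, y, x] L"

fun spread :: "'a set \<Rightarrow> 'a set \<Rightarrow> 'a set \<Rightarrow> 'a \<times> 'a \<times> 'a \<Rightarrow> bool" where
  "spread A B C (x, y, z) \<longleftrightarrow> x \<in> A \<and> y \<in> B \<and> z \<in> C \<or> y \<in> A \<and> z \<in> B \<and> x \<in> C \<or> z \<in> A \<and> x \<in> B \<and> y \<in> C"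

definition allowed :: "'a list \<Rightarrow> 'a list \<Rightarrow> 'a list \<Rightarrow> 'a \<times> 'a \<times> 'a \<Rightarrow> bool" where
  "allowed L1 L2 L3 t \<longleftrightarrow> (\<exists>L\<in>{L1, L2, L3}. inner L t \<or> pocket L t) \<or>
     spread (set L1 - set L2 - set L3) (set L2 - set L3 - set L1) (set L3 - set L1 - set L2) t"

lemma allowed_rotate: "allowed L1 L2 L3 t \<Longrightarrow> allowed L2 L3 L1 t"
  by (cases t) (auto simp: allowed_def)

section \<open>Assembling strips and pockets into a tiling\<close>

context chiro begin

definition filling :: "'a \<Rightarrow> 'a \<Rightarrow> 'a \<Rightarrow> 'a list \<Rightarrow> 'a list \<Rightarrow> 'a list \<Rightarrow> ('a \<times> 'a \<times> 'a) list \<Rightarrow> bool" where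
  "filling q1 q2 q3 B1 B2 B3 D \<longleftrightarrow>
     distinct (q1 # B1 @ q2 # B2 @ q3 # B3) \<and> bounds D (q1, q2, q3) \<and>
     (\<forall>x y z. (x, y, z) \<in> set D \<longrightarrow> d x y z > 0 \<and>
        allowed (q1 # B1 @ [q2]) (q2 # B2 @ [q3]) (q3 # B3 @ [q1]) (x, y, z) \<and>
        {x, y, z} \<subseteq> set (q1 # B1 @ q2 # B2 @ q3 # B3)) \<and>
     {q1, q2, q3} \<union> set B1 \<union> set B2 \<union> set B3 \<subseteq> \<Union> (corners ` set D)"

lemma filling_rotate:
  assumes "filling q1 q2 q3 B1 B2 B3 D"
  shows "filling q2 q3 q1 B2 B3 B1 D"
proof -
  have set: "set (q2 # B2 @ q3 # B3 @ q1 # B1) = set (q1 # B1 @ q2 # B2 @ q3 # B3)" by auto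
  have un: "{q2, q3, q1} \<union> set B2 \<union> set B3 \<union> set B1 = {q1, q2, q3} \<union> set B1 \<union> set B2 \<union> set B3" by auto
  have "distinct (q2 # B2 @ q3 # B3 @ q1 # B1)" using assms unfolding filling_def by auto
  moreover have "bounds D (q2, q3, q1)" using assms unfolding filling_def bounds_def by simp
  moreover have "d x y z > 0 \<and> allowed (q2 # B2 @ [q3]) (q3 # B3 @ [q1]) (q1 # B1 @ [q2]) (x, y, z) \<and>
      {x, y, z} \<subseteq> set (q1 # B1 @ q2 # B2 @ q3 # B3)" if "(x, y, z) \<in> set D" for x y z
    using assms that allowed_rotate unfolding filling_def by metis
  moreover have "{q1, q2, q3} \<union> set B1 \<union> set B2 \<union> set B3 \<subseteq> \<Union> (corners ` set D)"
    using assms unfolding filling_def by (elim conjE)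
  ultimately show ?thesis unfolding filling_def set un by (intro conjI allI impI) auto
qed

end

text \<open>Test the boundary identity with the oriented indicator of a side \<open>uv\<close>: if
  \<open>u\<close> or \<open>v\<close> were a corner of no triangle, the sum would be 0, while the
  outer triangle contributes 1.\<close>

lemma bounds_corners:
  assumes "bounds D (p, q, r)" "p \<noteq> q" "q \<noteq> r" "r \<noteq> p"
  shows "{p, q, r} \<subseteq> \<Union> (corners ` set D)"
proof -
  have *: "u \<in> \<Union> (corners ` set D) \<and> v \<in> \<Union> (corners ` set D)"
    if uv: "u \<noteq> v" "(u, v) \<in> {(p, q), (q, r)}" for u v
  proof (rule ccontr)
    assume no: "\<not> ?thesis"
    define \<phi> where "\<phi> = (\<lambda>x y. if x = u \<and> y = v then 1 else if x = v \<and> y = u then - 1 else 0 :: real)"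
    have s: "skew \<phi>" unfolding skew_def \<phi>_def using uv(1) by auto
    have "bd \<phi> t = 0" if "t \<in> set D" for t
    proof -
      obtain x y z where t: "t = (x, y, z)" by (cases t)
      have "u \<notin> corners t \<or> v \<notin> corners t" using no that by blast
      then show ?thesis
      proof
        assume "u \<notin> corners t"
        then have "x \<noteq> u" "y \<noteq> u" "z \<noteq> u" by (auto simp: t)
        then show ?thesis by (simp add: t \<phi>_def)
      next
        assume "v \<notin> corners t"
        then have "x \<noteq> v" "y \<noteq> v" "z \<noteq> v" by (auto simp: t)
        then show ?thesis by (simp add: t \<phi>_def)
      qed
    qed
    then have "(\<Sum>t\<leftarrow>D. bd \<phi> t) = (\<Sum>t\<leftarrow>D. 0)" by (intro arg_cong[where f = sum_list] map_cong) auto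
    then have "(\<Sum>t\<leftarrow>D. bd \<phi> t) = 0" by simp
    moreover have "bd \<phi> (p, q, r) = 1" 
    proof -
      have "u = p \<and> v = q \<or> u = q \<and> v = r" using uv(2) by auto
      then show ?thesis
      proof (elim disjE conjE)
        assume "u = p" "v = q"
        then show ?thesis using assms(2-4) by (simp add: \<phi>_def)
      next
        assume "u = q" "v = r"
        then show ?thesis using assms(2-4) by (simp add: \<phi>_def)
      qed
    qed
    ultimately show False using assms(1) s unfolding bounds_def by simp
  qed
  show ?thesis using *[of p q] *[of q r] assms(2,3) by auto
qed

context chiro begin

lemma strip_inner:
  assumes "is_strip q A B a c as bs D" "subseq (q # as) L" "subseq (rev (q # bs)) K"
    "set K \<inter> A = {}" "set L \<inter> B = {}" "(x, y, z) \<in> set D"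
  shows "d x y z > 0 \<and> (inner L (x, y, z) \<or> inner K (x, y, z))"
proof -
  have pos: "d x y z > 0" and c: "subseq [x, y] (q # as) \<and> z \<in> B \<or> subseq [z, y] (q # bs) \<and> x \<in> A"
    using is_stripD(10)[OF assms(1,6)] by auto
  from c show "d x y z > 0 \<and> (inner L (x, y, z) \<or> inner K (x, y, z))"
  proof
    assume "subseq [x, y] (q # as) \<and> z \<in> B"
    then show ?thesis using pos assms(2,5) subseq_order.order_trans[of "[x, y]" "q # as" L] by auto
  next
    assume h: "subseq [z, y] (q # bs) \<and> x \<in> A"
    then have "subseq [y, z] (rev (q # bs))" using subseq_rev[of "[z, y]" "q # bs"] by simp
    then have "subseq [y, z] K" using assms(3) subseq_order.order_trans by blast
    then show ?thesis using pos assms(4) h by auto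
  qed
qed

text \<open>\<open>as\<close> and \<open>bs\<close> are the paths along which the strips at
  \<open>q1\<close> and \<open>q2\<close> meet this class; together they form the chain, and
  \<open>T\<close> fills the pocket behind it.\<close>

definition is_chain :: "'a \<Rightarrow> 'a \<Rightarrow> 'a set \<Rightarrow> 'a list \<Rightarrow> 'a list \<Rightarrow> 'a list \<Rightarrow> ('a \<times> 'a \<times> 'a) list \<Rightarrow> bool" where
  "is_chain q1 q2 S as bs B T \<longleftrightarrow> set B = S \<and> distinct (q1 # B @ [q2]) \<and>
     (\<forall>\<phi>. skew \<phi> \<longrightarrow> walk \<phi> (q1 # B @ [q2]) = walk \<phi> (q1 # as) - walk \<phi> (q2 # bs)) \<and>
     subseq (q1 # as) (q1 # B @ [q2]) \<and> subseq (rev (q2 # bs)) (q1 # B @ [q2]) \<and>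
     (\<forall>\<phi>. skew \<phi> \<longrightarrow> (\<Sum>t\<leftarrow>T. bd \<phi> t) = \<phi> q1 q2 - walk \<phi> (q1 # B @ [q2])) \<and>
     (\<forall>x y z. (x, y, z) \<in> set T \<longrightarrow> d x y z > 0 \<and> pocket (q1 # B @ [q2]) (x, y, z))"

lemma is_chainD:
  assumes "is_chain q1 q2 S as bs B T"
  shows "set B = S" "distinct (q1 # B @ [q2])"
     "\<And>\<phi>. skew \<phi> \<Longrightarrow> walk \<phi> (q1 # B @ [q2]) = walk \<phi> (q1 # as) - walk \<phi> (q2 # bs)"
     "subseq (q1 # as) (q1 # B @ [q2])" "subseq (rev (q2 # bs)) (q1 # B @ [q2])"
     "\<And>\<phi>. skew \<phi> \<Longrightarrow> (\<Sum>t\<leftarrow>T. bd \<phi> t) = \<phi> q1 q2 - walk \<phi> (q1 # B @ [q2])"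
     "\<And>x y z. (x, y, z) \<in> set T \<Longrightarrow> d x y z > 0 \<and> pocket (q1 # B @ [q2]) (x, y, z)"
  using assms unfolding is_chain_def by (elim conjE, assumption | blast)+

lemma strip_corners:
  assumes "is_strip q A B a c as bs D" "(x, y, z) \<in> set D"
  shows "{x, y, z} \<subseteq> insert q (A \<union> B)"
  using is_stripD(10)[OF assms] subseq_set[of "[x, y]" "q # as"] subseq_set[of "[z, y]" "q # bs"]
    is_stripD(2,6)[OF assms(1)] by auto

lemma pocket_corners: "pocket L (x, y, z) \<Longrightarrow> {x, y, z} \<subseteq> set L"
  using subseq_set[of "[z, y, x]" L] by auto

lemma chain_from_strips:
  assumes s1: "is_strip q1 (insert a A) U a c as bs' D1" and s2: "is_strip q2 U' (insert a C) b a as' bs D2"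
    and S: "A \<inter> C = {}" "a \<notin> A \<union> C" "q1 \<notin> insert a (A \<union> C)" "q2 \<notin> insert a (A \<union> C)" "q1 \<noteq> q2"
    and gp: "gp (insert q1 (insert q2 (insert a (A \<union> C))))"
    and half: "\<And>x. x \<in> insert a (A \<union> C) \<Longrightarrow> d q1 x r1 > 0 \<and> d q2 r2 x > 0 \<and> d q1 q2 x > 0"
    and srt: "\<And>f g. f \<in> insert q1 A \<Longrightarrow> g \<in> insert q2 C \<Longrightarrow>
        f = q1 \<or> d a q1 f > 0 \<Longrightarrow> g = q2 \<or> d a g q2 > 0 \<Longrightarrow> d a f g > 0"
  shows "\<exists>B T. is_chain q1 q2 (insert a (A \<union> C)) as bs B T"
proof -
  note I = is_stripD[OF s1] and J = is_stripD[OF s2]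
  define as0 bs0 where "as0 = butlast as" and "bs0 = butlast bs"
  have as: "as = as0 @ [a]" and bs: "bs = bs0 @ [a]"
    using I(3,4) J(7,8) by (metis append_butlast_last_id as0_def, metis append_butlast_last_id bs0_def)
  define B where "B = as0 @ a # rev bs0"
  have L: "q1 # B @ [q2] = (q1 # as) @ tl (rev (q2 # bs))" by (simp add: B_def as bs)
  have sets: "set as0 = A" "set bs0 = C" using I(1,2) J(5,6) S(2) by (auto simp: as bs)
  have dist: "distinct (q1 # B @ [q2])" using I(1) J(5) S sets by (auto simp: B_def as bs)
  have setB: "set B = insert a (A \<union> C)" using sets by (auto simp: B_def)
  have "\<exists>T. (\<forall>\<phi>. skew \<phi> \<longrightarrow> (\<Sum>t\<leftarrow>T. bd \<phi> t) = \<phi> q1 q2 - walk \<phi> (q1 # B @ [q2])) \<and>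
     (\<forall>x y z. (x, y, z) \<in> set T \<longrightarrow> d x y z > 0 \<and> subseq [z, y, x] (q1 # B @ [q2]))"
  proof (rule chain_pocket[OF I(12,3,4) J(13,7,8) L dist])
    show "gp (set (q1 # B @ [q2]))" using gp setB by (simp add: insert_commute)
    show "d q1 x r1 > 0" if "x \<in> set as" for x using half that I(2) by blast
    show "d q2 r2 x > 0" if "x \<in> set bs" for x using half that J(6) by blast
    show "d q1 q2 x > 0" if "x \<in> set (q1 # B @ [q2]) - {q1, q2}" for x using half that setB by auto
    show "d a f g > 0" if "f \<in> insert q1 (set as - {a})" "g \<in> insert q2 (set bs - {a})"
       "f = q1 \<or> d a q1 f > 0" "g = q2 \<or> d a g q2 > 0" for f g
      using srt[OF _ _ that(3,4)] that(1,2) I(2) J(6) S(2) by auto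
  qed
  then obtain T where T: "\<forall>\<phi>. skew \<phi> \<longrightarrow> (\<Sum>t\<leftarrow>T. bd \<phi> t) = \<phi> q1 q2 - walk \<phi> (q1 # B @ [q2])"
     "\<forall>x y z. (x, y, z) \<in> set T \<longrightarrow> d x y z > 0 \<and> pocket (q1 # B @ [q2]) (x, y, z)" by auto
  have "walk \<phi> (q1 # B @ [q2]) = walk \<phi> (q1 # as) - walk \<phi> (q2 # bs)" if "skew \<phi>" for \<phi>
    using walk_append[of \<phi> "q1 # as0" a "rev (q2 # bs0)"] walk_rev[OF that, of "q2 # bs"]
    by (simp add: B_def as bs)
  moreover have "subseq (q1 # as) (q1 # B @ [q2])"
    unfolding L by (rule subseq_rev_drop_many[OF subseq_order.refl])
  moreover have "subseq (rev (q2 # bs)) (q1 # B @ [q2])"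
    using list_emb_append2[OF subseq_order.refl, of "rev (q2 # bs)" "q1 # as0"] by (simp add: B_def bs)
  ultimately have "is_chain q1 q2 (insert a (A \<union> C)) as bs B T" unfolding is_chain_def using T setB dist by blast
  then show ?thesis by blast
qed

text \<open>\<open>S1\<close>, \<open>S2\<close>, \<open>S3\<close> belong to the sides
  \<open>q1 q2\<close>, \<open>q2 q3\<close>, \<open>q3 q1\<close>. The last three clauses separate
  the two classes adjacent to each corner by their angle at that corner.\<close>

definition layout :: "'a \<Rightarrow> 'a \<Rightarrow> 'a \<Rightarrow> 'a set \<Rightarrow> 'a set \<Rightarrow> 'a set \<Rightarrow> bool" where
  "layout q1 q2 q3 S1 S2 S3 \<longleftrightarrow> finite S1 \<and> finite S2 \<and> finite S3 \<and>
     S1 \<inter> S2 = {} \<and> S2 \<inter> S3 = {} \<and> S3 \<inter> S1 = {} \<and>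
     q1 \<notin> S1 \<union> S2 \<union> S3 \<and> q2 \<notin> S1 \<union> S2 \<union> S3 \<and> q3 \<notin> S1 \<union> S2 \<union> S3 \<and>
     d q1 q2 q3 > 0 \<and> gp ({q1, q2, q3} \<union> S1 \<union> S2 \<union> S3) \<and>
     (\<forall>x\<in>S1 \<union> S2 \<union> S3. d q1 q2 x > 0 \<and> d q2 q3 x > 0 \<and> d q3 q1 x > 0) \<and>
     (\<forall>x\<in>S1. \<forall>z\<in>S3. d q1 x z > 0) \<and> (\<forall>y\<in>S2. \<forall>x\<in>S1. d q2 y x > 0) \<and> (\<forall>z\<in>S3. \<forall>y\<in>S2. d q3 z y > 0)"

lemma layoutD:
  assumes "layout q1 q2 q3 S1 S2 S3"
  shows "finite S1" "finite S2" "finite S3" "S1 \<inter> S2 = {}" "S2 \<inter> S3 = {}" "S3 \<inter> S1 = {}"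
    "q1 \<notin> S1 \<union> S2 \<union> S3" "q2 \<notin> S1 \<union> S2 \<union> S3" "q3 \<notin> S1 \<union> S2 \<union> S3"
    "d q1 q2 q3 > 0" "gp ({q1, q2, q3} \<union> S1 \<union> S2 \<union> S3)"
    "\<And>x. x \<in> S1 \<union> S2 \<union> S3 \<Longrightarrow> d q1 q2 x > 0 \<and> d q2 q3 x > 0 \<and> d q3 q1 x > 0"
    "\<And>x z. x \<in> S1 \<Longrightarrow> z \<in> S3 \<Longrightarrow> d q1 x z > 0"
    "\<And>y x. y \<in> S2 \<Longrightarrow> x \<in> S1 \<Longrightarrow> d q2 y x > 0"
    "\<And>z y. z \<in> S3 \<Longrightarrow> y \<in> S2 \<Longrightarrow> d q3 z y > 0"
    "q1 \<noteq> q2" "q2 \<noteq> q3" "q3 \<noteq> q1"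
  using assms unfolding layout_def by (elim conjE; simp; fail | (elim conjE; force))+

lemma layout_rotate: "layout q1 q2 q3 S1 S2 S3 \<Longrightarrow> layout q2 q3 q1 S2 S3 S1"
  unfolding layout_def using rot[of q1 q2 q3] by (simp add: insert_commute Un_ac)

definition filled :: "'a \<Rightarrow> 'a \<Rightarrow> 'a \<Rightarrow> 'a set \<Rightarrow> 'a set \<Rightarrow> 'a set \<Rightarrow> bool" where
  "filled q1 q2 q3 S1 S2 S3 \<longleftrightarrow>
     (\<exists>B1 B2 B3 D. filling q1 q2 q3 B1 B2 B3 D \<and> set B1 = S1 \<and> set B2 = S2 \<and> set B3 = S3)"

lemma filled_rotate: "filled q1 q2 q3 S1 S2 S3 \<Longrightarrow> filled q2 q3 q1 S2 S3 S1"
  unfolding filled_def using filling_rotate by blast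

lemma corner_of_layout:
  assumes L: "layout q1 q2 q3 S1 S2 S3" and abc: "a \<in> S1" "b \<in> S2" "c \<in> S3" "d a b c > 0"
    and S: "\<And>p. p \<in> S1 \<Longrightarrow> \<not> (d a b p > 0 \<and> d c a p > 0)"
  shows "\<exists>A C. cut_at a b c q1 q2 S1 A C"
proof (rule corner_split)
  note l = layoutD[OF L]
  show "d a q1 q2 > 0" using l(12)[of a] abc rot[of a q1 q2] by auto
  show "d a c q1 > 0" using l(13)[OF abc(1,3)] rot[of q1 a c] by simp
  have "d q2 b a > 0" using l(14)[OF abc(2,1)] .
  then show "d a b q2 < 0" using sw3[of q2 b a] by simp
  show "gp (insert b (insert c (insert q1 (insert q2 S1))))"
    using abc by (intro gp_subset[OF l(11)]) auto
  show "b \<notin> S1" "c \<notin> S1" using l(4,6) abc by auto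
qed (use layoutD(7,8)[OF L] abc S in auto)

lemma strip_of_layout:
  assumes L: "layout q1 q2 q3 S1 S2 S3" and A: "insert a A \<subseteq> S1" and C: "insert c C \<subseteq> S3"
    and front: "\<And>p. p \<in> A \<Longrightarrow> d c a p < 0" "\<And>p. p \<in> C \<Longrightarrow> d c a p < 0"
  shows "\<exists>as bs D. is_strip q1 (insert a A) (insert c C) a c as bs D"
proof (rule strip)
  show "finite (insert a A)" "finite (insert c C)"
    using finite_subset[OF A layoutD(1)[OF L]] finite_subset[OF C layoutD(3)[OF L]] by auto
  show "gp (insert q1 (insert a A \<union> insert c C))"
    using A C by (intro gp_subset[OF layoutD(11)[OF L]]) auto
  show "d q1 x y > 0" if "x \<in> insert a A" "y \<in> insert c C" for x y
    using layoutD(13)[OF L, of x y] A C that by blast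
qed (use front in auto)

text \<open>The open angle of \<open>abc\<close> at each vertex contains no point of the class of
  that vertex, so every class can be divided between the strips at the two ends of its side. Three
  strips, three pockets and the triangle fill the hull: in the sum of the boundaries, the sides of
  \<open>abc\<close> cancel against the outer edges of the strips and the chains against the
  pockets.\<close>

theorem filled_of_triple:
  assumes L: "layout q1 q2 q3 S1 S2 S3" and abc: "a \<in> S1" "b \<in> S2" "c \<in> S3" "d a b c > 0"
    and W1: "\<And>p. p \<in> S1 \<Longrightarrow> \<not> (d a b p > 0 \<and> d c a p > 0)"
    and W2: "\<And>p. p \<in> S2 \<Longrightarrow> \<not> (d b c p > 0 \<and> d a b p > 0)"
    and W3: "\<And>p. p \<in> S3 \<Longrightarrow> \<not> (d c a p > 0 \<and> d b c p > 0)"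
  shows "filled q1 q2 q3 S1 S2 S3"
proof -
  note L2 = layout_rotate[OF L] note L3 = layout_rotate[OF L2]
  have bca: "d b c a > 0" "d c a b > 0" using abc(4) rot by metis+
  obtain A1 C1 where "cut_at a b c q1 q2 S1 A1 C1"
    using corner_of_layout[OF L abc W1] by blast
  note c1 = cut_atD[OF this]
  obtain A2 C2 where "cut_at b c a q2 q3 S2 A2 C2"
    using corner_of_layout[OF L2 abc(2,3,1) bca(1) W2] by blast
  note c2 = cut_atD[OF this]
  obtain A3 C3 where "cut_at c a b q3 q1 S3 A3 C3"
    using corner_of_layout[OF L3 abc(3,1,2) bca(2) W3] by blast
  note c3 = cut_atD[OF this]
  obtain as1 bs3 D1 where s1: "is_strip q1 (insert a A1) (insert c C3) a c as1 bs3 D1"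
    using strip_of_layout[OF L, of a A1 c C3] c1 c3 by blast
  obtain as2 bs1 D2 where s2: "is_strip q2 (insert b A2) (insert a C1) b a as2 bs1 D2"
    using strip_of_layout[OF L2, of b A2 a C1] c1 c2 by blast
  obtain as3 bs2 D3 where s3: "is_strip q3 (insert c A3) (insert b C2) c b as3 bs2 D3"
    using strip_of_layout[OF L3, of c A3 b C2] c2 c3 by blast
  have lay: "gp ({q1, q2, q3} \<union> S1 \<union> S2 \<union> S3)" "S1 \<inter> S2 = {}" "S2 \<inter> S3 = {}" "S3 \<inter> S1 = {}"
     "q1 \<notin> S1 \<union> S2 \<union> S3" "q2 \<notin> S1 \<union> S2 \<union> S3" "q3 \<notin> S1 \<union> S2 \<union> S3" "q1 \<noteq> q2" "q2 \<noteq> q3" "q3 \<noteq> q1"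
    using layoutD[OF L] by blast+
  have half: "d q1 x c > 0 \<and> d q2 b x > 0 \<and> d q1 q2 x > 0" if "x \<in> S1" for x
    using layoutD(12-15)[OF L] abc that by blast
  have half2: "d q2 x a > 0 \<and> d q3 c x > 0 \<and> d q2 q3 x > 0" if "x \<in> S2" for x
    using layoutD(12-15)[OF L] abc that by blast
  have half3: "d q3 x b > 0 \<and> d q1 a x > 0 \<and> d q3 q1 x > 0" if "x \<in> S3" for x
    using layoutD(12-15)[OF L] abc that by blast
  have "\<exists>B T. is_chain q1 q2 (insert a (A1 \<union> C1)) as1 bs1 B T"
  proof (rule chain_from_strips[OF s1 s2 c1(3,2)])
    show "gp (insert q1 (insert q2 (insert a (A1 \<union> C1))))"
      using c1(1) by (intro gp_subset[OF lay(1)]) auto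
  qed (use half lay c1(1,6) in auto)
  then obtain B1 T1 where "is_chain q1 q2 S1 as1 bs1 B1 T1" using c1(1) by auto
  note h1 = is_chainD[OF this]
  have "\<exists>B T. is_chain q2 q3 (insert b (A2 \<union> C2)) as2 bs2 B T"
  proof (rule chain_from_strips[OF s2 s3 c2(3,2)])
    show "gp (insert q2 (insert q3 (insert b (A2 \<union> C2))))"
      using c2(1) by (intro gp_subset[OF lay(1)]) auto
  qed (use half2 lay c2(1,6) in auto)
  then obtain B2 T2 where "is_chain q2 q3 S2 as2 bs2 B2 T2" using c2(1) by auto
  note h2 = is_chainD[OF this]
  have "\<exists>B T. is_chain q3 q1 (insert c (A3 \<union> C3)) as3 bs3 B T"
  proof (rule chain_from_strips[OF s3 s1 c3(3,2)])
    show "gp (insert q3 (insert q1 (insert c (A3 \<union> C3))))"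
      using c3(1) by (intro gp_subset[OF lay(1)]) auto
  qed (use half3 lay c3(1,6) in auto)
  then obtain B3 T3 where "is_chain q3 q1 S3 as3 bs3 B3 T3" using c3(1) by auto
  note h3 = is_chainD[OF this]
  let ?L1 = "q1 # B1 @ [q2]" and ?L2 = "q2 # B2 @ [q3]" and ?L3 = "q3 # B3 @ [q1]"
  define D where "D = D1 @ D2 @ D3 @ [(a, b, c)] @ T1 @ T2 @ T3"
  have bnd: "bounds D (q1, q2, q3)"
    unfolding bounds_def
  proof (intro allI impI)
    fix \<phi> :: "'a \<Rightarrow> 'a \<Rightarrow> real" assume s: "skew \<phi>"
    show "(\<Sum>t\<leftarrow>D. bd \<phi> t) = bd \<phi> (q1, q2, q3)"
      using is_stripD(9)[OF s1 s] is_stripD(9)[OF s2 s] is_stripD(9)[OF s3 s]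
        h1(3,6)[OF s] h2(3,6)[OF s] h3(3,6)[OF s]
        skew_eq[OF s, of c a] skew_eq[OF s, of b a] skew_eq[OF s, of c b]
      by (simp add: D_def)
  qed
  have "filling q1 q2 q3 B1 B2 B3 D"
    unfolding filling_def
  proof (intro conjI allI impI)
    show "distinct (q1 # B1 @ q2 # B2 @ q3 # B3)"
      using h1(1,2) h2(1,2) h3(1,2) lay by auto
    show "bounds D (q1, q2, q3)" by (rule bnd)
    show "{q1, q2, q3} \<union> set B1 \<union> set B2 \<union> set B3 \<subseteq> \<Union> (corners ` set D)"
    proof -
      have "S1 \<union> S2 \<union> S3 \<subseteq> \<Union> (corners ` set D)"
        using is_stripD(11)[OF s1] is_stripD(11)[OF s2] is_stripD(11)[OF s3] c1(1) c2(1) c3(1)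
        unfolding D_def by auto
      moreover have "{q1, q2, q3} \<subseteq> \<Union> (corners ` set D)" using bnd lay by (intro bounds_corners) auto
      ultimately show ?thesis using h1(1) h2(1) h3(1) by auto
    qed
    fix x y z assume t: "(x, y, z) \<in> set D"
    have r1: "d x y z > 0 \<and> (inner ?L1 (x, y, z) \<or> inner ?L3 (x, y, z))" if "(x, y, z) \<in> set D1"
      using that h1(1,4) h3(1,5) lay c1(1) c3(1) by (intro strip_inner[OF s1]) auto
    have r2: "d x y z > 0 \<and> (inner ?L2 (x, y, z) \<or> inner ?L1 (x, y, z))" if "(x, y, z) \<in> set D2"
      using that h2(1,4) h1(1,5) lay c1(1) c2(1) by (intro strip_inner[OF s2]) auto
    have r3: "d x y z > 0 \<and> (inner ?L3 (x, y, z) \<or> inner ?L2 (x, y, z))" if "(x, y, z) \<in> set D3"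
      using that h3(1,4) h2(1,5) lay c2(1) c3(1) by (intro strip_inner[OF s3]) auto
    have r4: "spread (set ?L1 - set ?L2 - set ?L3) (set ?L2 - set ?L3 - set ?L1) (set ?L3 - set ?L1 - set ?L2) (a, b, c)"
      using abc h1(1) h2(1) h3(1) lay by auto
    have "d x y z > 0 \<and> allowed ?L1 ?L2 ?L3 (x, y, z)"
      using t r1 r2 r3 r4 abc(4) h1(7)[of x y z] h2(7)[of x y z] h3(7)[of x y z]
      unfolding D_def allowed_def set_append Un_iff by (elim disjE) (simp_all del: inner.simps pocket.simps spread.simps, auto simp del: inner.simps pocket.simps spread.simps)
    then show "d x y z > 0" "allowed ?L1 ?L2 ?L3 (x, y, z)" by auto
    show "{x, y, z} \<subseteq> set (q1 # B1 @ q2 # B2 @ q3 # B3)"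
    proof -
      let ?V = "set (q1 # B1 @ q2 # B2 @ q3 # B3)"
      have V: "?V = {q1, q2, q3} \<union> S1 \<union> S2 \<union> S3" using h1(1) h2(1) h3(1) by auto
      have X: "insert q1 (insert a A1 \<union> insert c C3) \<subseteq> ?V" "insert q2 (insert b A2 \<union> insert a C1) \<subseteq> ?V"
        "insert q3 (insert c A3 \<union> insert b C2) \<subseteq> ?V" unfolding V using c1(1) c2(1) c3(1) by blast+
      have Y: "set ?L1 \<subseteq> ?V" "set ?L2 \<subseteq> ?V" "set ?L3 \<subseteq> ?V" by auto
      from t consider "(x, y, z) \<in> set D1" | "(x, y, z) \<in> set D2" | "(x, y, z) \<in> set D3"
        | "(x, y, z) = (a, b, c)" | "(x, y, z) \<in> set T1" | "(x, y, z) \<in> set T2" | "(x, y, z) \<in> set T3"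
        unfolding D_def by auto
      then show ?thesis
      proof cases
        case 1 then show ?thesis using strip_corners[OF s1] X(1) by (meson order_trans)
      next
        case 2 then show ?thesis using strip_corners[OF s2] X(2) by (meson order_trans)
      next
        case 3 then show ?thesis using strip_corners[OF s3] X(3) by (meson order_trans)
      next
        case 4 then show ?thesis unfolding V using abc(1-3) by auto
      next
        case 5 then show ?thesis using h1(7)[OF 5] pocket_corners Y(1) by (meson order_trans)
      next
        case 6 then show ?thesis using h2(7)[OF 6] pocket_corners Y(2) by (meson order_trans)
      next
        case 7 then show ?thesis using h3(7)[OF 7] pocket_corners Y(3) by (meson order_trans)
      qed
    qed
  qed
  then show ?thesis using h1(1) h2(1) h3(1) unfolding filled_def by blast
qed

text \<open>The path ends at the hull vertex \<open>r\<close>, and its other points are to the left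
  of \<open>qr\<close>. Further vertices of a convex chain from \<open>q\<close> to \<open>r\<close>
  would be to the right of it, so the funnel collapses to the edge \<open>qr\<close>.\<close>

lemma side_pocket:
  assumes "peeled q as" "as \<noteq> []" "last as = r" "set as = insert r S" "r \<notin> S" "distinct (q # as)"
    "gp (insert q (set as))" "\<And>x. x \<in> set as \<Longrightarrow> d q x p > 0" "\<And>x. x \<in> S \<Longrightarrow> d q r x > 0"
  shows "\<exists>T. (\<forall>\<phi>. skew \<phi> \<longrightarrow> (\<Sum>t\<leftarrow>T. bd \<phi> t) = \<phi> q r - walk \<phi> (q # as)) \<and>
     (\<forall>x y z. (x, y, z) \<in> set T \<longrightarrow> d x y z > 0 \<and> subseq [z, y, x] (q # as))"
proof -
  obtain F T where "is_funnel q as F T" using funnel[OF assms(1,2,6,7,8)] by blast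
  note F = is_funnelD[OF this]
  have dF: "distinct F" using subseq_distinct[OF F(4)] assms(6) by simp
  have "F = [r]"
  proof (cases F)
    case (Cons f F')
    show ?thesis
    proof (cases F')
      case Nil then show ?thesis using Cons F(3) assms(3) by simp
    next
      case (Cons f' F'')
      then have len: "1 < length F" using \<open>F = f # F'\<close> by simp
      have fr: "last F = r" using F(3) assms(3) by simp
      then have "d q f r > 0"
        using cvxD[OF F(1), of 0 1 "length F"] len \<open>F = f # F'\<close> last_conv_nth[OF F(2)] by (simp add: nth_Cons')
      moreover have "f \<noteq> r" using dF fr Cons \<open>F = f # F'\<close> by (metis distinct.simps(2) last.simps last_in_set list.distinct(1))
      then have "f \<in> S" using subseq_set[OF F(4)] \<open>F = f # F'\<close> assms(4) by auto
      then have "d q r f > 0" using assms(9) by blast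
      ultimately show ?thesis using sw2[of q f r] by simp
    qed
  qed (use F(2) in simp)
  then have "(\<Sum>t\<leftarrow>map reversed T. bd \<phi> t) = \<phi> q r - walk \<phi> (q # as)" if "skew \<phi>" for \<phi>
    using F(5)[OF that] sum_reversed[OF that, of T] by simp
  moreover have "d x y z > 0 \<and> subseq [z, y, x] (q # as)" if "(x, y, z) \<in> set (map reversed T)" for x y z
    using that F(6)[of z y x] sw3[of x y z] unfolding in_reversed by simp
  ultimately show ?thesis by blast
qed

text \<open>The edge \<open>a q3\<close> separates \<open>S3\<close> from \<open>S2\<close> and
  replaces the central triangle: \<open>q3\<close> joins both of these classes as the outer end of a
  strip, and only the class of \<open>a\<close> is divided, by the line \<open>a q3\<close>.\<close>

theorem filled_of_hub:
  assumes L: "layout q1 q2 q3 S1 S2 S3" and a: "a \<in> S1"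
    and hub: "\<And>z. z \<in> S3 \<Longrightarrow> d q3 z a > 0" "\<And>y. y \<in> S2 \<Longrightarrow> d q3 a y > 0"
  shows "filled q1 q2 q3 S1 S2 S3"
proof -
  interpret neg: chiro "\<lambda>a b c. - d a b c" by (rule neg_chiro)
  have neg_gp: "neg.gp V \<longleftrightarrow> gp V" for V unfolding neg.gp_def gp_def by auto
  note l = layoutD[OF L]
  have hull: "d q1 x q3 > 0" "d q2 q3 x > 0" "d q1 q2 x > 0" "d q3 q1 x > 0" if "x \<in> S1 \<union> S2 \<union> S3" for x
    using l(12)[OF that] rot[of q3 q1 x] by auto
  define A C where "A = {p \<in> S1 - {a}. d q3 a p < 0}" and "C = {p \<in> S1 - {a}. d q3 a p > 0}"
  have nz: "d q3 a p \<noteq> 0" if "p \<in> S1 - {a}" for p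
    using that a l(9) by (intro gpD[OF l(11)]) auto
  have S1: "S1 = insert a (A \<union> C)" "A \<inter> C = {}" "a \<notin> A \<union> C"
    using nz a by (auto simp: A_def C_def linorder_neq_iff)
  have srt: "d a f g > 0" if fg: "f \<in> insert q1 A" "g \<in> insert q2 C" "f = q1 \<or> d a q1 f > 0" "g = q2 \<or> d a g q2 > 0" for f g
  proof (rule sort_split[of a q1 q2 "\<lambda>p. 1 * d a q3 p + 0 * d a a p" 1 q3 0 a])
    show "d a q1 q2 > 0" using hull(3)[of a] a rot[of a q1 q2] by auto
    have h1: "d a q3 q1 > 0" using hull(4)[of a] a rot[of a q3 q1] by auto
    have h2: "d a q3 q2 < 0" using hull(2)[of a] a rot[of a q3 q2] sw[of q2 q3 a] by auto
    show "1 * d a q3 q1 + 0 * d a a q1 > 0" "1 * d a q3 q2 + 0 * d a a q2 < 0" using h1 h2 by auto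
    show "1 * d a q3 f + 0 * d a a f \<ge> 0" using fg(1) h1 sw[of q3 a f] by (auto simp: A_def)
    show "1 * d a q3 g + 0 * d a a g \<le> 0" using fg(2) h2 sw[of q3 a g] by (auto simp: C_def)
    have "f \<noteq> g" "f \<noteq> a" "g \<noteq> a" using fg(1,2) l(7,8,16) a S1(2) by (auto simp: A_def C_def)
    then show "d a f g \<noteq> 0" using fg(1,2) a by (intro gpD[OF l(11)]) (auto simp: A_def C_def)
  qed (use fg in auto)
  have "\<exists>as bs D. is_strip q1 (insert a A) (insert q3 S3) a q3 as bs D"
  proof (rule strip)
    show "gp (insert q1 (insert a A \<union> insert q3 S3))"
      using a by (intro gp_subset[OF l(11)]) (auto simp: A_def)
    show "d q1 x y > 0" if "x \<in> insert a A" "y \<in> insert q3 S3" for x y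
      using that l(13)[of x y] hull(1)[of x] a by (auto simp: A_def)
    show "d q3 a p < 0" if "p \<in> insert a A \<union> insert q3 S3 - {a, q3}" for p
      using that hub(1)[of p] sw2[of q3 a p] by (auto simp: A_def)
  qed (use l(1,3) in \<open>auto simp: A_def\<close>)
  then obtain as1 bs3 D1 where s1: "is_strip q1 (insert a A) (insert q3 S3) a q3 as1 bs3 D1" by blast
  have "\<exists>as bs D. is_strip q2 (insert q3 S2) (insert a C) q3 a as bs D"
  proof (rule strip)
    show "gp (insert q2 (insert q3 S2 \<union> insert a C))"
      using a by (intro gp_subset[OF l(11)]) (auto simp: C_def)
    show "d q2 x y > 0" if "x \<in> insert q3 S2" "y \<in> insert a C" for x y
      using that l(14)[of x y] hull(2)[of y] a by (auto simp: C_def)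
    show "d a q3 p < 0" if "p \<in> insert q3 S2 \<union> insert a C - {q3, a}" for p
      using that hub(2)[of p] sw[of a q3 p] by (auto simp: C_def)
  qed (use l(1,2) in \<open>auto simp: C_def\<close>)
  then obtain as2 bs1 D2 where s2: "is_strip q2 (insert q3 S2) (insert a C) q3 a as2 bs1 D2" by blast
  note i1 = is_stripD[OF s1] and i2 = is_stripD[OF s2]
  have "\<exists>B T. is_chain q1 q2 (insert a (A \<union> C)) as1 bs1 B T"
  proof (rule chain_from_strips[OF s1 s2 S1(2,3)])
    show "gp (insert q1 (insert q2 (insert a (A \<union> C))))"
      using S1(1) by (intro gp_subset[OF l(11)]) auto
    show "d q1 x q3 > 0 \<and> d q2 q3 x > 0 \<and> d q1 q2 x > 0" if "x \<in> insert a (A \<union> C)" for x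
      using hull[of x] that S1(1) by auto
  qed (use l(7,8,16) S1(1) srt in auto)
  then obtain B1 T1 where "is_chain q1 q2 S1 as1 bs1 B1 T1" using S1(1) by auto
  note h1 = is_chainD[OF this]
  have "\<exists>T. (\<forall>\<phi>. skew \<phi> \<longrightarrow> (\<Sum>t\<leftarrow>T. bd \<phi> t) = \<phi> q2 q3 - walk \<phi> (q2 # as2)) \<and>
     (\<forall>x y z. (x, y, z) \<in> set T \<longrightarrow> d x y z > 0 \<and> subseq [z, y, x] (q2 # as2))"
  proof (rule side_pocket[OF i2(12,3,4,2)])
    show "distinct (q2 # as2)" using i2(1,2) l(8,17) by auto
    show "gp (insert q2 (set as2))" using i2(2) by (intro gp_subset[OF l(11)]) auto
    show "d q2 x a > 0" if "x \<in> set as2" for x using that i2(2) a l(14)[of x a] hull(2)[of a] by auto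
  qed (use l(9) hull(2) in auto)
  then obtain T2 where T2: "\<And>\<phi>. skew \<phi> \<Longrightarrow> (\<Sum>t\<leftarrow>T2. bd \<phi> t) = \<phi> q2 q3 - walk \<phi> (q2 # as2)"
     "\<And>x y z. (x, y, z) \<in> set T2 \<Longrightarrow> d x y z > 0 \<and> subseq [z, y, x] (q2 # as2)" by blast
  have "\<exists>T. (\<forall>\<phi>. skew \<phi> \<longrightarrow> (\<Sum>t\<leftarrow>T. bd \<phi> t) = \<phi> q1 q3 - walk \<phi> (q1 # bs3)) \<and>
     (\<forall>x y z. (x, y, z) \<in> set T \<longrightarrow> - d x y z > 0 \<and> subseq [z, y, x] (q1 # bs3))"
  proof (rule neg.side_pocket[OF i1(13,7,8,6)])
    show "distinct (q1 # bs3)" using i1(5,6) l(7,18) by auto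
    show "neg.gp (insert q1 (set bs3))" unfolding neg_gp using i1(6) by (intro gp_subset[OF l(11)]) auto
    show "0 < - d q1 x a" if "x \<in> set bs3" for x
      using that i1(6) a l(13)[of a x] hull(1)[of a] sw2[of q1 x a] by auto
    show "0 < - d q1 q3 x" if "x \<in> S3" for x using that hull(4)[of x] sw[of q1 q3 x] by simp
  qed (use l(9) in auto)
  then obtain T3 where T3: "\<And>\<phi>. skew \<phi> \<Longrightarrow> (\<Sum>t\<leftarrow>T3. bd \<phi> t) = \<phi> q1 q3 - walk \<phi> (q1 # bs3)"
     "\<And>x y z. (x, y, z) \<in> set T3 \<Longrightarrow> - d x y z > 0 \<and> subseq [z, y, x] (q1 # bs3)" by blast
  define B2 B3 where "B2 = butlast as2" and "B3 = rev (butlast bs3)"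
  have as2: "as2 = B2 @ [q3]" and bs3: "bs3 = rev B3 @ [q3]"
    using i2(3,4) i1(7,8) by (simp_all add: B2_def B3_def) (metis append_butlast_last_id)+
  have B23: "set B2 = S2" "set B3 = S3" "distinct B2" "distinct B3"
    using i2(1,2) i1(5,6) l(9) by (auto simp: as2 bs3)
  let ?L1 = "q1 # B1 @ [q2]" and ?L2 = "q2 # B2 @ [q3]" and ?L3 = "q3 # B3 @ [q1]"
  have L23: "?L2 = q2 # as2" "?L3 = rev (q1 # bs3)" by (simp_all add: as2 bs3)
  have rv: "subseq (rev (q1 # bs3)) ?L3" "subseq (q2 # as2) ?L2" unfolding L23 by simp_all
  note dj = l(4-9,16-18)
  define D where "D = D1 @ D2 @ T1 @ T2 @ map reversed T3"
  have bnd: "bounds D (q1, q2, q3)"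
    unfolding bounds_def
  proof (intro allI impI)
    fix \<phi> :: "'a \<Rightarrow> 'a \<Rightarrow> real" assume s: "skew \<phi>"
    show "(\<Sum>t\<leftarrow>D. bd \<phi> t) = bd \<phi> (q1, q2, q3)"
      using is_stripD(9)[OF s1 s] is_stripD(9)[OF s2 s] h1(3,6)[OF s] T2(1)[OF s] T3(1)[OF s]
        sum_reversed[OF s, of T3] skew_eq[OF s, of a q3] skew_eq[OF s, of q3 q1]
      by (simp add: D_def)
  qed
  have "filling q1 q2 q3 B1 B2 B3 D"
    unfolding filling_def
  proof (intro conjI allI impI)
    show "distinct (q1 # B1 @ q2 # B2 @ q3 # B3)" using h1(1,2) B23 dj by auto
    show "bounds D (q1, q2, q3)" by (rule bnd)
    show "{q1, q2, q3} \<union> set B1 \<union> set B2 \<union> set B3 \<subseteq> \<Union> (corners ` set D)"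
    proof -
      have "S1 \<union> S2 \<union> S3 \<subseteq> \<Union> (corners ` set D)"
        using is_stripD(11)[OF s1] is_stripD(11)[OF s2] S1(1) unfolding D_def by auto
      moreover have "{q1, q2, q3} \<subseteq> \<Union> (corners ` set D)" using bnd l(16-18) by (intro bounds_corners) auto
      ultimately show ?thesis using h1(1) B23 by auto
    qed
    fix x y z assume t: "(x, y, z) \<in> set D"
    have r1: "d x y z > 0 \<and> (inner ?L1 (x, y, z) \<or> inner ?L3 (x, y, z))" if "(x, y, z) \<in> set D1"
      by (rule strip_inner[OF s1 h1(4) rv(1) _ _ that]) (use h1(1) B23(1,2) dj S1(1) in auto)
    have r2: "d x y z > 0 \<and> (inner ?L2 (x, y, z) \<or> inner ?L1 (x, y, z))" if "(x, y, z) \<in> set D2"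
      by (rule strip_inner[OF s2 rv(2) h1(5) _ _ that]) (use h1(1) B23(1,2) dj S1(1) in auto)
    have r3: "d x y z > 0 \<and> pocket ?L3 (x, y, z)" if "(x, y, z) \<in> set (map reversed T3)"
    proof -
      have "- d z y x > 0" "subseq [x, y, z] (q1 # bs3)" using T3(2)[of z y x] that[unfolded in_reversed] by auto
      then show ?thesis
        unfolding L23(2) pocket.simps using sw3[of x y z] subseq_rev[of "[x, y, z]" "q1 # bs3"] by simp
    qed
    have r4: "d x y z > 0 \<and> pocket ?L2 (x, y, z)" if "(x, y, z) \<in> set T2"
      using T2(2)[OF that] unfolding L23 by simp
    have "d x y z > 0 \<and> allowed ?L1 ?L2 ?L3 (x, y, z)"
      using t r1 r2 r3 r4 h1(7)[of x y z]
      unfolding D_def allowed_def set_append Un_iff by (elim disjE) (simp_all del: inner.simps pocket.simps spread.simps set_map, auto simp del: inner.simps pocket.simps spread.simps)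
    then show "d x y z > 0" "allowed ?L1 ?L2 ?L3 (x, y, z)" by auto
    show "{x, y, z} \<subseteq> set (q1 # B1 @ q2 # B2 @ q3 # B3)"
    proof -
      let ?V = "set (q1 # B1 @ q2 # B2 @ q3 # B3)"
      have V: "?V = {q1, q2, q3} \<union> S1 \<union> S2 \<union> S3" using h1(1) B23(1,2) by auto
      have X: "insert q1 (insert a A \<union> insert q3 S3) \<subseteq> ?V" "insert q2 (insert q3 S2 \<union> insert a C) \<subseteq> ?V"
        unfolding V using S1(1) by blast+
      have Y: "set ?L1 \<subseteq> ?V" "set ?L2 \<subseteq> ?V" "set ?L3 \<subseteq> ?V" by auto
      from t consider "(x, y, z) \<in> set D1" | "(x, y, z) \<in> set D2"
        | "(x, y, z) \<in> set T1" | "(x, y, z) \<in> set T2" | "(x, y, z) \<in> set (map reversed T3)"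
        unfolding D_def set_append Un_iff by blast
      then show ?thesis
      proof cases
        case 1 then show ?thesis using strip_corners[OF s1] X(1) by (meson order_trans)
      next
        case 2 then show ?thesis using strip_corners[OF s2] X(2) by (meson order_trans)
      next
        case 3 then show ?thesis using h1(7)[OF 3] pocket_corners Y(1) by (meson order_trans)
      next
        case 4 then show ?thesis using r4[OF 4] pocket_corners Y(2) by (meson order_trans)
      next
        case 5 then show ?thesis using r3[OF 5] pocket_corners Y(3) by (meson order_trans)
      qed
    qed
  qed
  then show ?thesis using h1(1) B23 unfolding filled_def by blast
qed

end

section \<open>Finding the centre of the point set\<close>

context chiro begin

text \<open>As in \<open>first_hit\<close>, but with a ray that turns counterclockwise over the
  points, of which the last one met is wanted.\<close>

lemma last_hit:
  assumes "finite T" "T \<noteq> {}" "\<And>p. p \<in> T \<Longrightarrow> d e r p > 0" "gp (insert e T)" "e \<notin> T"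
  shows "\<exists>w\<in>T. \<forall>p\<in>T - {w}. d e w p < 0"
  using assms
proof (induction T rule: finite_ne_induct)
  case (insert x T)
  then obtain w where w: "w \<in> T" "\<forall>p\<in>T - {w}. d e w p < 0"
    using gp_subset[of "insert e (insert x T)" "insert e T"] by auto
  have wx: "w \<noteq> x" using w(1) insert by auto
  have nz: "d e w x \<noteq> 0"
    using insert.prems w wx by (intro gpD[OF insert.prems(2)]) auto
  show ?case
  proof (cases "d e w x < 0")
    case True
    then show ?thesis using w by (intro bexI[of _ w]) auto
  next
    case False
    then have wx': "d e w x > 0" using nz by linarith
    have "d e x p < 0" if p: "p \<in> T" for p
    proof (cases "p = w")
      case False
      then have pw: "d e p w > 0" using w p sw2[of e p w] by auto
      have "d e p x > 0"
        using trans_left[of e r p w x] pw wx' insert.prems(1)[of p] insert.prems(1)[of w] insert.prems(1)[of x] p w by simp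
      then show ?thesis using sw2[of e x p] by simp
    qed (use wx' sw2[of e x w] in auto)
    then show ?thesis using insert.hyps by (intro bexI[of _ x]) auto
  qed
qed auto

text \<open>A proper crossing, expressed by signs because the abstract setting has no points between
  two given ones.\<close>

definition crossing :: "'a \<Rightarrow> 'a \<Rightarrow> 'a \<Rightarrow> 'a \<Rightarrow> bool" where
  "crossing x x' y y' \<longleftrightarrow> d x x' y * d x x' y' < 0 \<and> d y y' x * d y y' x' < 0"

text \<open>At a common point \<open>m\<close> of the segments, \<open>d q m m\<close> vanishes;
  writing \<open>m\<close> along either segment gives the identity \<open>cross\<close>. If no end
  is \<open>q\<close>, a crossing makes its four terms non-zero and of equal sign. A segment that
  ends in \<open>q\<close> is not crossed, because the other class lies weakly on one side of
  it.\<close>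

lemma no_crossing:
  assumes sep: "\<And>x y. x \<in> A \<Longrightarrow> y \<in> B \<Longrightarrow> d q x y > 0"
    and x: "x \<in> insert q A" "x' \<in> insert q A" and y: "y \<in> insert q B" "y' \<in> insert q B"
  shows "\<not> crossing x x' y y'"
proof
  assume c: "crossing x x' y y'"
  have nn: "d q u w \<ge> 0" if "u \<in> insert q A" "w \<in> insert q B" for u w
    using that sep[of u w] by auto
  have xq: "x \<noteq> q"
  proof
    assume "x = q"
    then have "d x x' y * d x x' y' \<ge> 0" using nn x y by simp
    then show False using c by (simp add: crossing_def)
  qed
  have xq': "x' \<noteq> q"
  proof
    assume "x' = q"
    then have "d x x' y \<le> 0" "d x x' y' \<le> 0" using nn[of x y] nn[of x y'] x y sw[of x q] by auto
    then have "d x x' y * d x x' y' \<ge> 0" by (simp add: mult_nonpos_nonpos)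
    then show False using c by (simp add: crossing_def)
  qed
  have yq: "y \<noteq> q"
  proof
    assume "y = q"
    then have "d y y' x \<le> 0" "d y y' x' \<le> 0" using nn[of x y'] nn[of x' y'] x y sw2[of q y'] by auto
    then have "d y y' x * d y y' x' \<ge> 0" by (simp add: mult_nonpos_nonpos)
    then show False using c by (simp add: crossing_def)
  qed
  have yq': "y' \<noteq> q"
  proof
    assume "y' = q"
    then have "d y y' x \<ge> 0" "d y y' x' \<ge> 0" using nn[of x y] nn[of x' y] x y rot[of q] rot[of y q] by auto
    then have "d y y' x * d y y' x' \<ge> 0" by simp
    then show False using c by (simp add: crossing_def)
  qed
  define P P' R R' where "P = d y y' x" and "P' = d y y' x'" and "R = d x x' y" and "R' = d x x' y'"
  have pos: "d q x y > 0" "d q x y' > 0" "d q x' y > 0" "d q x' y' > 0"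
    using sep x y xq xq' yq yq' by auto
  have e: "- (P' * R' * d q x y) + P' * R * d q x y' + P * R' * d q x' y - P * R * d q x' y' = 0"
    using cross[of y y' x' x q] by (simp add: P_def P'_def R_def R'_def algebra_simps)
  have s: "P * P' < 0" "R * R' < 0" using c by (simp_all add: crossing_def P_def P'_def R_def R'_def)
  have "(P' * R' > 0 \<and> P' * R < 0 \<and> P * R' < 0 \<and> P * R > 0) \<or> (P' * R' < 0 \<and> P' * R > 0 \<and> P * R' > 0 \<and> P * R < 0)"
    using s by (auto simp: mult_less_0_iff zero_less_mult_iff)
  then show False
  proof (elim disjE conjE)
    assume a: "P' * R' > 0" "P' * R < 0" "P * R' < 0" "P * R > 0"
    have "P' * R' * d q x y > 0" "P' * R * d q x y' < 0" "P * R' * d q x' y < 0" "P * R * d q x' y' > 0"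
      using a pos by (auto intro: mult_pos_pos mult_neg_pos)
    then show False using e by linarith
  next
    assume a: "P' * R' < 0" "P' * R > 0" "P * R' > 0" "P * R < 0"
    have "P' * R' * d q x y < 0" "P' * R * d q x y' > 0" "P * R' * d q x' y > 0" "P * R * d q x' y' < 0"
      using a pos by (auto intro: mult_pos_pos mult_neg_pos)
    then show False using e by linarith
  qed
qed

text \<open>Pasch's axiom with signs: the line \<open>yy'\<close> meets \<open>pv\<close>, hence
  also one of the other two sides, depending on where \<open>u\<close> lies. That the segment
  reaches this side follows from both of its ends being outside the triangle.\<close>

lemma crossing_triangle:
  assumes tri: "d v u p > 0" and c: "crossing p v y y'"
    and out: "\<not> (d v u y > 0 \<and> d u p y > 0 \<and> d p v y > 0)" "\<not> (d v u y' > 0 \<and> d u p y' > 0 \<and> d p v y' > 0)"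
    and gp: "gp {v, u, p, y, y'}" and ne: "u \<noteq> y" "u \<noteq> y'"
  shows "crossing u v y y' \<or> crossing u p y y'"
proof -
  have main: "crossing u v y y' \<or> crossing u p y y'"
    if c: "crossing p v y y'" and y: "d p v y > 0" "d p v y' < 0"
      and out: "\<not> (d v u y > 0 \<and> d u p y > 0 \<and> d p v y > 0)" and gp: "gp {v, u, p, y, y'}" and ne: "u \<noteq> y" "u \<noteq> y'"
    for y y'
  proof -
    define l where "l = (\<lambda>x. d y y' x)"
    have yy: "y \<noteq> y'" using y by auto
    have dist: "v \<noteq> u" "u \<noteq> p" "v \<noteq> p" using tri by auto
    have dist2: "p \<noteq> y" "v \<noteq> y" "p \<noteq> y'" "v \<noteq> y'" using y by auto
    \<comment> \<open>The line function \<open>l\<close> vanishes at \<open>y\<close>; in the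
      barycentric coordinates of \<open>y\<close> this excludes three terms of the same
      sign.\<close>
    have ly: "0 = d u p y * l v + d p v y * l u + d v u y * l p"
      using lin[of v u p y y' y] by (simp add: l_def)
    have ly': "0 = d u p y' * l v + d p v y' * l u + d v u y' * l p"
      using lin[of v u p y y' y'] by (simp add: l_def)
    have sum: "d u p y + d p v y + d v u y > 0" "d u p y' + d p v y' + d v u y' > 0"
      using tri four[of v u y p] four[of v u y' p] by linarith+
    have lpv: "l p * l v < 0" using c by (simp add: crossing_def l_def)
    have lu: "l u \<noteq> 0" unfolding l_def using ne yy by (intro gpD[OF gp]) auto
    have nzs: "d v u y \<noteq> 0" "d v u y' \<noteq> 0" "d u p y \<noteq> 0" "d u p y' \<noteq> 0"
      using dist dist2 ne by (intro gpD[OF gp]; simp)+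
    show ?thesis
    proof (cases "l u * l v < 0")
      case True
      then have "l u * l p > 0" using lpv by (auto simp: mult_less_0_iff zero_less_mult_iff)
      have "d v u y < 0"
      proof (rule ccontr)
        assume "\<not> ?thesis"
        then have 1: "d v u y > 0" using nzs by linarith
        then have 2: "d u p y < 0" using out y nzs by auto
        show False
        proof (cases "l v < 0")
          case True
          then have "l u > 0" "l p > 0" using \<open>l u * l v < 0\<close> lpv by (auto simp: mult_less_0_iff)
          then have "d u p y * l v > 0" "d p v y * l u > 0" "d v u y * l p > 0" using 1 2 y True by (auto intro: mult_pos_pos mult_neg_neg)
          then show False using ly by linarith
        next
          case False
          then have "l v > 0" "l u < 0" "l p < 0" using \<open>l u * l v < 0\<close> lpv by (auto simp: mult_less_0_iff)
          then have "d u p y * l v < 0" "d p v y * l u < 0" "d v u y * l p < 0" using 1 2 y by (auto intro: mult_pos_neg mult_neg_pos)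
          then show False using ly by linarith
        qed
      qed
      moreover have "d v u y' > 0"
      proof (rule ccontr)
        assume "\<not> ?thesis"
        then have 1: "d v u y' < 0" using nzs by linarith
        then have 2: "d u p y' > 0" using sum y by linarith
        show False
        proof (cases "l v < 0")
          case True
          then have "l u > 0" "l p > 0" using \<open>l u * l v < 0\<close> lpv by (auto simp: mult_less_0_iff)
          then have "d u p y' * l v < 0" "d p v y' * l u < 0" "d v u y' * l p < 0" using 1 2 y True by (auto intro: mult_pos_neg mult_neg_pos)
          then show False using ly' by linarith
        next
          case False
          then have "l v > 0" "l u < 0" "l p < 0" using \<open>l u * l v < 0\<close> lpv by (auto simp: mult_less_0_iff)
          then have "d u p y' * l v > 0" "d p v y' * l u > 0" "d v u y' * l p > 0" using 1 2 y by (auto intro: mult_pos_pos mult_neg_neg)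
          then show False using ly' by linarith
        qed
      qed
      ultimately have "d u v y * d u v y' < 0" using sw[of u v y] sw[of u v y'] by (simp add: mult_neg_pos)
      then show ?thesis using True by (simp add: crossing_def l_def)
    next
      case False
      then have uv: "l u * l v > 0" using lu lpv by (auto simp: mult_less_0_iff zero_less_mult_iff not_less)
      then have up: "l u * l p < 0" using lpv by (auto simp: mult_less_0_iff zero_less_mult_iff)
      have "d u p y < 0"
      proof (rule ccontr)
        assume "\<not> ?thesis"
        then have 1: "d u p y > 0" using nzs by linarith
        then have 2: "d v u y < 0" using out y nzs by auto
        show False
        proof (cases "l v < 0")
          case True
          then have "l u < 0" "l p > 0" using uv lpv by (auto simp: mult_less_0_iff zero_less_mult_iff)
          then have "d u p y * l v < 0" "d p v y * l u < 0" "d v u y * l p < 0" using 1 2 y True by (auto intro: mult_pos_neg mult_neg_pos)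
          then show False using ly by linarith
        next
          case False
          then have "l v > 0" "l u > 0" "l p < 0" using uv lpv by (auto simp: mult_less_0_iff zero_less_mult_iff)
          then have "d u p y * l v > 0" "d p v y * l u > 0" "d v u y * l p > 0" using 1 2 y by (auto intro: mult_pos_pos mult_neg_neg)
          then show False using ly by linarith
        qed
      qed
      moreover have "d u p y' > 0"
      proof (rule ccontr)
        assume "\<not> ?thesis"
        then have 1: "d u p y' < 0" using nzs by linarith
        then have 2: "d v u y' > 0" using sum y by linarith
        show False
        proof (cases "l v < 0")
          case True
          then have "l u < 0" "l p > 0" using uv lpv by (auto simp: mult_less_0_iff zero_less_mult_iff)
          then have "d u p y' * l v > 0" "d p v y' * l u > 0" "d v u y' * l p > 0" using 1 2 y True by (auto intro: mult_pos_pos mult_neg_neg)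
          then show False using ly' by linarith
        next
          case False
          then have "l v > 0" "l u > 0" "l p < 0" using uv lpv by (auto simp: mult_less_0_iff zero_less_mult_iff)
          then have "d u p y' * l v < 0" "d p v y' * l u < 0" "d v u y' * l p < 0" using 1 2 y by (auto intro: mult_pos_neg mult_neg_pos)
          then show False using ly' by linarith
        qed
      qed
      ultimately have "d u p y * d u p y' < 0" by (simp add: mult_neg_pos)
      then show ?thesis using up by (simp add: crossing_def l_def)
    qed
  qed
  have "d p v y * d p v y' < 0" using c by (simp add: crossing_def)
  then consider "d p v y > 0" "d p v y' < 0" | "d p v y' > 0" "d p v y < 0" by (auto simp: mult_less_0_iff)
  then show ?thesis
  proof cases
    case 1
    then show ?thesis using main[OF c 1 out(1) gp ne] by simp
  next
    case 2
    have swp: "crossing a b y' y \<longleftrightarrow> crossing a b y y'" for a b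
      unfolding crossing_def using sw[of y' y] by (simp add: mult.commute)
    have "gp {v, u, p, y', y}" using gp by (simp add: insert_commute)
    then show ?thesis using main[of y' y] 2 out(2) ne c swp by auto
  qed
qed

section \<open>Hull edges, visibility and the sweeping front\<close>

definition hedge :: "'a set \<Rightarrow> 'a \<Rightarrow> 'a \<Rightarrow> bool" where
  "hedge K t u \<longleftrightarrow> t \<in> K \<and> u \<in> K \<and> t \<noteq> u \<and> (\<forall>x\<in>K - {t, u}. d t u x < 0)"

text \<open>The front moves away from \<open>q1\<close> along the hulls of \<open>S1\<close> and
  \<open>S3\<close> in opposite senses, so the second hull is traversed counterclockwise.\<close>

definition hedge' :: "'a set \<Rightarrow> 'a \<Rightarrow> 'a \<Rightarrow> bool" where
  "hedge' K t u \<longleftrightarrow> t \<in> K \<and> u \<in> K \<and> t \<noteq> u \<and> (\<forall>x\<in>K - {t, u}. d t u x > 0)"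

text \<open>\<open>v\<close> is beyond one of the hull edges at \<open>u\<close>, hence the segment
  \<open>uv\<close> meets the hull of \<open>K\<close> only in \<open>u\<close>.\<close>

definition vis :: "'a set \<Rightarrow> 'a \<Rightarrow> 'a \<Rightarrow> bool" where
  "vis K u v \<longleftrightarrow> (\<exists>t. hedge K t u \<and> d t u v > 0) \<or> (\<exists>p. hedge K u p \<and> d u p v > 0)"

definition vis' :: "'a set \<Rightarrow> 'a \<Rightarrow> 'a \<Rightarrow> bool" where
  "vis' K u v \<longleftrightarrow> (\<exists>t. hedge' K t u \<and> d t u v < 0) \<or> (\<exists>p. hedge' K u p \<and> d u p v < 0)"

text \<open>The segment from \<open>u\<close> to \<open>v\<close> joins vertices of the hulls of \<open>S1\<close> and \<open>S3\<close> (with their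
  corners) and avoids the interiors of the hulls of all three classes.\<close>

definition front :: "'a \<Rightarrow> 'a \<Rightarrow> 'a \<Rightarrow> 'a set \<Rightarrow> 'a set \<Rightarrow> 'a set \<Rightarrow> 'a \<Rightarrow> 'a \<Rightarrow> bool" where
  "front q1 q2 q3 S1 S2 S3 u v \<longleftrightarrow> u \<in> S1 \<and> v \<in> S3 \<and>
     (\<exists>t. hedge ({q1, q2} \<union> S1) t u) \<and> (\<exists>t. hedge' ({q1, q3} \<union> S3) t v) \<and>
     vis ({q1, q2} \<union> S1) u v \<and> vis' ({q1, q3} \<union> S3) v u \<and>
     (\<forall>y\<in>{q2, q3} \<union> S2. \<forall>y'\<in>{q2, q3} \<union> S2. \<not> crossing u v y y')"

text \<open>The line through \<open>q\<close> and \<open>a\<close> separates \<open>S\<close> from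
  \<open>T\<close>, so that \<open>qa\<close> can serve as the dividing edge.\<close>

definition hub :: "'a \<Rightarrow> 'a set \<Rightarrow> 'a set \<Rightarrow> 'a \<Rightarrow> bool" where
  "hub q S T a \<longleftrightarrow> (\<forall>z\<in>S. d q z a > 0) \<and> (\<forall>y\<in>T. d q a y > 0)"

text \<open>Exactly the conditions under which each class can be divided at its vertex of the
  triangle.\<close>

definition clean :: "'a set \<Rightarrow> 'a set \<Rightarrow> 'a set \<Rightarrow> 'a \<Rightarrow> 'a \<Rightarrow> 'a \<Rightarrow> bool" where
  "clean S1 S2 S3 a b c \<longleftrightarrow> d a b c > 0 \<and>
     (\<forall>p\<in>S1. \<not> (d a b p > 0 \<and> d c a p > 0)) \<and> (\<forall>p\<in>S2. \<not> (d b c p > 0 \<and> d a b p > 0)) \<and>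
     (\<forall>p\<in>S3. \<not> (d c a p > 0 \<and> d b c p > 0))"

definition centred :: "'a \<Rightarrow> 'a \<Rightarrow> 'a \<Rightarrow> 'a set \<Rightarrow> 'a set \<Rightarrow> 'a set \<Rightarrow> bool" where
  "centred q1 q2 q3 S1 S2 S3 \<longleftrightarrow> (\<exists>a\<in>S1. \<exists>b\<in>S2. \<exists>c\<in>S3. clean S1 S2 S3 a b c) \<or>
     (\<exists>a\<in>S1. hub q3 S3 S2 a) \<or> (\<exists>b\<in>S2. hub q1 S1 S3 b) \<or> (\<exists>c\<in>S3. hub q2 S2 S1 c)"

lemma filled_of_centred:
  assumes L: "layout q1 q2 q3 S1 S2 S3" and c: "centred q1 q2 q3 S1 S2 S3"
  shows "filled q1 q2 q3 S1 S2 S3"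
proof -
  note L2 = layout_rotate[OF L] note L3 = layout_rotate[OF L2]
  from c consider a b c where "a \<in> S1" "b \<in> S2" "c \<in> S3" "clean S1 S2 S3 a b c"
    | a where "a \<in> S1" "hub q3 S3 S2 a" | b where "b \<in> S2" "hub q1 S1 S3 b" | c where "c \<in> S3" "hub q2 S2 S1 c"
    unfolding centred_def by blast
  then show ?thesis
  proof cases
    case 1 then show ?thesis by (intro filled_of_triple[OF L 1(1-3)]) (auto simp: clean_def)
  next
    case 2 then show ?thesis by (intro filled_of_hub[OF L 2(1)]) (auto simp: hub_def)
  next
    case 3
    have "filled q2 q3 q1 S2 S3 S1" using 3 by (intro filled_of_hub[OF L2 3(1)]) (auto simp: hub_def)
    then show ?thesis by (rule filled_rotate[OF filled_rotate])
  next
    case 4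
    have "filled q3 q1 q2 S3 S1 S2" using 4 by (intro filled_of_hub[OF L3 4(1)]) (auto simp: hub_def)
    then show ?thesis by (rule filled_rotate)
  qed
qed

lemma hedge_unique:
  assumes "hedge' K v p" "hedge' K v p'"
  shows "p = p'"
proof (rule ccontr)
  assume "p \<noteq> p'"
  then have "d v p p' > 0" "d v p' p > 0" using assms unfolding hedge'_def by auto
  then show False using sw2[of v p p'] by simp
qed

lemma hedge_step:
  assumes L: "layout q1 q2 q3 S1 S2 S3" and t: "hedge ({q1, q2} \<union> S1) t u" and u: "u \<in> S1"
  shows "\<exists>p. hedge ({q1, q2} \<union> S1) u p"
proof -
  note l = layoutD[OF L]
  define T where "T = {q1, q2} \<union> S1 - {u, t}"
  have "\<exists>w\<in>T. \<forall>p\<in>T - {w}. d u w p < 0"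
  proof (rule last_hit)
    show "finite T" using l(1) by (simp add: T_def)
    show "T \<noteq> {}" using l(7,8,16) u by (auto simp: T_def)
    show "d u t p > 0" if "p \<in> T" for p
    proof -
      have "p \<in> {q1, q2} \<union> S1 - {t, u}" using that by (auto simp: T_def)
      then have "d t u p < 0" using t unfolding hedge_def by blast
      then show ?thesis using sw[of t u p] by simp
    qed
    show "gp (insert u T)" using u by (intro gp_subset[OF l(11)]) (auto simp: T_def)
  qed (simp add: T_def)
  then obtain w where w: "w \<in> T" "\<forall>p\<in>T - {w}. d u w p < 0" by blast
  have "w \<in> {q1, q2} \<union> S1 - {t, u}" using w(1) by (auto simp: T_def)
  then have "d t u w < 0" using t unfolding hedge_def by blast
  then have "d u w t < 0" using rot[of t u w] by simp
  then have "hedge ({q1, q2} \<union> S1) u w" using w u unfolding hedge_def by (auto simp: T_def)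
  then show ?thesis by blast
qed

lemma hedge_target:
  assumes L: "layout q1 q2 q3 S1 S2 S3" and p: "hedge ({q1, q2} \<union> S1) u p" and u: "u \<in> S1"
  shows "p \<in> insert q2 S1" "d q1 u p < 0"
proof -
  note l = layoutD[OF L]
  have "p \<noteq> q1"
  proof
    assume "p = q1"
    then have "d u q1 q2 < 0" using p u l(8,16) unfolding hedge_def by auto
    then show False using l(12)[of u] u rot[of u q1 q2] by auto
  qed
  then show "p \<in> insert q2 S1" using p unfolding hedge_def by auto
  have "d u p q1 < 0" using p u l(7) \<open>p \<noteq> q1\<close> unfolding hedge_def by auto
  then show "d q1 u p < 0" using rot[of q1 u p] by simp
qed

text \<open>The hull of \<open>S1\<close> is followed clockwise and bends further to the right after
  \<open>p\<close>: if already \<open>p\<close> is to the right of \<open>vu\<close>, so is its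
  final vertex \<open>q2\<close>.\<close>

lemma turn_away:
  assumes L: "layout q1 q2 q3 S1 S2 S3" and p: "hedge ({q1, q2} \<union> S1) u p" and u: "u \<in> S1" and v: "v \<in> S3"
    and right: "d v u p < 0"
  shows "d v u q2 < 0"
proof (cases "p = q2")
  case False
  note l = layoutD[OF L]
  have 0: "d u p q2 < 0" using p False u l(8) unfolding hedge_def by auto
  have 1: "d u q1 p > 0" using hedge_target(2)[OF L p u] sw[of q1 u p] by simp
  have 2: "d u v p > 0" using right sw[of u v p] by simp
  have 3: "d u q1 v < 0" using l(13)[OF u v] sw[of q1 u v] by simp
  have 4: "d u q1 q2 > 0" using l(12)[of u] u rot[of u q1 q2] by auto
  have nz: "d v u q2 \<noteq> 0" using u v l(6,8) by (intro gpD[OF l(11)]) auto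
  show ?thesis
  proof (rule ccontr)
    assume "\<not> ?thesis"
    then have "d v u q2 > 0" using nz by linarith
    then have 5: "d u q2 v > 0" using rot[of u q2 v] rot[of q2 v u] by simp
    have "d u q1 p * d u q2 v > 0" "d u q1 q2 * d u p v < 0" "d u q1 v * d u p q2 > 0"
      using 0 1 2 3 4 5 sw2[of u v p] by (auto intro: mult_pos_pos mult_neg_neg mult_pos_neg)
    then show False using gr[of u q1 p q2 v] by linarith
  qed
qed (use right in simp)

text \<open>The points still ahead in the angular order at \<open>q1\<close>: beyond
  \<open>u\<close> towards \<open>q2\<close> and beyond \<open>v\<close> towards \<open>q3\<close>,
  both corners included. It drops with every move of the front.\<close>

definition todo :: "'a \<Rightarrow> 'a \<Rightarrow> 'a \<Rightarrow> 'a set \<Rightarrow> 'a set \<Rightarrow> 'a \<Rightarrow> 'a \<Rightarrow> nat" where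
  "todo q1 q2 q3 S1 S3 u v = card {x\<in>insert q2 S1. d q1 u x < 0} + card {z\<in>insert q3 S3. d q1 v z > 0}"

lemma todo_less:
  assumes L: "layout q1 q2 q3 S1 S2 S3" and p: "hedge ({q1, q2} \<union> S1) u p" and u: "u \<in> S1"
  shows "todo q1 q2 q3 S1 S3 p v < todo q1 q2 q3 S1 S3 u v"
proof -
  note l = layoutD[OF L]
  have h: "d q1 x q3 > 0" if "x \<in> insert q2 S1" for x
    using that l(10) l(12)[of x] rot[of q3 q1 x] by auto
  note pp = hedge_target[OF L p u]
  have "{x\<in>insert q2 S1. d q1 p x < 0} \<subset> {x\<in>insert q2 S1. d q1 u x < 0}"
  proof
    show "{x\<in>insert q2 S1. d q1 p x < 0} \<subseteq> {x\<in>insert q2 S1. d q1 u x < 0}"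
    proof
      fix x assume "x \<in> {x\<in>insert q2 S1. d q1 p x < 0}"
      then have x: "x \<in> insert q2 S1" "d q1 p x < 0" by auto
      have "d q1 x u > 0"
        using x pp u h sw2[of q1 x p] sw2[of q1 p u] by (intro trans_right[of q1 x q3 p u]) auto
      then show "x \<in> {x\<in>insert q2 S1. d q1 u x < 0}" using x sw2[of q1 u x] by simp
    qed
    have "p \<in> {x\<in>insert q2 S1. d q1 u x < 0}" "p \<notin> {x\<in>insert q2 S1. d q1 p x < 0}" using pp by simp_all
    then show "{x\<in>insert q2 S1. d q1 p x < 0} \<noteq> {x\<in>insert q2 S1. d q1 u x < 0}" by blast
  qed
  then have "card {x\<in>insert q2 S1. d q1 p x < 0} < card {x\<in>insert q2 S1. d q1 u x < 0}"
    using l(1) by (intro psubset_card_mono) auto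
  then show ?thesis by (simp add: todo_def)
qed

text \<open>The front sweeps over the triangle \<open>v u p\<close>. The last hypothesis ensures
  that a hull edge of \<open>S3\<close> at \<open>v\<close> has both \<open>u\<close> and
  \<open>p\<close> beyond it, so the triangle avoids that hull. If the triangle contains points of
  \<open>S2\<close>, the one nearest to \<open>uv\<close> completes a clean triangle. If it contains
  none, then either \<open>p\<close> is the corner \<open>q2\<close> and \<open>v\<close> is a hub
  there, or \<open>pv\<close> is the next front.\<close>

lemma front_step:
  assumes L: "layout q1 q2 q3 S1 S2 S3" and F: "front q1 q2 q3 S1 S2 S3 u v"
    and p: "hedge ({q1, q2} \<union> S1) u p" and p': "hedge' ({q1, q3} \<union> S3) v p'"
    and left: "d v u p > 0" and p'p: "d v u p' < 0 \<or> d v p p' > 0"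
  shows "centred q1 q2 q3 S1 S2 S3 \<or>
     (\<exists>u'. front q1 q2 q3 S1 S2 S3 u' v \<and> todo q1 q2 q3 S1 S3 u' v < todo q1 q2 q3 S1 S3 u v)"
proof -
  note l = layoutD[OF L]
  have u: "u \<in> S1" and v: "v \<in> S3" and vis': "vis' ({q1, q3} \<union> S3) v u"
    and free: "\<And>y y'. y \<in> {q2, q3} \<union> S2 \<Longrightarrow> y' \<in> {q2, q3} \<union> S2 \<Longrightarrow> \<not> crossing u v y y'"
    using F unfolding front_def by auto
  note pp = hedge_target[OF L p u]
  have up: "u \<noteq> p" using left by auto
  have pv: "d q1 p v > 0" using pp(1) v l(12)[of v] l(13)[of p v] by auto
  have uvp: "d u p v > 0" using left rot[of v u p] by simp
  \<comment> \<open>The edge after \<open>v\<close> serves if \<open>u\<close> is beyond it;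
    otherwise visibility of \<open>v\<close> from \<open>u\<close> is due to the edge before
    \<open>v\<close>.\<close>
  have "\<exists>w e. hedge' ({q1, q3} \<union> S3) w e \<and> (v = w \<or> v = e) \<and> d w e u < 0 \<and> d w e p < 0"
  proof (cases "d v u p' < 0")
    case False
    have "d v u p' \<noteq> 0"
    proof (rule gpD[OF l(11)])
      show "p' \<in> {q1, q2, q3} \<union> S1 \<union> S2 \<union> S3" using p' unfolding hedge'_def by auto
      show "u \<noteq> p'" using p' u l(6,7,9) unfolding hedge'_def by auto
      show "v \<noteq> p'" using p' unfolding hedge'_def by auto
    qed (use u v l(6) in auto)
    then have "d v p' u < 0" using False sw2[of v u p'] by simp
    moreover have "d v p' p < 0" using p'p False sw2[of v p p'] by auto
    ultimately show ?thesis using p' by blast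
  next
    case True
    then have "d v p' u > 0" using sw2[of v u p'] by simp
    then obtain t where t: "hedge' ({q1, q3} \<union> S3) t v" "d t v u < 0"
      
      using vis' hedge_unique[OF p'] unfolding vis'_def by (metis less_asym)
    have vqp: "d v q1 p > 0" "d v q1 u > 0" using pv l(13)[OF u v] rot by metis+
    have "d t v p < 0"
    proof (cases "t = q1")
      case True
      then show ?thesis using vqp sw[of q1 v p] by simp
    next
      case False
      have "t \<noteq> p" 
      proof
        assume "t = p"
        then have "p = q3 \<or> p \<in> S3" using t(1) False unfolding hedge'_def by auto
        then show False using pp(1) l(6,8,9,17) by auto
      qed
      have nz: "d t v p \<noteq> 0"
      proof (rule gpD[OF l(11)])
        show "t \<in> {q1, q2, q3} \<union> S1 \<union> S2 \<union> S3" using t(1) unfolding hedge'_def by auto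
        show "p \<in> {q1, q2, q3} \<union> S1 \<union> S2 \<union> S3" using pp(1) by auto
        show "t \<noteq> v" using t(1) unfolding hedge'_def by auto
      qed (use v left \<open>t \<noteq> p\<close> in auto)
      show ?thesis
      proof (rule ccontr)
        assume "\<not> ?thesis"
        then have 1: "d v p t > 0" using nz rot[of t v p] by simp
        have 2: "d v u t < 0" using t(2) rot[of t v u] by simp
        have "d t v q1 > 0" using t(1) False v l(7) unfolding hedge'_def by auto
        then have 3: "d v q1 t > 0" using rot[of t v q1] by simp
        have "d v q1 u * d v p t > 0" "d v q1 p * d v u t < 0" "d v q1 t * d v u p > 0"
          using 1 2 3 vqp left by (auto intro: mult_pos_pos mult_pos_neg)
        then show False using gr[of v q1 u p t] by linarith
      qed
    qed
    then show ?thesis using t by blast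
  qed
  then obtain w e where we: "hedge' ({q1, q3} \<union> S3) w e" "v = w \<or> v = e" "d w e u < 0" "d w e p < 0" by blast
  have wev: "d w e v = 0" using we(2) by auto
  have weS: "d w e z \<ge> 0" if "z \<in> S3" for z
    using we(1) that unfolding hedge'_def by (cases "z = w \<or> z = e") (auto simp: less_imp_le)
  let ?I = "{y\<in>S2. d v u y > 0 \<and> d u p y > 0 \<and> d p v y > 0}"
  show ?thesis
  proof (cases "?I = {}")
    case False
    have "Min (d v u ` ?I) \<in> d v u ` ?I" using False l(2) by (intro Min_in) auto
    then obtain y where y: "y \<in> ?I" "Min (d v u ` ?I) = d v u y" by auto
    have low: "d v u y \<le> d v u y2" if "y2 \<in> ?I" for y2
    proof -
      have "Min (d v u ` ?I) \<le> d v u y2" using that l(2) by (intro Min_le finite_imageI imageI) auto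
      then show ?thesis unfolding y(2) .
    qed
    have yS: "y \<in> S2" and yp: "d v u y > 0" "d u p y > 0" "d p v y > 0" using y(1) by auto
    have "clean S1 S2 S3 u y v"
      unfolding clean_def
    proof (intro conjI ballI notI)
      show "d u y v > 0" using yp(1) rot[of v u y] by simp
    next
      fix x assume x: "x \<in> S1" "d u y x > 0 \<and> d v u x > 0"
      have "d u p x > 0"
        using trans_right[of u p v y x] uvp yp x(2) rot[of v u y] rot[of v u x] by simp
      moreover have "x = p \<or> d u p x < 0" using p x unfolding hedge_def by auto
      ultimately show False by auto
    next
      \<comment> \<open>A point of \<open>S2\<close> in the angle at \<open>y\<close> is either in
        the triangle \<open>u y v\<close>, hence nearer to \<open>uv\<close> than \<open>y\<close>,
        or behind the front, and then the segment \<open>yx\<close> crosses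
        \<open>uv\<close>.\<close>
      fix x assume x: "x \<in> S2" "d y v x > 0 \<and> d u y x > 0"
      have "x \<noteq> u" "x \<noteq> v" using x(1) u v l(4,5) by auto
      then have "d v u x \<noteq> 0" using u v x(1) l(6) by (intro gpD[OF l(11)]) auto
      then consider "d v u x > 0" | "d v u x < 0" by linarith
      then show False
      proof cases
        case 1
        have "d v u y * d u p x = d u y x * d u p v + d y v x * d u p u + d v u x * d u p y"
          using lin[of v u y u p x] by simp
        moreover have "d u y x * d u p v > 0" "d v u x * d u p y > 0" using x 1 yp uvp by simp_all
        ultimately have "d v u y * d u p x > 0" by simp
        then have 2: "d u p x > 0" using yp(1) by (metis zero_less_mult_pos)
        have "d v u y * d p v x = d u y x * d p v v + d y v x * d p v u + d v u x * d p v y"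
          using lin[of v u y p v x] by simp
        moreover have "d y v x * d p v u > 0" "d v u x * d p v y > 0" using x 1 yp left rot[of p v u] by simp_all
        ultimately have "d v u y * d p v x > 0" by simp
        then have 3: "d p v x > 0" using yp(1) by (metis zero_less_mult_pos)
        have "x \<in> ?I" using x(1) 1 2 3 by simp
        then have "d v u y \<le> d v u x" by (rule low)
        moreover have "d v u x + d u y x + d y v x = d v u y" by (rule four)
        ultimately show False using x(2) by linarith
      next
        case 2
        have "d u v y < 0" "d u v x > 0" using yp(1) 2 sw[of u v] by auto
        moreover have "d y x u > 0" "d y x v < 0" using x(2) rot[of u y x] sw2[of y v x] by auto
        ultimately have "crossing u v y x" unfolding crossing_def by (simp add: mult_neg_pos mult_pos_neg)
        then show False using free yS x(1) by blast
      qed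
    next
      fix z assume z: "z \<in> S3" "d v u z > 0 \<and> d y v z > 0"
      have "d v u p * d w e y = d u p y * d w e v + d p v y * d w e u + d v u y * d w e p"
        using lin[of v u p w e y] by simp
      moreover have "d p v y * d w e u < 0" "d v u y * d w e p < 0" using yp we by (simp_all add: mult_pos_neg)
      ultimately have "d v u p * d w e y < 0" using wev by simp
      then have wy: "d w e y < 0" using left by (simp add: mult_less_0_iff)
      have "d v u y * d w e z = d u y z * d w e v + d y v z * d w e u + d v u z * d w e y"
        using lin[of v u y w e z] by simp
      moreover have "d y v z * d w e u < 0" "d v u z * d w e y < 0" using z we wy by (simp_all add: mult_pos_neg)
      ultimately have "d v u y * d w e z < 0" using wev by simp
      then show False using yp(1) weS[OF z(1)] by (simp add: mult_less_0_iff)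
    qed
    then show ?thesis using u v yS unfolding centred_def by blast
  next
    case empty: True
    show ?thesis
    proof (cases "p = q2")
      case True
      have q2x: "d q2 q3 x > 0" if "x \<in> S1 \<union> S2 \<union> S3" for x using l(12)[OF that] by simp
      have vu: "d q2 v u > 0" using left True rot[of q2 v u] by simp
      have "hub q2 S2 S1 v"
        unfolding hub_def
      proof (intro conjI ballI)
        fix y assume y: "y \<in> S2"
        have "d q2 y v \<noteq> 0" using y v l(5,8) by (intro gpD[OF l(11)]) auto
        \<comment> \<open>If \<open>y\<close> came after \<open>v\<close> around \<open>q2\<close>,
          it would be behind the front, since it is not in the swept triangle, and the segment
          \<open>q2 y\<close> would cross \<open>uv\<close>.\<close>
        moreover have False if neg: "d q2 y v < 0"
        proof -
          have vy: "d q2 v y > 0" using neg sw2[of q2 v y] by simp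
          have yu: "d q2 y u > 0" using l(14)[OF y u] .
          have "\<not> (d v u y > 0 \<and> d u q2 y > 0 \<and> d q2 v y > 0)" using empty y True by auto
          moreover have "d u q2 y > 0" using yu rot[of u q2 y] by simp
          moreover have "d v u y \<noteq> 0" using y v u l(4,5,6) by (intro gpD[OF l(11)]) auto
          ultimately have "d v u y < 0" using vy by linarith
          then have "d u v y > 0" "d u v q2 < 0" using sw[of u v y] left True sw[of u v q2] by auto
          moreover have "d q2 y u * d q2 y v < 0" using yu neg by (simp add: mult_pos_neg)
          ultimately have "crossing u v q2 y" unfolding crossing_def by (simp add: mult_neg_pos)
          then show False using free y by blast
        qed
        ultimately show "d q2 y v > 0" by (meson linorder_neqE_linordered_idom)
      next
        fix x assume x: "x \<in> S1"
        show "d q2 v x > 0"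
        proof (cases "x = u")
          case False
          then have "d u q2 x < 0" using p True x l(8) unfolding hedge_def by auto
          then have "d q2 u x > 0" using sw[of u q2 x] by simp
          then show ?thesis using trans_left[of q2 q3 v u x] vu q2x u v x by auto
        qed (use vu in simp)
      qed
      then show ?thesis using v unfolding centred_def by blast
    next
      case False
      then have pS: "p \<in> S1" using pp(1) by simp
      \<comment> \<open>A segment of the third class that crosses \<open>pv\<close> also crosses
        \<open>uv\<close> or \<open>up\<close>. The old front excludes the former, the separation at
        \<open>q2\<close> the latter.\<close>
      have K2: "\<not> crossing p v y y'" if y: "y \<in> {q2, q3} \<union> S2" "y' \<in> {q2, q3} \<union> S2" for y y'
      proof
        assume c: "crossing p v y y'"
        have hull: "d q1 q2 x > 0 \<and> d q2 q3 x > 0 \<and> d q3 q1 x > 0" if "x \<in> {u, v, p}" for x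
          using l(12)[of x] that u v pS by auto
        have out: "\<not> (d v u y > 0 \<and> d u p y > 0 \<and> d p v y > 0)" if y: "y \<in> {q2, q3} \<union> S2" for y
        proof
          assume i: "d v u y > 0 \<and> d u p y > 0 \<and> d p v y > 0"
          have "d q2 q3 y > 0"
          proof -
            have "d v u p * d q2 q3 y = d u p y * d q2 q3 v + d p v y * d q2 q3 u + d v u y * d q2 q3 p"
              using lin[of v u p q2 q3 y] by simp
            moreover have "d u p y * d q2 q3 v > 0" "d p v y * d q2 q3 u > 0" "d v u y * d q2 q3 p > 0"
              using i hull by simp_all
            ultimately have "d v u p * d q2 q3 y > 0" by linarith
            then show ?thesis using left by (metis zero_less_mult_pos)
          qed
          then have "y \<in> S2" using y by auto
          then show False using i empty by auto
        qed
        have "crossing u v y y' \<or> crossing u p y y'"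
        proof (rule crossing_triangle[OF left c out[OF y(1)] out[OF y(2)]])
          show "gp {v, u, p, y, y'}" using u v pS y by (intro gp_subset[OF l(11)]) auto
          show "u \<noteq> y" "u \<noteq> y'" using u y l(4,8,9) by auto
        qed
        moreover have "\<not> crossing u p y y'"
        proof
          assume "crossing u p y y'"
          then have "crossing y y' u p" unfolding crossing_def by simp
          moreover have "\<not> crossing y y' u p"
          proof (rule no_crossing[where q = q2 and A = "insert q3 S2" and B = S1])
            show "d q2 x y > 0" if "x \<in> insert q3 S2" "y \<in> S1" for x y
              using that l(14)[of x y] l(12)[of y] by auto
          qed (use y u pS in auto)
          ultimately show False by simp
        qed
        ultimately show False using free y by blast
      qed
      have "vis ({q1, q2} \<union> S1) p v" unfolding vis_def using p uvp by blast
      moreover have "vis' ({q1, q3} \<union> S3) v p" unfolding vis'_def using we by blast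
      ultimately have "front q1 q2 q3 S1 S2 S3 p v"
        using F p pS K2 unfolding front_def by blast
      then show ?thesis using todo_less[OF L p u, of v] by blast
    qed
  qed
qed

section \<open>Mirror images of layouts and fronts\<close>

lemma neg_gp: "chiro.gp (\<lambda>a b c. - d a b c) V \<longleftrightarrow> gp V"
  unfolding chiro.gp_def[OF neg_chiro] gp_def by auto

lemma neg_layout:
  assumes "layout q1 q2 q3 S1 S2 S3"
  shows "chiro.layout (\<lambda>a b c. - d a b c) q1 q3 q2 S3 S2 S1"
proof -
  note l = layoutD[OF assms]
  have sgn: "- d q1 q3 x > 0 \<and> - d q3 q2 x > 0 \<and> - d q2 q1 x > 0" if "x \<in> S1 \<union> S2 \<union> S3" for x
    using l(12)[OF that] sw[of q1 q3 x] sw[of q3 q2 x] sw[of q2 q1 x] by simp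
  have "- d q1 z x > 0" if "x \<in> S1" "z \<in> S3" for x z using l(13)[OF that] sw2[of q1 z x] by simp
  moreover have "- d q2 x y > 0" if "x \<in> S1" "y \<in> S2" for x y using l(14)[OF that(2,1)] sw2[of q2 x y] by simp
  moreover have "- d q3 y z > 0" if "y \<in> S2" "z \<in> S3" for y z using l(15)[OF that(2,1)] sw2[of q3 y z] by simp
  moreover have "- d q1 q3 q2 > 0" using l(10) sw2[of q1 q3 q2] by simp
  moreover have "gp ({q1, q3, q2} \<union> S3 \<union> S2 \<union> S1)" by (rule gp_subset[OF l(11)]) auto
  ultimately show ?thesis
    unfolding chiro.layout_def[OF neg_chiro] neg_gp using l(1-9) sgn by blast
qed

lemma neg_hedge: "chiro.hedge (\<lambda>a b c. - d a b c) = hedge'" "chiro.hedge' (\<lambda>a b c. - d a b c) = hedge"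
  by (intro ext; simp add: chiro.hedge_def[OF neg_chiro] chiro.hedge'_def[OF neg_chiro] hedge_def hedge'_def)+

lemma neg_vis: "chiro.vis (\<lambda>a b c. - d a b c) = vis'" "chiro.vis' (\<lambda>a b c. - d a b c) = vis"
  by (intro ext; simp add: chiro.vis_def[OF neg_chiro] chiro.vis'_def[OF neg_chiro] vis_def vis'_def neg_hedge)+

lemma crossing_swap: "crossing v u y y' = crossing u v y y'"
  unfolding crossing_def using sw[of v u y] sw[of v u y'] by (simp add: mult.commute)

lemma neg_crossing: "chiro.crossing (\<lambda>a b c. - d a b c) u v y y' = crossing v u y y'"
  by (subst crossing_swap) (simp add: chiro.crossing_def[OF neg_chiro] crossing_def)

lemma neg_front:
  "chiro.front (\<lambda>a b c. - d a b c) q1 q3 q2 S3 S2 S1 v u \<longleftrightarrow> front q1 q2 q3 S1 S2 S3 u v"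
  unfolding chiro.front_def[OF neg_chiro] front_def neg_hedge neg_vis neg_crossing
  by (simp add: insert_commute) blast

lemma neg_hub: "chiro.hub (\<lambda>a b c. - d a b c) q S T a \<longleftrightarrow> hub q T S a"
proof -
  have "(- d q z a > 0) = (d q a z > 0)" "(- d q a z > 0) = (d q z a > 0)" for z
    using sw2[of q a z] by auto
  then show ?thesis unfolding chiro.hub_def[OF neg_chiro] hub_def by auto
qed

lemma neg_clean: "chiro.clean (\<lambda>a b c. - d a b c) S3 S2 S1 c b a \<longleftrightarrow> clean S1 S2 S3 a b c"
proof -
  have "(- d u v w > 0) = (d v u w > 0)" for u v w using sw[of u v w] by auto
  then show ?thesis
    unfolding chiro.clean_def[OF neg_chiro] clean_def using rot[of a b c] rot[of b c a] by auto
qed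

lemma neg_centred:
  "chiro.centred (\<lambda>a b c. - d a b c) q1 q3 q2 S3 S2 S1 \<longleftrightarrow> centred q1 q2 q3 S1 S2 S3"
  unfolding chiro.centred_def[OF neg_chiro] centred_def neg_hub neg_clean by blast

lemma neg_todo:
  "chiro.todo (\<lambda>a b c. - d a b c) q1 q3 q2 S3 S1 v u = todo q1 q2 q3 S1 S3 u v"
  unfolding chiro.todo_def[OF neg_chiro] todo_def by simp

text \<open>One of the next hull vertices \<open>p\<close> and \<open>p'\<close> is to the left of
  \<open>vu\<close>: otherwise all three corners would be to its right, although \<open>u\<close> is
  inside their triangle. If both are, then the triangle \<open>v u p\<close> or its mirror image
  \<open>u v p'\<close> can be swept, since otherwise \<open>up\<close> and \<open>vp'\<close> would
  cross against the separation at \<open>q1\<close>.\<close>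

lemma centred_of_front:
  assumes L: "layout q1 q2 q3 S1 S2 S3" and F: "front q1 q2 q3 S1 S2 S3 u v"
  shows "centred q1 q2 q3 S1 S2 S3"
  using F
proof (induction "todo q1 q2 q3 S1 S3 u v" arbitrary: u v rule: less_induct)
  case less
  interpret neg: chiro "\<lambda>a b c. - d a b c" by (rule neg_chiro)
  note F = less.prems and l = layoutD[OF L] and L' = neg_layout[OF L]
  have u: "u \<in> S1" and v: "v \<in> S3" using F unfolding front_def by auto
  obtain t t' where t: "hedge ({q1, q2} \<union> S1) t u" "hedge' ({q1, q3} \<union> S3) t' v"
    using F unfolding front_def by blast
  obtain p where p: "hedge ({q1, q2} \<union> S1) u p" using hedge_step[OF L t(1) u] by blast
  obtain p' where p': "hedge' ({q1, q3} \<union> S3) v p'"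
    using neg.hedge_step[OF L' _ v] t(2) unfolding neg_hedge by blast
  note pp = hedge_target(1)[OF L p u]
  have pp': "p' \<in> insert q3 S3" using neg.hedge_target(1)[OF L' _ v] p' unfolding neg_hedge by blast
  have pne: "p \<noteq> p'" using pp pp' l(6,8,9,17) by auto
  have "d v u p > 0 \<or> d v u p' > 0"
  proof (rule ccontr)
    assume no: "\<not> ?thesis"
    have "u \<noteq> p" "v \<noteq> p'" using p p' unfolding hedge_def hedge'_def by auto
    moreover have "v \<noteq> p" "u \<noteq> p'" "u \<noteq> v" using pp pp' u v l(6,8,9) by auto
    ultimately have "d v u p \<noteq> 0" "d v u p' \<noteq> 0" using pp pp' u v by (intro gpD[OF l(11)]; auto)+
    then have r: "d v u p < 0" "d v u p' < 0" using no by auto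
    have "d v u q2 < 0" by (rule turn_away[OF L p u v r(1)])
    moreover have "- d u v q3 < 0"
      using neg.turn_away[OF L' _ v u] p' r(2) sw[of u v p'] unfolding neg_hedge by simp
    then have "d v u q3 < 0" using sw[of u v q3] by simp
    moreover have "d v u q1 < 0" using l(13)[OF u v] rot[of q1 u v] sw[of u v q1] by simp
    moreover have "d q1 q2 u > 0" "d q2 q3 u > 0" "d q3 q1 u > 0" using l(12)[of u] u by auto
    ultimately have "d q2 q3 u * d v u q1 < 0" "d q3 q1 u * d v u q2 < 0" "d q1 q2 u * d v u q3 < 0"
      by (simp_all add: mult_pos_neg)
    then show False using lin[of q1 q2 q3 v u u] by simp
  qed
  moreover have "d v u p' > 0 \<Longrightarrow> d v u p > 0 \<Longrightarrow> \<not> d v p p' > 0 \<Longrightarrow> - d u p' p > 0"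
  proof (rule ccontr)
    assume a: "d v u p' > 0" "d v u p > 0" "\<not> d v p p' > 0" "\<not> - d u p' p > 0"
    have "v \<noteq> p" "u \<noteq> p'" "u \<noteq> p" "v \<noteq> p'" using pp pp' u v l(6,8,9) a by auto
    then have nz: "d v p p' \<noteq> 0" "d u p' p \<noteq> 0" using pp pp' u v pne by (intro gpD[OF l(11)]; auto)+
    have 1: "d u p v > 0" "d u p p' < 0" "d v p' p > 0" "d v p' u < 0"
      using a nz rot[of v u p] sw2[of u p p'] sw2[of v p' p] sw2[of v p' u] by auto
    then have "crossing u p v p'" unfolding crossing_def by (simp add: mult_pos_neg mult_neg_pos)
    moreover have "\<not> crossing u p v p'"
    proof (rule no_crossing[where q = q1 and A = "insert q2 S1" and B = "insert q3 S3"])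
      show "d q1 x y > 0" if "x \<in> insert q2 S1" "y \<in> insert q3 S3" for x y
        using that l(10) l(12)[of x] l(12)[of y] l(13)[of x y] rot[of q3 q1 x] by auto
    qed (use u v pp pp' in auto)
    ultimately show False by simp
  qed
  ultimately consider "d v u p > 0" "d v u p' < 0 \<or> d v p p' > 0"
    | "d v u p' > 0" "d v u p < 0 \<or> - d u p' p > 0" | "d v u p = 0 \<or> d v u p' = 0"
    by linarith
  then show ?case
  proof cases
    case 1
    then show ?thesis using front_step[OF L F p p'] less.hyps by blast
  next
    case 2
    have "neg.centred q1 q3 q2 S3 S2 S1 \<or>
      (\<exists>v'. neg.front q1 q3 q2 S3 S2 S1 v' u \<and> neg.todo q1 q3 q2 S3 S1 v' u < neg.todo q1 q3 q2 S3 S1 v u)"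
    proof (rule neg.front_step[OF L'])
      show "neg.front q1 q3 q2 S3 S2 S1 v u" using F unfolding neg_front .
      show "neg.hedge ({q1, q3} \<union> S3) v p'" "neg.hedge' ({q1, q2} \<union> S1) u p" unfolding neg_hedge by (rule p' p)+
      show "0 < - d u v p'" using 2(1) sw[of u v p'] by simp
      show "- d u v p < 0 \<or> 0 < - d u p' p" using 2(2) sw[of u v p] by auto
    qed
    then show ?thesis using less.hyps unfolding neg_centred neg_front neg_todo by blast
  next
    case 3
    have "u \<noteq> p" "v \<noteq> p'" using p p' unfolding hedge_def hedge'_def by auto
    moreover have "v \<noteq> p" "u \<noteq> p'" "u \<noteq> v" using pp pp' u v l(6,8,9) by auto
    ultimately have "d v u p \<noteq> 0" "d v u p' \<noteq> 0" using pp pp' u v by (intro gpD[OF l(11)]; auto)+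
    then show ?thesis using 3 by blast
  qed
qed

lemma first_hedge:
  assumes L: "layout q1 q2 q3 S1 S2 S3" and ne: "S1 \<noteq> {}"
  shows "\<exists>x\<in>S1. hedge ({q1, q2} \<union> S1) q1 x"
proof -
  note l = layoutD[OF L]
  have "\<exists>w\<in>insert q2 S1. \<forall>p\<in>insert q2 S1 - {w}. d q1 w p < 0"
  proof (rule first_hit)
    show "d q1 q3 p < 0" if "p \<in> insert q2 S1" for p
      using that l(10) l(12)[of p] sw[of q1 q3 p] sw2[of q1 q3 p] by auto
    show "gp (insert q1 (insert q2 S1))" by (rule gp_subset[OF l(11)]) auto
  qed (use l(1,7,16) in auto)
  then obtain w where w: "w \<in> insert q2 S1" "\<forall>p\<in>insert q2 S1 - {w}. d q1 w p < 0" by blast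
  obtain x where x: "x \<in> S1" using ne by blast
  have "w \<noteq> q2"
  proof
    assume "w = q2"
    then have "d q1 q2 x < 0" using w(2) x l(8) by auto
    then show False using l(12)[of x] x by auto
  qed
  then have "w \<in> S1" "hedge ({q1, q2} \<union> S1) q1 w" using w l(7) unfolding hedge_def by auto
  then show ?thesis by blast
qed

text \<open>The sweep starts at \<open>q1\<close>, with its hull neighbours \<open>x\<close> and
  \<open>z\<close> in \<open>S1\<close> and \<open>S3\<close>. A point of \<open>S2\<close> between
  them around \<open>q1\<close> is a hub for \<open>q1\<close>; without such a point the segment
  \<open>xz\<close> is a front.\<close>

theorem centred:
  assumes L: "layout q1 q2 q3 S1 S2 S3" and ne: "S1 \<noteq> {}" "S3 \<noteq> {}"
  shows "centred q1 q2 q3 S1 S2 S3"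
proof -
  interpret neg: chiro "\<lambda>a b c. - d a b c" by (rule neg_chiro)
  note l = layoutD[OF L] and L' = neg_layout[OF L]
  obtain x where x: "x \<in> S1" "hedge ({q1, q2} \<union> S1) q1 x" using first_hedge[OF L ne(1)] by blast
  obtain z where z: "z \<in> S3" "hedge' ({q1, q3} \<union> S3) q1 z" using neg.first_hedge[OF L' ne(2)] unfolding neg_hedge by blast
  have xz: "d q1 x z > 0" using l(13)[OF x(1) z(1)] .
  have xw: "w = x \<or> d q1 w x > 0" if "w \<in> S1" for w
    using x(2) that l(7) sw2[of q1 w x] unfolding hedge_def by auto
  have zw: "w = z \<or> d q1 z w > 0" if "w \<in> S3" for w
    using z(2) that l(7) unfolding hedge'_def by auto
  show ?thesis
  proof (cases "\<exists>y\<in>S2. d q1 x y > 0 \<and> d q1 y z > 0")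
    case True
    then obtain y where y: "y \<in> S2" "d q1 x y > 0" "d q1 y z > 0" by blast
    have h: "d q1 q2 w > 0" if "w \<in> S1 \<union> S2 \<union> S3" for w using l(12)[OF that] by simp
    have "d q1 w y > 0" if w: "w \<in> S1" for w
      using xw[OF w] y(2) trans_left[of q1 q2 w x y] h w x(1) y(1) by auto
    moreover have "d q1 y w > 0" if w: "w \<in> S3" for w
      using zw[OF w] y(3) trans_left[of q1 q2 y z w] h w z(1) y(1) by auto
    ultimately have "hub q1 S1 S3 y" unfolding hub_def by blast
    then show ?thesis using y(1) unfolding centred_def by blast
  next
    case False
    have K2: "\<not> crossing x z y y'" if y: "y \<in> {q2, q3} \<union> S2" "y' \<in> {q2, q3} \<union> S2" for y y'
    proof
      assume c: "crossing x z y y'"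
      have out: "\<not> (d z q1 y > 0 \<and> d q1 x y > 0 \<and> d x z y > 0)" if y: "y \<in> {q2, q3} \<union> S2" for y
      proof
        assume i: "d z q1 y > 0 \<and> d q1 x y > 0 \<and> d x z y > 0"
        then have "d q1 y z > 0" using rot[of z q1 y] by simp
        then have "y \<notin> S2" using i False by blast
        then consider "y = q2" | "y = q3" using y by blast
        then show False
          using i x(1) z(1) l(12)[of x] l(12)[of z] sw2[of q1 x q2] sw[of q3 q1 z] rot[of z q1 q3] rot[of q1 q3 z] by cases auto
      qed
      have "crossing q1 z y y' \<or> crossing q1 x y y'"
      proof (rule crossing_triangle[OF _ c out[OF y(1)] out[OF y(2)]])
        show "d z q1 x > 0" using xz rot[of z q1 x] by simp
        show "gp {z, q1, x, y, y'}" using x(1) z(1) y by (intro gp_subset[OF l(11)]) auto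
        show "q1 \<noteq> y" "q1 \<noteq> y'" using y l(7,16,18) by auto
      qed
      moreover have "\<not> crossing y y' q1 x"
      proof (rule no_crossing[where q = q2 and A = "insert q3 S2" and B = "insert q1 S1"])
        show "d q2 u w > 0" if "u \<in> insert q3 S2" "w \<in> insert q1 S1" for u w
          using that l(14)[of u w] l(12)[of w] l(12)[of u] l(10) rot[of q1 q2 u] rot[of q1 q2 q3] by auto
      qed (use y x(1) in auto)
      moreover have "\<not> crossing q1 z y y'"
      proof (rule no_crossing[where q = q3 and A = "insert q1 S3" and B = "insert q2 S2"])
        show "d q3 u w > 0" if "u \<in> insert q1 S3" "w \<in> insert q2 S2" for u w
          using that l(15)[of u w] l(12)[of w] l(12)[of u] l(10) rot[of q2 q3 u] rot[of q3 q1 q2] by auto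
      qed (use y z(1) in auto)
      ultimately show False unfolding crossing_def by blast
    qed
    have "vis ({q1, q2} \<union> S1) x z" unfolding vis_def using x xz by blast
    moreover have "vis' ({q1, q3} \<union> S3) z x" unfolding vis'_def using z xz sw2[of q1 z x] by auto
    ultimately have "front q1 q2 q3 S1 S2 S3 x z"
      unfolding front_def using x z K2 by blast
    then show ?thesis by (rule centred_of_front[OF L])
  qed
qed

theorem layout_filled: "layout q1 q2 q3 S1 S2 S3 \<Longrightarrow> S1 \<noteq> {} \<Longrightarrow> S3 \<noteq> {} \<Longrightarrow> filled q1 q2 q3 S1 S2 S3"
  by (intro filled_of_centred centred)

end

section \<open>An optimal distribution of the points among the sides\<close>

lemma sum_swap:
  assumes "finite S" "x \<in> S" "z \<notin> S"
  shows "sum f (insert z (S - {x})) = sum f S - f x + (f z :: real)" "card (insert z (S - {x})) = card S"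
proof -
  show "sum f (insert z (S - {x})) = sum f S - f x + f z"
    using assms by (simp add: sum_diff1)
  show "card (insert z (S - {x})) = card S"
    using assms card_Suc_Diff1[of S x] by simp
qed

text \<open>A cheapest one of the finitely many partitions with these sizes cannot be improved by
  exchanging two points of different classes.\<close>

lemma optimal_partition:
  fixes f1 f2 f3 :: "'a \<Rightarrow> real"
  assumes R: "finite R" "card R = c1 + c2 + c3"
  shows "\<exists>S1 S2 S3. S1 \<union> S2 \<union> S3 = R \<and> S1 \<inter> S2 = {} \<and> S2 \<inter> S3 = {} \<and> S3 \<inter> S1 = {} \<and>
     card S1 = c1 \<and> card S2 = c2 \<and> card S3 = c3 \<and>
     (\<forall>x\<in>S1. \<forall>y\<in>S2. f1 x + f2 y \<le> f1 y + f2 x) \<and>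
     (\<forall>y\<in>S2. \<forall>z\<in>S3. f2 y + f3 z \<le> f2 z + f3 y) \<and>
     (\<forall>z\<in>S3. \<forall>x\<in>S1. f3 z + f1 x \<le> f3 x + f1 z)"
proof -
  define good where "good = {(S1, S2, S3). S1 \<union> S2 \<union> S3 = R \<and> S1 \<inter> S2 = {} \<and> S2 \<inter> S3 = {} \<and> S3 \<inter> S1 = {} \<and>
     card S1 = c1 \<and> card S2 = c2 \<and> card S3 = c3}"
  define cost where "cost = (\<lambda>(S1, S2, S3). sum f1 S1 + sum f2 S2 + sum f3 S3)"
  have fin: "finite good"
    by (rule finite_subset[of _ "Pow R \<times> Pow R \<times> Pow R"]) (use R in \<open>auto simp: good_def\<close>)
  obtain S1 where S1: "S1 \<subseteq> R" "card S1 = c1"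
    using obtain_subset_with_card_n[of c1 R] R by auto
  have "card (R - S1) = c2 + c3" using R S1 by (simp add: card_Diff_subset finite_subset)
  then obtain S2 where S2: "S2 \<subseteq> R - S1" "card S2 = c2"
    using obtain_subset_with_card_n[of c2 "R - S1"] by auto
  have "card (R - S1 - S2) = c3"
    using R S2 \<open>card (R - S1) = c2 + c3\<close> by (simp add: card_Diff_subset finite_subset)
  then have "(S1, S2, R - S1 - S2) \<in> good" using S1 S2 by (auto simp: good_def)
  then have ne: "good \<noteq> {}" by auto
  have "Min (cost ` good) \<in> cost ` good" using fin ne by (intro Min_in) auto
  then obtain T1 T2 T3 where T: "(T1, T2, T3) \<in> good" "Min (cost ` good) = cost (T1, T2, T3)" by auto
  have low: "cost (T1, T2, T3) \<le> cost t" if "t \<in> good" for t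
    using Min_le[of "cost ` good" "cost t"] fin that T(2) by auto
  have t: "T1 \<union> T2 \<union> T3 = R" "T1 \<inter> T2 = {}" "T2 \<inter> T3 = {}" "T3 \<inter> T1 = {}"
     "card T1 = c1" "card T2 = c2" "card T3 = c3" using T(1) by (auto simp: good_def)
  have f: "finite T1" "finite T2" "finite T3" using t(1) R(1) by auto
  have m1: "f1 x + f2 y \<le> f1 y + f2 x" if xy: "x \<in> T1" "y \<in> T2" for x y
  proof -
    have n: "y \<notin> T1" "x \<notin> T2" using xy t by auto
    have "(insert y (T1 - {x}), insert x (T2 - {y}), T3) \<in> good"
      using xy t n sum_swap(2)[OF f(1) xy(1) n(1)] sum_swap(2)[OF f(2) xy(2) n(2)] by (auto simp: good_def)
    from low[OF this] show ?thesis
      unfolding cost_def prod.case sum_swap(1)[OF f(1) xy(1) n(1)] sum_swap(1)[OF f(2) xy(2) n(2)] by linarith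
  qed
  have m2: "f2 y + f3 z \<le> f2 z + f3 y" if yz: "y \<in> T2" "z \<in> T3" for y z
  proof -
    have n: "z \<notin> T2" "y \<notin> T3" using yz t by auto
    have "(T1, insert z (T2 - {y}), insert y (T3 - {z})) \<in> good"
      using yz t n sum_swap(2)[OF f(2) yz(1) n(1)] sum_swap(2)[OF f(3) yz(2) n(2)] by (auto simp: good_def)
    from low[OF this] show ?thesis
      unfolding cost_def prod.case sum_swap(1)[OF f(2) yz(1) n(1)] sum_swap(1)[OF f(3) yz(2) n(2)] by linarith
  qed
  have m3: "f3 z + f1 x \<le> f3 x + f1 z" if zx: "z \<in> T3" "x \<in> T1" for z x
  proof -
    have n: "x \<notin> T3" "z \<notin> T1" using zx t by auto
    have "(insert z (T1 - {x}), T2, insert x (T3 - {z})) \<in> good"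
      using zx t n sum_swap(2)[OF f(3) zx(1) n(1)] sum_swap(2)[OF f(1) zx(2) n(2)] by (auto simp: good_def)
    from low[OF this] show ?thesis
      unfolding cost_def prod.case sum_swap(1)[OF f(3) zx(1) n(1)] sum_swap(1)[OF f(1) zx(2) n(2)] by linarith
  qed
  show ?thesis by (intro exI[of _ T1] exI[of _ T2] exI[of _ T3] conjI ballI t m1 m2 m3)
qed

lemma subseq2_nth: "subseq [x, y] L \<Longrightarrow> \<exists>i j. i < j \<and> j < length L \<and> x = L ! i \<and> y = L ! j"
proof (induction L)
  case (Cons a L)
  show ?case
  proof (cases "subseq [x, y] L")
    case True
    then obtain i j where "i < j" "j < length L" "x = L ! i" "y = L ! j" using Cons.IH by blast
    then show ?thesis by (intro exI[of _ "Suc i"] exI[of _ "Suc j"]) auto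
  next
    case False
    then have "x = a" "y \<in> set L" using Cons.prems by (auto simp: subseq_singleton_left split: if_splits)
    then obtain j where "j < length L" "y = L ! j" by (metis in_set_conv_nth)
    then show ?thesis using \<open>x = a\<close> by (intro exI[of _ 0] exI[of _ "Suc j"]) auto
  qed
qed simp

lemma subseq3_nth:
  "subseq [x, y, z] L \<Longrightarrow> \<exists>i j k. i < j \<and> j < k \<and> k < length L \<and> x = L ! i \<and> y = L ! j \<and> z = L ! k"
proof (induction L)
  case (Cons a L)
  show ?case
  proof (cases "subseq [x, y, z] L")
    case True
    then obtain i j k where "i < j" "j < k" "k < length L" "x = L ! i" "y = L ! j" "z = L ! k" using Cons.IH by blast
    then show ?thesis by (intro exI[of _ "Suc i"] exI[of _ "Suc j"] exI[of _ "Suc k"]) auto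
  next
    case False
    then have "x = a" "subseq [y, z] L" using Cons.prems by (auto split: if_splits)
    then obtain j k where "j < k" "k < length L" "y = L ! j" "z = L ! k" using subseq2_nth by metis
    then show ?thesis using \<open>x = a\<close> by (intro exI[of _ 0] exI[of _ "Suc j"] exI[of _ "Suc k"]) auto
  qed
qed simp

context chiro begin

theorem filling_exists:
  assumes R: "finite R" "card R = c1 + c2 + c3" "c1 > 0" "c3 > 0" "q1 \<notin> R" "q2 \<notin> R" "q3 \<notin> R"
    and q: "d q1 q2 q3 > 0" "\<And>x. x \<in> R \<Longrightarrow> d q1 q2 x > 0 \<and> d q2 q3 x > 0 \<and> d q3 q1 x > 0"
    and gp: "gp ({q1, q2, q3} \<union> R)"
  shows "\<exists>B1 B2 B3 D. filling q1 q2 q3 B1 B2 B3 D \<and> set B1 \<union> set B2 \<union> set B3 = R \<and>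
     length B1 = c1 \<and> length B2 = c2 \<and> length B3 = c3"
proof -
  obtain S1 S2 S3 where S: "S1 \<union> S2 \<union> S3 = R" "S1 \<inter> S2 = {}" "S2 \<inter> S3 = {}" "S3 \<inter> S1 = {}"
    "card S1 = c1" "card S2 = c2" "card S3 = c3"
    "\<forall>x\<in>S1. \<forall>y\<in>S2. ln (d q1 q2 x) + ln (d q2 q3 y) \<le> ln (d q1 q2 y) + ln (d q2 q3 x)"
    "\<forall>y\<in>S2. \<forall>z\<in>S3. ln (d q2 q3 y) + ln (d q3 q1 z) \<le> ln (d q2 q3 z) + ln (d q3 q1 y)"
    "\<forall>z\<in>S3. \<forall>x\<in>S1. ln (d q3 q1 z) + ln (d q1 q2 x) \<le> ln (d q3 q1 x) + ln (d q1 q2 z)"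
    using optimal_partition[OF R(1,2), of "\<lambda>x. ln (d q1 q2 x)" "\<lambda>x. ln (d q2 q3 x)" "\<lambda>x. ln (d q3 q1 x)"]
    by (elim exE conjE) (rule that)
  \<comment> \<open>Without logarithms, the exchange inequality compares the ratios of the distances
    of \<open>x\<close> and \<open>z\<close> to the two sides at \<open>p\<close>. The
    Grassmann-Pluecker relation identifies the difference of the two products with
    \<open>d p q r * d p x z\<close>.\<close>
  have sep: "d p x z > 0"
    if "ln (d r p z) + ln (d p q x) \<le> ln (d r p x) + ln (d p q z)" "d r p z > 0" "d p q x > 0" "d r p x > 0" "d p q z > 0"
      "d p q r > 0" "d p x z \<noteq> 0" for p q r x z
  proof -
    have "ln (d r p z * d p q x) \<le> ln (d r p x * d p q z)" using that by (simp add: ln_mult)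
    then have "d r p z * d p q x \<le> d r p x * d p q z" using that by (simp add: ln_le_cancel_iff)
    moreover have "d p q r * d p x z = d r p x * d p q z - d r p z * d p q x"
      using gr[of p q x r z] sw[of p r z] rot[of r p x] by (simp add: algebra_simps)
    ultimately have "d p q r * d p x z \<ge> 0" by simp
    then show ?thesis using that(6,7) by (simp add: zero_le_mult_iff order_less_le)
  qed
  have qs: "d q2 q3 q1 > 0" "d q3 q1 q2 > 0" using q(1) rot by metis+
  have lay: "layout q1 q2 q3 S1 S2 S3"
    unfolding layout_def
  proof (intro conjI)
    show "finite S1" "finite S2" "finite S3" using S(1) R(1) by auto
    have nz: "d a x z \<noteq> 0" if "a \<in> {q1, q2, q3}" "x \<in> R" "z \<in> R" "x \<noteq> z" for a x z
      using that R(5-7) by (intro gpD[OF gp]) auto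
    have inR: "x \<in> R" if "x \<in> S1 \<or> x \<in> S2 \<or> x \<in> S3" for x using that S(1) by blast
    show "\<forall>x\<in>S1. \<forall>z\<in>S3. d q1 x z > 0"
    proof (intro ballI)
      fix x z assume a: "x \<in> S1" "z \<in> S3"
      have "x \<noteq> z" using a S(4) by blast
      then show "d q1 x z > 0"
        using S(10)[rule_format, OF a(2,1)] q(1) q(2)[OF inR, of x] q(2)[OF inR, of z] a nz[of q1 x z] inR
        by (intro sep[of q3 q1 z q2 x]) auto
    qed
    show "\<forall>y\<in>S2. \<forall>x\<in>S1. d q2 y x > 0"
    proof (intro ballI)
      fix y x assume a: "y \<in> S2" "x \<in> S1"
      have "y \<noteq> x" using a S(2) by blast
      then show "d q2 y x > 0"
        using S(8)[rule_format, OF a(2,1)] qs(1) q(2)[OF inR, of x] q(2)[OF inR, of y] a nz[of q2 y x] inR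
        by (intro sep[of q1 q2 x q3 y]) auto
    qed
    show "\<forall>z\<in>S3. \<forall>y\<in>S2. d q3 z y > 0"
    proof (intro ballI)
      fix z y assume a: "z \<in> S3" "y \<in> S2"
      have "z \<noteq> y" using a S(3) by blast
      then show "d q3 z y > 0"
        using S(9)[rule_format, OF a(2,1)] qs(2) q(2)[OF inR, of z] q(2)[OF inR, of y] a nz[of q3 z y] inR
        by (intro sep[of q2 q3 y q1 z]) auto
    qed
    show "gp ({q1, q2, q3} \<union> S1 \<union> S2 \<union> S3)" using gp S(1) by (simp add: Un_ac)
  qed (use S q R in auto)
  have "S1 \<noteq> {}" "S3 \<noteq> {}" using S R by auto
  then obtain B1 B2 B3 D where B: "filling q1 q2 q3 B1 B2 B3 D" "set B1 = S1" "set B2 = S2" "set B3 = S3"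
    using layout_filled[OF lay] unfolding filled_def by blast
  have "distinct B1" "distinct B2" "distinct B3" using B(1) unfolding filling_def by auto
  then have "length B1 = c1" "length B2 = c2" "length B3 = c3"
    using B(2-4) S(5-7) by (auto simp: distinct_card[symmetric])
  then show ?thesis using B S(1) by blast
qed

section \<open>Forced orientations in a double circle\<close>

lemma pocket_triple:
  assumes edge: "\<And>k j. Suc k < length L \<Longrightarrow> j < length L \<Longrightarrow> j \<noteq> k \<Longrightarrow> j \<noteq> Suc k \<Longrightarrow> d (L ! k) (L ! Suc k) (L ! j) < 0"
    and ijk: "i < j" "j < k" "k < length L"
  shows "d (L ! i) (L ! j) (L ! k) < 0"
proof (cases "j = Suc i")
  case True
  then show ?thesis using edge[of i k] ijk by simp
next
  case False
  interpret neg: chiro "\<lambda>a b c. - d a b c" by (rule neg_chiro)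
  have j: "Suc i < j" using ijk False by simp
  have ref: "- d (L ! i) (L ! Suc i) (L ! l) > 0" if "Suc i < l" "l < length L" for l
    using edge[of i l] that by simp
  \<comment> \<open>In the mirror image all later vertices are on the left of the edge leaving
    \<open>L ! i\<close>, and every later edge advances around \<open>L ! i\<close>, so transitivity
    of the angular order applies.\<close>
  have "- d (L ! i) (L ! j) (L ! k) > 0"
    using ijk(2,3)
  proof (induction k)
    case (Suc k)
    have e: "- d (L ! i) (L ! k) (L ! Suc k) > 0" if "i < k"
      using edge[of k i] Suc.prems that rot[of "L ! i" "L ! k" "L ! Suc k"] by simp
    show ?case
    proof (cases "j = k")
      case True
      then show ?thesis using e ijk(1) by simp
    next
      case False
      then have k: "j < k" using Suc.prems by simp
      show ?thesis
        by (rule neg.trans_left[of "L ! i" "L ! Suc i" "L ! j" "L ! k" "L ! Suc k"])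
          (use ref[of j] ref[of k] ref[of "Suc k"] j k Suc e in auto)
    qed
  qed simp
  then show ?thesis by simp
qed

text \<open>Seen from \<open>z\<close> the chain never turns back: if the line through
  \<open>z\<close> and \<open>L ! i\<close> separated the ends of an edge in the wrong direction,
  then either the segment from \<open>z\<close> to \<open>L ! i\<close> crosses that edge, or
  \<open>z\<close> is in the triangle of \<open>L ! i\<close> and the edge, although it lies beyond
  another edge that supports the whole chain.\<close>

lemma chain_sorted:
  assumes gp: "gp (insert z (set L))" and dist: "distinct L" and z: "z \<notin> set L"
    and edge: "\<And>k j. Suc k < length L \<Longrightarrow> j < length L \<Longrightarrow> j \<noteq> k \<Longrightarrow> j \<noteq> Suc k \<Longrightarrow> d (L ! k) (L ! Suc k) (L ! j) < 0"
    and base: "d z (hd L) (last L) > 0"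
    and free: "\<And>i k. i < length L \<Longrightarrow> Suc k < length L \<Longrightarrow> \<not> crossing (L ! i) z (L ! k) (L ! Suc k)"
    and out: "\<exists>k. Suc k < length L \<and> d (L ! k) (L ! Suc k) z > 0"
    and ri: "r < i" "i < length L"
  shows "d z (L ! r) (L ! i) > 0"
proof -
  have nz: "d z (L ! r) (L ! i) \<noteq> 0" if "r \<noteq> i" "r < length L" "i < length L" for r i
    using that dist z nth_eq_iff_index_eq by (intro gpD[OF gp]) (auto simp: nth_mem)
  have nope: False if i: "i < length L" and r: "Suc r < length L" "i \<noteq> r" "i \<noteq> Suc r"
     and pm: "d (L ! i) z (L ! r) > 0" "d (L ! i) z (L ! Suc r) < 0" for i r
  proof -
    let ?l = "\<lambda>p. d (L ! r) (L ! Suc r) p"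
    have li: "?l (L ! i) < 0" using edge[of r i] i r by simp
    have "?l z \<noteq> 0" using nz[of r "Suc r"] r rot[of z "L ! r" "L ! Suc r"] by simp
    moreover have "\<not> ?l z > 0"
    proof
      assume "?l z > 0"
      then have "crossing (L ! i) z (L ! r) (L ! Suc r)" using pm li unfolding crossing_def by (simp add: mult_pos_neg mult_neg_pos)
      then show False using free[of i r] i r by simp
    qed
    ultimately have lz: "?l z < 0" by linarith
    obtain k where k: "Suc k < length L" "d (L ! k) (L ! Suc k) z > 0" using out by blast
    have kn: "d (L ! k) (L ! Suc k) (L ! j) \<le> 0" if "j < length L" for j
      using edge[OF k(1) that] by (cases "j = k \<or> j = Suc k") (auto simp: less_imp_le)
    have "d (L ! Suc r) (L ! r) z > 0" using lz sw[of "L ! Suc r" "L ! r" z] by simp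
    moreover have "d (L ! r) (L ! i) z > 0" using pm(1) rot[of "L ! r" "L ! i" z] by simp
    moreover have "d (L ! i) (L ! Suc r) z > 0" using pm(2) sw2[of "L ! i" "L ! Suc r" z] by simp
    moreover have "d (L ! i) (L ! Suc r) (L ! r) > 0" using li sw3[of "L ! i" "L ! Suc r" "L ! r"] by simp
    ultimately have "d (L ! Suc r) (L ! r) z * d (L ! k) (L ! Suc k) (L ! i) \<le> 0"
      "d (L ! r) (L ! i) z * d (L ! k) (L ! Suc k) (L ! Suc r) \<le> 0"
      "d (L ! i) (L ! Suc r) z * d (L ! k) (L ! Suc k) (L ! r) \<le> 0"
      "0 < d (L ! i) (L ! Suc r) (L ! r) * d (L ! k) (L ! Suc k) z"
      using kn[of i] kn[of r] kn[of "Suc r"] i r k(2)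
      by (intro mult_nonneg_nonpos mult_pos_pos; simp)+
    moreover note lin[of "L ! i" "L ! Suc r" "L ! r" "L ! k" "L ! Suc k" z]
    ultimately have False by linarith
    then show False .
  qed
  have len: "length L \<ge> 2" using ri by linarith
  have hl: "hd L = L ! 0" "last L = L ! (length L - 1)"
    using len by (cases "L = []"; simp add: hd_conv_nth last_conv_nth)+
  \<comment> \<open>For the first vertex the sign is known against the last vertex only. A wrong
    sign at \<open>k\<close> would persist up to the end, because \<open>nope\<close> excludes the
    change back.\<close>
  have first: "d z (L ! 0) (L ! k) > 0" if "0 < k" "k < length L" for k
  proof (rule ccontr)
    assume "\<not> ?thesis"
    then have neg: "d z (L ! 0) (L ! k) < 0" using nz[of 0 k] that by linarith
    have "d z (L ! 0) (L ! j) < 0" if "k \<le> j" "j < length L" for j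
      using that
    proof (induction j rule: dec_induct)
      case (step j)
      show ?case
      proof (rule ccontr)
        assume "\<not> ?thesis"
        moreover have "d z (L ! 0) (L ! Suc j) \<noteq> 0" using step len by (intro nz) auto
        ultimately have "d z (L ! 0) (L ! Suc j) > 0" by linarith
        then have "d (L ! 0) z (L ! j) > 0" "d (L ! 0) z (L ! Suc j) < 0"
          using step sw[of z "L ! 0"] by auto
        moreover have "0 < length L" using len by linarith
        ultimately show False using nope[of 0 j] step \<open>0 < k\<close> by blast
      qed
    qed (use neg in simp)
    moreover have "k \<le> length L - 1" "length L - 1 < length L" using that by linarith+
    ultimately show False using base hl by (metis less_asym)
  qed
  show ?thesis
  proof (cases "r = 0")
    case True
    then show ?thesis using first ri by simp
  next
    case False
    have "d (L ! i) z (L ! j) > 0" if "j < i" for j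
      using that
    proof (induction j)
      case 0
      then show ?case using first[of i] ri rot[of z "L ! 0" "L ! i"] rot[of "L ! i" z "L ! 0"] by simp
    next
      case (Suc j)
      show ?case
      proof (rule ccontr)
        assume no: "\<not> ?thesis"
        have "d z (L ! Suc j) (L ! i) \<noteq> 0" using Suc ri by (intro nz) auto
        then have "d (L ! i) z (L ! Suc j) < 0" using no rot[of "L ! i" z "L ! Suc j"] by auto
        then show False using nope[of i j] Suc ri by auto
      qed
    qed
    from this[OF ri(1)] show ?thesis using rot[of "L ! i" z "L ! r"] by simp
  qed
qed

text \<open>What has to be found is an edge beyond which \<open>z\<close> lies. For \<open>z\<close>
  other than the opposite corner \<open>w\<close>, the chain changes sides of the line
  \<open>zw\<close> at some edge, and \<open>w\<close> is beyond this edge; \<open>z\<close> must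
  then be beyond it as well, since otherwise the segment \<open>zw\<close> would cross it.\<close>

lemma chain_chirotope:
  assumes L: "L = p # A @ [q]" "distinct L" "set L \<subseteq> V" and w: "w \<in> V" "w \<notin> set L" and gp: "gp V"
    and hull: "\<And>x. x \<in> V - {p, q} \<Longrightarrow> d p q x > 0" "\<And>x. x \<in> V - {q, w} \<Longrightarrow> d q w x > 0"
      "\<And>x. x \<in> V - {w, p} \<Longrightarrow> d w p x > 0"
    and edge: "\<And>k j. Suc k < length L \<Longrightarrow> j < length L \<Longrightarrow> j \<noteq> k \<Longrightarrow> j \<noteq> Suc k \<Longrightarrow> d (L ! k) (L ! Suc k) (L ! j) < 0"
    and free: "\<And>u v k. u \<in> V \<Longrightarrow> v \<in> V \<Longrightarrow> Suc k < length L \<Longrightarrow> \<not> crossing u v (L ! k) (L ! Suc k)"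
    and z: "z \<in> V" "z \<notin> set L" and ri: "r < i" "i < length L"
  shows "d z (L ! r) (L ! i) > 0"
proof (rule chain_sorted[OF _ L(2) z(2) edge _ _ _ ri])
  have len: "length L \<ge> 2" using L(1) by simp
  have mem: "L ! k \<in> V" if "k < length L" for k using that L(3) by (meson nth_mem subsetD)
  have ends: "L ! 0 = p" "L ! (length L - 1) = q" using L(1) by (simp_all add: nth_append)
  have neq: "L ! k \<noteq> L ! j" if "k < length L" "j < length L" "k \<noteq> j" for k j
    using that L(2) nth_eq_iff_index_eq by blast
  have nL: "z \<noteq> L ! k" "w \<noteq> L ! k" if "k < length L" for k using that z(2) w(2) nth_mem by metis+
  have pw: "p \<noteq> w" "q \<noteq> w" "p \<noteq> q" using w L(1,2) by auto
  have zpq: "z \<noteq> p" "z \<noteq> q" using z(2) L(1) by auto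
  have seen: "d w p (L ! k) > 0" if "0 < k" "k < length L" for k
    using hull(3)[of "L ! k"] mem[of k] neq[of k 0] nL(2)[of k] ends(1) that len by force
  show "gp (insert z (set L))" using gp L(3) z(1) by (intro gp_subset[OF gp]) auto
  show "d z (hd L) (last L) > 0" using hull(1)[of z] z(1) zpq L(1) rot[of z p q] by simp
  show "\<exists>k. Suc k < length L \<and> d (L ! k) (L ! Suc k) z > 0"
  proof (cases "z = w")
    case True
    then show ?thesis using seen[of 1] len rot[of w p "L ! 1"] ends by (intro exI[of _ 0]) auto
  next
    case False
    have s0: "d z w (L ! 0) > 0" using hull(3)[of z] z(1) False zpq ends rot[of z w p] by auto
    have sm: "d z w (L ! (length L - 1)) < 0"
      using hull(2)[of z] z(1) False zpq ends rot[of q w z] sw[of w z q] by auto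
    have nz: "d z w (L ! k) \<noteq> 0" if "k < length L" for k
      using that mem nL[of k] False z(1) w(1) by (intro gpD[OF gp]) auto
    have "\<exists>k. Suc k < length L \<and> d z w (L ! k) > 0 \<and> d z w (L ! Suc k) < 0"
    proof (rule ccontr)
      assume no: "\<not> ?thesis"
      have "d z w (L ! k) > 0" if "k < length L" for k
        using that
      proof (induction k)
        case (Suc k)
        then show ?case using no nz[of "Suc k"] by (metis Suc_lessD linorder_neqE_linordered_idom)
      qed (use s0 in simp)
      moreover have "length L - 1 < length L" using len by linarith
      ultimately show False using sm by (meson less_asym)
    qed
    then obtain k where k: "Suc k < length L" "d z w (L ! k) > 0" "d z w (L ! Suc k) < 0" by blast
    have wk: "d w (L ! k) (L ! Suc k) > 0"
    proof (cases "k = 0")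
      case True
      then show ?thesis using seen[of 1] k(1) ends by simp
    next
      case False
      have "d w p z > 0" using hull(3)[of z] z(1) \<open>z \<noteq> w\<close> zpq by simp
      moreover have "d w (L ! k) z > 0" "d w z (L ! Suc k) > 0"
        using k(2,3) rot[of z w "L ! k"] sw[of z w "L ! Suc k"] by auto
      ultimately show ?thesis using trans_left[of w p "L ! k" z "L ! Suc k"] seen False k(1) by simp
    qed
    have "\<not> d (L ! k) (L ! Suc k) z < 0"
    proof
      assume "d (L ! k) (L ! Suc k) z < 0"
      then have "crossing z w (L ! k) (L ! Suc k)"
        using k wk rot[of w "L ! k" "L ! Suc k"] unfolding crossing_def by (simp add: mult_pos_neg mult_neg_pos)
      then show False using free z(1) w(1) k(1) by blast
    qed
    moreover have "d (L ! k) (L ! Suc k) z \<noteq> 0"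
      using k(1) mem nL(1)[of k] nL(1)[of "Suc k"] neq[of k "Suc k"] z(1) by (intro gpD[OF gp]) auto
    ultimately show ?thesis using k(1) by (intro exI[of _ k]) linarith
  qed
  show "\<not> crossing (L ! i) z (L ! k) (L ! Suc k)" if "i < length L" "Suc k < length L" for i k
    using free[of "L ! i" z k] mem that z(1) by blast
qed

text \<open>If \<open>x, y, z\<close> were clockwise, then \<open>p1, p2, p3\<close> would lie in the opposite cones at \<open>y, z, x\<close>;
  a determinant of a diagonally dominant matrix shows that \<open>p1, p2, p3\<close> would be clockwise too.\<close>

lemma three_chains:
  assumes p: "d p1 p2 p3 > 0" and nz: "d x y z \<noteq> 0"
    and c1: "d y p1 x > 0" "d z x p2 > 0" "d z p1 x > 0" "d y x p2 > 0"
    and c2: "d z p2 y > 0" "d x y p3 > 0" "d x p2 y > 0" "d z y p3 > 0"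
    and c3: "d x p3 z > 0" "d y z p1 > 0" "d y p3 z > 0" "d x z p1 > 0"
  shows "d x y z > 0"
proof (rule ccontr)
  assume "\<not> ?thesis"
  then have neg: "d x y z < 0" using nz by linarith
  define D where "D = d x y z"
  \<comment> \<open>Up to the factor \<open>D\<close>, these are the barycentric coordinates of
    \<open>p1\<close>, \<open>p2\<close> and \<open>p3\<close> with respect to \<open>x\<close>,
    \<open>y\<close>, \<open>z\<close>, with the signs taken out so that all nine letters are
    positive.\<close>
  define e f g where "e = d p1 y z" and "f = - d x p1 z" and "g = d x y p1"
  define h k l where "h = d p2 y z" and "k = d x p2 z" and "l = - d x y p2"
  define a b c where "a = - d p3 y z" and "b = d x p3 z" and "c = d x y p3"
  have "f = d x z p1" "l = d x p2 y" "a = d z y p3"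
    using sw2[of x p1 z] sw2[of x y p2] sw3[of p3 y z] by (simp_all add: f_def l_def a_def)
  moreover have "e = d y z p1" "g = d y p1 x" "k = d z x p2"
    using rot[of p1 y z] rot[of x y p1] rot[of z x p2] by (simp_all add: e_def g_def k_def)
  moreover have "d p2 y z = d z p2 y" using rot[of z p2 y] by simp
  ultimately have pos: "a > 0" "b > 0" "c > 0" "e > 0" "f > 0" "g > 0" "h > 0" "k > 0" "l > 0"
    using c1 c2 c3 by (simp_all add: b_def c_def h_def)
  have sums: "e - f + g = D" "h + k - l = D" "- a + b + c = D"
    using four[of x y p1 z] four[of x y p2 z] four[of x y p3 z]
      rot[of y z p1] rot[of z p1 x] rot[of z x p1] sw2[of x p1 z] rot[of p1 y z]
      rot[of y z p2] rot[of z x p2] rot[of p2 y z] rot[of x p2 z]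
      rot[of y z p3] rot[of z x p3] rot[of p3 y z] rot[of x p3 z]
    by (simp_all add: D_def e_def f_def g_def h_def k_def l_def a_def b_def c_def)
  have ex: "D * d u v t = d t y z * d u v x + d x t z * d u v y + d x y t * d u v z" for u v t
    using lin[of x y z u v t] rot[of y z t] rot[of t y z] rot[of z x t] rot[of x t z] by (simp add: D_def)
  have P3: "D * d p1 p2 p3 = - a * d p1 p2 x + b * d p1 p2 y + c * d p1 p2 z"
    using ex[of p1 p2 p3] by (simp add: a_def b_def c_def)
  have X: "D * d p1 p2 x = l * f - k * g"
  proof -
    have "D * d x p1 p2 = k * d x p1 y + - l * d x p1 z" using ex[of x p1 p2] by (simp add: k_def l_def)
    then show ?thesis using rot[of x p1 p2] sw2[of x p1 y] by (simp add: f_def g_def algebra_simps)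
  qed
  have Y: "D * d p1 p2 y = h * g + l * e"
  proof -
    have "D * d y p1 p2 = h * d y p1 x + - l * d y p1 z" using ex[of y p1 p2] by (simp add: h_def l_def)
    then show ?thesis using rot[of y p1 p2] rot[of y p1 x] rot[of p1 x y] sw[of y p1 z]
      by (simp add: e_def g_def algebra_simps)
  qed
  have Z: "D * d p1 p2 z = h * f + k * e"
  proof -
    have "D * d z p1 p2 = h * d z p1 x + k * d z p1 y" using ex[of z p1 p2] by (simp add: h_def k_def)
    then show ?thesis using rot[of z p1 p2] rot[of z p1 x] rot[of p1 x z] sw2[of x p1 z] sw[of x p1 z] rot[of z p1 y] rot[of p1 y z]
      by (simp add: e_def f_def algebra_simps)
  qed
  have "D * (D * d p1 p2 p3) = - a * (D * d p1 p2 x) + b * (D * d p1 p2 y) + c * (D * d p1 p2 z)"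
    unfolding P3 by (simp add: algebra_simps)
  also have "\<dots> = D * (b * (g + l) + c * (k + f) + (f * l - g * k))"
  proof -
    have "a = b + c - D" "e = f - g + D" "h = l - k + D" using sums by linarith+
    then show ?thesis unfolding X Y Z by algebra
  qed
  \<comment> \<open>The determinant of the coordinates, divided by \<open>D\<close> after the row
    sums have eliminated \<open>a\<close>, \<open>e\<close> and \<open>h\<close>. As
    \<open>D\<close> is negative, the row sums also give \<open>f > g\<close> and
    \<open>l > k\<close>.\<close>
  finally have "D * d p1 p2 p3 = b * (g + l) + c * (k + f) + (f * l - g * k)"
    using neg by (simp add: D_def)
  moreover have "f > g" "l > k" using sums pos neg unfolding D_def[symmetric] by linarith+
  then have "f * l > g * k" using pos by (intro mult_strict_mono) auto
  moreover have "b * (g + l) > 0" "c * (k + f) > 0" using pos by simp_all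
  ultimately have "D * d p1 p2 p3 > 0" by linarith
  then show False using neg p by (simp add: D_def mult_less_0_iff zero_less_mult_iff)
qed

text \<open>Two properties of the chains enter: each edge has the rest of its chain on the right,
  which comes from convexity, and no segment between two points crosses it, which comes from
  unavoidability.\<close>

definition double_circle :: "'a set \<Rightarrow> 'a \<Rightarrow> 'a \<Rightarrow> 'a \<Rightarrow> 'a list \<Rightarrow> 'a list \<Rightarrow> 'a list \<Rightarrow> bool" where
  "double_circle V p1 p2 p3 A1 A2 A3 \<longleftrightarrow>
     gp V \<and> distinct (p1 # A1 @ p2 # A2 @ p3 # A3) \<and> set (p1 # A1 @ p2 # A2 @ p3 # A3) = V \<and> d p1 p2 p3 > 0 \<and>
     (\<forall>x\<in>V - {p1, p2, p3}. d p1 p2 x > 0 \<and> d p2 p3 x > 0 \<and> d p3 p1 x > 0) \<and>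
     (\<forall>L\<in>{p1 # A1 @ [p2], p2 # A2 @ [p3], p3 # A3 @ [p1]}. \<forall>k. Suc k < length L \<longrightarrow>
        (\<forall>j<length L. j \<noteq> k \<longrightarrow> j \<noteq> Suc k \<longrightarrow> d (L ! k) (L ! Suc k) (L ! j) < 0) \<and>
        (\<forall>u\<in>V. \<forall>v\<in>V. \<not> crossing u v (L ! k) (L ! Suc k)))"

lemma double_circle_rotate:
  "double_circle V p1 p2 p3 A1 A2 A3 \<Longrightarrow> double_circle V p2 p3 p1 A2 A3 A1"
  unfolding double_circle_def using rot[of p1 p2 p3] by (auto simp: insert_commute)

lemma double_circle_chain:
  assumes C: "double_circle V p1 p2 p3 A1 A2 A3" and s: "subseq [x, y] (p1 # A1 @ [p2])"
    and z: "z \<in> V" "z \<notin> set (p1 # A1 @ [p2])"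
  shows "d z x y > 0"
proof -
  let ?L = "p1 # A1 @ [p2]"
  have c: "gp V" "distinct (p1 # A1 @ p2 # A2 @ p3 # A3)" "set (p1 # A1 @ p2 # A2 @ p3 # A3) = V" "d p1 p2 p3 > 0"
    "\<And>x. x \<in> V - {p1, p2, p3} \<Longrightarrow> d p1 p2 x > 0 \<and> d p2 p3 x > 0 \<and> d p3 p1 x > 0"
    "\<And>k j. Suc k < length ?L \<Longrightarrow> j < length ?L \<Longrightarrow> j \<noteq> k \<Longrightarrow> j \<noteq> Suc k \<Longrightarrow> d (?L ! k) (?L ! Suc k) (?L ! j) < 0"
    "\<And>k u v. Suc k < length ?L \<Longrightarrow> u \<in> V \<Longrightarrow> v \<in> V \<Longrightarrow> \<not> crossing u v (?L ! k) (?L ! Suc k)"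
    using C unfolding double_circle_def by (elim conjE; simp; fail | (elim conjE; blast))+
  obtain i j where ij: "i < j" "j < length ?L" "x = ?L ! i" "y = ?L ! j" using subseq2_nth[OF s] by blast
  have pp: "d p2 p3 p1 > 0" "d p3 p1 p2 > 0" using c(4) rot by metis+
  have "d z (?L ! i) (?L ! j) > 0"
  proof (rule chain_chirotope[where w = p3 and V = V, OF refl _ _ _ _ c(1) _ _ _ c(6) c(7) z ij(1,2)])
    show "distinct ?L" "set ?L \<subseteq> V" "p3 \<in> V" "p3 \<notin> set ?L" using c(2,3) by auto
    show "d p1 p2 x > 0" if "x \<in> V - {p1, p2}" for x using c(5)[of x] c(4) that by (cases "x = p3") auto
    show "d p2 p3 x > 0" if "x \<in> V - {p2, p3}" for x using c(5)[of x] pp that by (cases "x = p1") auto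
    show "d p3 p1 x > 0" if "x \<in> V - {p3, p1}" for x using c(5)[of x] pp that by (cases "x = p2") auto
  qed
  then show ?thesis using ij by simp
qed

lemma double_circle_inner:
  assumes C: "double_circle V p1 p2 p3 A1 A2 A3" and V: "x \<in> V" "y \<in> V" "z \<in> V"
    and a: "inner (p1 # A1 @ [p2]) (x, y, z) \<or> pocket (p1 # A1 @ [p2]) (x, y, z)"
  shows "d x y z > 0"
  using a
proof
  assume "inner (p1 # A1 @ [p2]) (x, y, z)"
  then show ?thesis
    unfolding inner.simps using double_circle_chain[OF C] V rot rot' by metis
next
  let ?L = "p1 # A1 @ [p2]"
  assume "pocket ?L (x, y, z)"
  then obtain i j k where "i < j" "j < k" "k < length ?L" "z = ?L ! i" "y = ?L ! j" "x = ?L ! k"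
    using subseq3_nth unfolding pocket.simps by metis
  moreover have "\<And>k j. Suc k < length ?L \<Longrightarrow> j < length ?L \<Longrightarrow> j \<noteq> k \<Longrightarrow> j \<noteq> Suc k \<Longrightarrow> d (?L ! k) (?L ! Suc k) (?L ! j) < 0"
    using C unfolding double_circle_def by blast
  ultimately have "d z y x < 0" using pocket_triple[of ?L i j k] by blast
  then show ?thesis using sw3[of x y z] by simp
qed

text \<open>Each of the three points sees the other two chains in order, hence sees the chosen point
  of such a chain between the ends of that chain; these are the twelve signs that
  \<open>three_chains\<close> needs.\<close>

lemma double_circle_spread:
  assumes C: "double_circle V p1 p2 p3 A1 A2 A3" and "x \<in> set A1" "y \<in> set A2" "z \<in> set A3"
  shows "d x y z > 0"
proof -
  note C2 = double_circle_rotate[OF C]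
  note C3 = double_circle_rotate[OF C2]
  have c: "gp V" "distinct (p1 # A1 @ p2 # A2 @ p3 # A3)" "set (p1 # A1 @ p2 # A2 @ p3 # A3) = V" "d p1 p2 p3 > 0"
    using C unfolding double_circle_def by (elim conjE; simp; fail | (elim conjE; blast))+
  have V: "x \<in> V" "y \<in> V" "z \<in> V" using c(3) assms by auto
  have n1: "y \<notin> set (p1 # A1 @ [p2])" "z \<notin> set (p1 # A1 @ [p2])" using c(2) assms by auto
  have n2: "x \<notin> set (p2 # A2 @ [p3])" "z \<notin> set (p2 # A2 @ [p3])" using c(2) assms by auto
  have n3: "x \<notin> set (p3 # A3 @ [p1])" "y \<notin> set (p3 # A3 @ [p1])" using c(2) assms by auto
  have sub: "subseq [p, a] (p # A @ [q])" "subseq [a, q] (p # A @ [q])" if "a \<in> set A" for a p q :: 'a and A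
  proof -
    have "subseq [a] A" using that by (simp add: subseq_singleton_left)
    then have "subseq ([a] @ [q]) (A @ [q])" by (simp only: subseq_append)
    then have "subseq [a, q] (A @ [q])" by (simp only: append_Cons append_Nil)
    then show "subseq [a, q] (p # A @ [q])" by (rule list_emb_Cons)
    have "subseq [a] (A @ [q])" using that by (simp add: subseq_singleton_left)
    then show "subseq [p, a] (p # A @ [q])" by simp
  qed
  show ?thesis
  proof (rule three_chains[of p1 p2 p3])
    show "d x y z \<noteq> 0" using c(1,2) V assms by (intro gpD[OF c(1)]) auto
    show "d y p1 x > 0" "d y x p2 > 0"
      using double_circle_chain[OF C _ V(2) n1(1)] sub[OF assms(2)] by blast+
    show "d z p1 x > 0" "d z x p2 > 0"
      using double_circle_chain[OF C _ V(3) n1(2)] sub[OF assms(2)] by blast+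
    show "d z p2 y > 0" "d z y p3 > 0"
      using double_circle_chain[OF C2 _ V(3) n2(2)] sub[OF assms(3)] by blast+
    show "d x p2 y > 0" "d x y p3 > 0"
      using double_circle_chain[OF C2 _ V(1) n2(1)] sub[OF assms(3)] by blast+
    show "d x p3 z > 0" "d x z p1 > 0"
      using double_circle_chain[OF C3 _ V(1) n3(1)] sub[OF assms(4)] by blast+
    show "d y p3 z > 0" "d y z p1 > 0"
      using double_circle_chain[OF C3 _ V(2) n3(2)] sub[OF assms(4)] by blast+
  qed (use c(4) in auto)
qed

theorem double_circle_allowed:
  assumes C: "double_circle V p1 p2 p3 A1 A2 A3" and V: "x \<in> V" "y \<in> V" "z \<in> V"
    and a: "allowed (p1 # A1 @ [p2]) (p2 # A2 @ [p3]) (p3 # A3 @ [p1]) (x, y, z)"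
  shows "d x y z > 0"
proof -
  note C2 = double_circle_rotate[OF C]
  note C3 = double_circle_rotate[OF C2]
  let ?L1 = "p1 # A1 @ [p2]" and ?L2 = "p2 # A2 @ [p3]" and ?L3 = "p3 # A3 @ [p1]"
  consider "inner ?L1 (x, y, z) \<or> pocket ?L1 (x, y, z)" | "inner ?L2 (x, y, z) \<or> pocket ?L2 (x, y, z)"
    | "inner ?L3 (x, y, z) \<or> pocket ?L3 (x, y, z)"
    | "spread (set ?L1 - set ?L2 - set ?L3) (set ?L2 - set ?L3 - set ?L1) (set ?L3 - set ?L1 - set ?L2) (x, y, z)"
    using a unfolding allowed_def by blast
  then show ?thesis
  proof cases
    case 1 then show ?thesis by (rule double_circle_inner[OF C V])
  next
    case 2 then show ?thesis by (rule double_circle_inner[OF C2 V])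
  next
    case 3 then show ?thesis by (rule double_circle_inner[OF C3 V])
  next
    case 4
    then have "x \<in> set A1 \<and> y \<in> set A2 \<and> z \<in> set A3 \<or> y \<in> set A1 \<and> z \<in> set A2 \<and> x \<in> set A3 \<or>
       z \<in> set A1 \<and> x \<in> set A2 \<and> y \<in> set A3" by auto
    then show ?thesis using double_circle_spread[OF C] rot rot' by metis
  qed
qed

end

section \<open>Proof of the theorem\<close>

text \<open>The sign makes the corners positively oriented. It is chosen separately for
  \<open>P\<close> and \<open>Q\<close>, because the given bijection of the hull vertices may
  reverse the orientation.\<close>

definition sori :: "real \<Rightarrow> real^2 \<Rightarrow> real^2 \<Rightarrow> real^2 \<Rightarrow> real" where
  "sori s a b c = s * ori a b c"

lemma ori_lin: "ori a b c * ori w e p = ori b c p * ori w e a + ori c a p * ori w e b + ori a b p * ori w e c"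
  unfolding ori_def by algebra

text \<open>When the lines \<open>cw\<close> and \<open>aw'\<close> meet, their common point can be
  written along either of them; the identity says that its determinant with itself, seen from
  \<open>q\<close>, is 0.\<close>

lemma ori_cross: "- ori c w w' * ori a w' w * ori q a c + ori c w w' * ori a w' c * ori q a w
       + ori c w a * ori a w' w * ori q w' c - ori c w a * ori a w' c * ori q w' w = 0"
  unfolding ori_def by algebra

lemma chiro_ori: "chiro ori"
proof
  fix a b c p e w q w' :: "real^2"
  show "ori a b c = ori b c a" by (rule ori_rotate)
  show "ori a b c = - ori b a c" by (rule ori_swap)
  show "ori a b p + ori b c p + ori c a p = ori a b c" by (rule ori_four)
  show "ori a b c * ori a p e - ori a b p * ori a c e + ori a b e * ori a c p = 0" by (rule ori_grassmann)
  show "ori a b c * ori w e p = ori b c p * ori w e a + ori c a p * ori w e b + ori a b p * ori w e c" by (rule ori_lin)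
  show "- ori c w w' * ori a w' w * ori q a c + ori c w w' * ori a w' c * ori q a w
       + ori c w a * ori a w' w * ori q w' c - ori c w a * ori a w' c * ori q w' w = 0" by (rule ori_cross)
qed

lemma chiro_sori:
  assumes "s = 1 \<or> s = - 1"
  shows "chiro (sori s)"
  using assms
proof
  assume "s = 1"
  then have "sori s = ori" by (intro ext) (simp add: sori_def)
  then show ?thesis using chiro_ori by simp
next
  assume "s = - 1"
  then have "sori s = (\<lambda>a b c. - ori a b c)" by (intro ext) (simp add: sori_def)
  then show ?thesis using chiro.neg_chiro[OF chiro_ori] by simp
qed

lemma planar_gp:
  assumes "s = 1 \<or> s = - 1" "planar_point_set V"
  shows "chiro.gp (sori s) V"
  unfolding chiro.gp_def[OF chiro_sori[OF assms(1)]] sori_def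
  using assms planar_ori_nonzero[OF assms(2)] by (auto; metis)

lemma sides_reversed: "sides (reversed t) = sides t"
  by (cases t) (auto simp: insert_commute)

lemma corners_reversed: "corners (reversed t) = corners t"
  by (cases t) (auto simp: insert_commute)

text \<open>For \<open>s = - 1\<close> the triangles are clockwise in the plane. Reversing all of
  them, and the outer one, negates both sides of the boundary identity and keeps the sets of
  sides.\<close>

lemma triangulation_of_bounds:
  assumes s: "s = 1 \<or> s = - 1" and V: "planar_point_set V" "{a, b, c} \<subseteq> V" and abc: "sori s a b c > 0"
    and hull: "\<And>x. x \<in> V - {a, b, c} \<Longrightarrow> sori s a b x > 0 \<and> sori s b c x > 0 \<and> sori s c a x > 0"
    and D: "\<And>t. t \<in> set D \<Longrightarrow> corners t \<subseteq> V" "\<And>x y z. (x, y, z) \<in> set D \<Longrightarrow> sori s x y z > 0"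
      "bounds D (a, b, c)" "V \<subseteq> \<Union> (corners ` set D)"
  shows "triangulation_on V (\<Union> (sides ` set D))"
  using s
proof
  assume s1: "s = 1"
  interpret tiling V D "(a, b, c)"
  proof
    show "ccw t" if "t \<in> set D" for t using D(2) that s1 by (cases t) (auto simp: sori_def)
    show "cinside p (a, b, c)" if "p \<in> V" for p
    proof (cases "p \<in> {a, b, c}")
      case True
      then show ?thesis using abc s1 ori_rotate[of a b c] ori_rotate'[of a b c] by (auto simp: sori_def)
    next
      case False
      then show ?thesis using hull[of p] that s1 by (auto simp: sori_def less_imp_le)
    qed
  qed (use V D abc s1 in \<open>auto simp: sori_def\<close>)
  show ?thesis using triangulation unfolding edges_def .
next
  assume s1: "s = - 1"
  interpret tiling V "map reversed D" "(c, b, a)"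
  proof
    show "corners t \<subseteq> V" if "t \<in> set (map reversed D)" for t
      using that D(1) by (auto simp: corners_reversed)
    show "ccw t" if "t \<in> set (map reversed D)" for t
    proof -
      obtain x y z where t: "t = (x, y, z)" by (cases t)
      then have "sori s z y x > 0" using that D(2) unfolding t in_reversed by blast
      then show ?thesis using ori_swap(3)[of x y z] s1 by (simp add: t sori_def)
    qed
    show "ccw (c, b, a)" using abc ori_swap(3)[of a b c] s1 by (simp add: sori_def)
    show "cinside p (c, b, a)" if "p \<in> V" for p
    proof (cases "p \<in> {a, b, c}")
      case True
      have "ori c b a > 0" using abc ori_swap(3)[of a b c] s1 by (simp add: sori_def)
      then show ?thesis using True ori_rotate[of c b a] ori_rotate'[of c b a] by auto
    next
      case False
      then show ?thesis
        using hull[of p] that s1 ori_swap(1)[of c b p] ori_swap(1)[of b a p] ori_swap(1)[of a c p]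
        by (auto simp: sori_def)
    qed
    show "bounds (map reversed D) (c, b, a)"
      unfolding bounds_def
    proof (intro allI impI)
      fix \<phi> :: "real^2 \<Rightarrow> real^2 \<Rightarrow> real" assume k: "skew \<phi>"
      show "(\<Sum>t\<leftarrow>map reversed D. bd \<phi> t) = bd \<phi> (c, b, a)"
        using sum_reversed[OF k, of D] D(3) k bd_reversed[OF k, of "(a, b, c)"] unfolding bounds_def by simp
    qed
    show "V \<subseteq> \<Union> (corners ` set (map reversed D))" using D(4) by (simp add: corners_reversed image_image)
  qed (use V in auto)
  show ?thesis using triangulation unfolding edges_def by (simp add: sides_reversed image_image)
qed

text \<open>By Krein-Milman the hull is spanned by its three extreme points, so every other point is
  a convex combination of these. The weights are quotients of determinants, hence positive in
  general position.\<close>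

lemma triangular_hull:
  assumes V: "planar_point_set V" "hull_vertices V = {a, b, c}" "a \<noteq> b" "b \<noteq> c" "c \<noteq> a"
  shows "{a, b, c} \<subseteq> V" "\<exists>s. (s = 1 \<or> s = - 1) \<and> sori s a b c > 0 \<and>
     (\<forall>x\<in>V - {a, b, c}. sori s a b x > 0 \<and> sori s b c x > 0 \<and> sori s c a x > 0)"
proof -
  have ext: "{x. x extreme_point_of (convex hull V)} = {a, b, c}" using V(2) by (simp add: hull_vertices_def)
  show sub: "{a, b, c} \<subseteq> V" using ext extreme_point_of_convex_hull by fastforce
  have "compact (convex hull V)" using planar_finite[OF V(1)] by (rule finite_imp_compact_convex_hull)
  then have hull: "convex hull V = convex hull {a, b, c}"
    using Krein_Milman_Minkowski[of "convex hull V"] ext by simp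
  have nz: "ori a b c \<noteq> 0" using planar_ori_nonzero[OF V(1), of a b c] sub V(3-5) by auto
  define s :: real where "s = (if ori a b c > 0 then 1 else - 1)"
  have s: "s = 1 \<or> s = - 1" "sori s a b c > 0" using nz by (auto simp: s_def sori_def)
  have "sori s a b x > 0 \<and> sori s b c x > 0 \<and> sori s c a x > 0" if x: "x \<in> V - {a, b, c}" for x
  proof -
    have "x \<in> convex hull {a, b, c}" using hull x hull_inc[of x V] by auto
    then obtain u v w where u: "u \<ge> 0" "v \<ge> 0" "w \<ge> 0" "u + v + w = 1" "x = u *\<^sub>R a + v *\<^sub>R b + w *\<^sub>R c"
      unfolding convex_hull_3 by blast
    have u1: "u = 1 - v - w" using u(4) by simp
    have e: "ori a b x = w * ori a b c" "ori b c x = u * ori a b c" "ori c a x = v * ori a b c"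
      unfolding u(5) u1 by (simp_all add: ori_def algebra_simps)
    have "ori a b x \<noteq> 0" "ori b c x \<noteq> 0" "ori c a x \<noteq> 0"
      using x sub V(3-5) planar_ori_nonzero[OF V(1)] by auto
    then have "w \<noteq> 0" "u \<noteq> 0" "v \<noteq> 0" using e by auto
    then have "u > 0" "v > 0" "w > 0" using u(1-3) by auto
    moreover have "sori s a b x = w * sori s a b c" "sori s b c x = u * sori s a b c" "sori s c a x = v * sori s a b c"
      by (simp_all add: sori_def e)
    ultimately show ?thesis using s(2) by simp
  qed
  then show "\<exists>s. (s = 1 \<or> s = - 1) \<and> sori s a b c > 0 \<and>
     (\<forall>x\<in>V - {a, b, c}. sori s a b x > 0 \<and> sori s b c x > 0 \<and> sori s c a x > 0)" using s by blast
qed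

lemma on_line:
  assumes "ori p q m = 0" "p \<noteq> q"
  shows "\<exists>t. m = p + t *\<^sub>R (q - p)"
proof -
  have "collinear {p, q, m}" using assms by (simp add: collinear_iff_ori)
  then have "collinear {0, q - p, m - p}" using collinear_3[of q p m] by (simp add: insert_commute)
  then have "m - p = 0 \<or> (\<exists>t. m - p = t *\<^sub>R (q - p))" unfolding collinear_lemma using assms(2) by auto
  then show ?thesis
  proof
    assume "m - p = 0"
    then show ?thesis by (intro exI[of _ 0]) simp
  next
    assume "\<exists>t. m - p = t *\<^sub>R (q - p)"
    then obtain t where "m - p = t *\<^sub>R (q - p)" by blast
    then show ?thesis by (intro exI[of _ t]) (simp add: algebra_simps)
  qed
qed

text \<open>The segment between \<open>r\<close> and \<open>r'\<close> meets the line
  \<open>pq\<close> in a point \<open>m\<close> of the hull. If \<open>m\<close> is on the edge, the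
  face property puts \<open>r\<close> on it as well. If \<open>m\<close> is beyond an end, that end
  is strictly between the other end and \<open>m\<close>, and the face property puts
  \<open>m\<close> on the edge.\<close>

lemma hull_edge_one_side:
  assumes e: "hull_edge S p q" and pq: "p \<noteq> q" and rs: "r \<in> S" "r' \<in> S" "ori p q r > 0" "ori p q r' < 0"
  shows False
proof -
  have face: "closed_segment p q face_of convex hull S" using e by (simp add: hull_edge_def edge_of_def)
  have F: "a \<in> closed_segment p q \<and> b \<in> closed_segment p q"
    if "a \<in> convex hull S" "b \<in> convex hull S" "x \<in> closed_segment p q" "x \<in> open_segment a b" for a b x
    using face that unfolding face_of_def by blast
  have pqS: "p \<in> convex hull S" "q \<in> convex hull S"
    using face_of_imp_subset[OF face] by auto
  define u where "u = ori p q r / (ori p q r - ori p q r')"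
  have u: "0 < u" "u < 1" using rs by (auto simp: u_def divide_simps)
  define m where "m = (1 - u) *\<^sub>R r + u *\<^sub>R r'"
  have m0: "ori p q m = 0" unfolding m_def ori_affine u_def using rs by (simp add: field_simps)
  have "r \<noteq> r'" using rs by auto
  then have mseg: "m \<in> open_segment r r'" using u by (auto simp: in_segment m_def)
  have rS: "r \<in> convex hull S" "r' \<in> convex hull S" using rs hull_inc by metis+
  have mS: "m \<in> convex hull S"
    using mseg rS convex_contains_open_segment[of "convex hull S"] convex_convex_hull by blast
  obtain t where t: "m = p + t *\<^sub>R (q - p)" using on_line[OF m0 pq] by blast
  have tt: "t' = t" if "m = (1 - t') *\<^sub>R p + t' *\<^sub>R q" for t'
  proof -
    have "(t - t') *\<^sub>R (q - p) = 0" using that t by (simp add: algebra_simps)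
    then show ?thesis using pq by simp
  qed
  have m_in: "0 \<le> t \<and> t \<le> 1" if ms: "m \<in> closed_segment p q"
  proof -
    obtain t' where "0 \<le> t'" "t' \<le> 1" "m = (1 - t') *\<^sub>R p + t' *\<^sub>R q" using ms by (auto simp: in_segment)
    then show ?thesis using tt by blast
  qed
  consider "0 \<le> t" "t \<le> 1" | "t > 1" | "t < 0" by linarith
  then show False
  proof cases
    case 1
    have "m = (1 - t) *\<^sub>R p + t *\<^sub>R q" using t by (simp add: algebra_simps)
    then have "m \<in> closed_segment p q" using 1 by (auto simp: in_segment)
    then have "r \<in> closed_segment p q" using F[OF rS _ mseg] by blast
    then obtain v where "r = (1 - v) *\<^sub>R p + v *\<^sub>R q" by (auto simp: in_segment)
    then have "ori p q r = 0" by (simp add: ori_affine)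
    then show False using rs by simp
  next
    case 2
    have "q = (1 - 1 / t) *\<^sub>R p + (1 / t) *\<^sub>R m" unfolding t using 2 by (simp add: algebra_simps)
    moreover have "p \<noteq> m" using t pq 2 by simp
    ultimately have "q \<in> open_segment p m" using 2 unfolding in_segment(2) by (intro conjI exI[of _ "1 / t"]) auto
    then have "m \<in> closed_segment p q" using F[OF pqS(1) mS, of q] by auto
    then show False using m_in 2 by linarith
  next
    case 3
    have "1 - t \<noteq> 0" using 3 by simp
    have "(1 - t) *\<^sub>R p = m - t *\<^sub>R q" using t by (simp add: algebra_simps)
    then have "p = (1 / (1 - t)) *\<^sub>R (m - t *\<^sub>R q)" using 3 by (metis \<open>1 - t \<noteq> 0\<close> divide_self_if scaleR_one scaleR_scaleR times_divide_eq_left mult_1)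
    also have "\<dots> = (1 - 1 / (1 - t)) *\<^sub>R q + (1 / (1 - t)) *\<^sub>R m"
    proof -
      have "1 - 1 / (1 - t) = - t / (1 - t)" using 3 by (simp add: field_simps)
      then show ?thesis by (simp only: scaleR_diff_right) simp
    qed
    finally have pe: "p = (1 - 1 / (1 - t)) *\<^sub>R q + (1 / (1 - t)) *\<^sub>R m" .
    have "q \<noteq> m"
    proof
      assume "q = m"
      then have "m = (1 - 1) *\<^sub>R p + 1 *\<^sub>R q" by simp
      then have "1 = t" by (rule tt)
      then show False using 3 by simp
    qed
    then have "p \<in> open_segment q m" using 3 pe unfolding in_segment(2) by (intro conjI exI[of _ "1 / (1 - t)"]) auto
    then have "m \<in> closed_segment p q" using F[OF pqS(2) mS, of p] by auto
    then show False using m_in 3 by linarith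
  qed
qed

text \<open>A segment \<open>uv\<close> crossing an edge of the cycle could be extended to a
  triangulation, which contains that edge. A non-crossing set of maximal size among those containing
  \<open>uv\<close> is such a triangulation.\<close>

lemma unavoidable_not_crossed:
  assumes P: "planar_point_set P" and c: "unavoidable_spanning_cycle P xs" and e: "{x, y} \<in> closed_chain_edges xs"
    and uv: "u \<in> P" "v \<in> P" and s: "s = 1 \<or> s = - 1"
  shows "\<not> chiro.crossing (sori s) u v x y"
proof
  interpret chiro "sori s" by (rule chiro_sori[OF s])
  assume "crossing u v x y"
  then have "sori s u v x * sori s u v y < 0" "sori s x y u * sori s x y v < 0" by (auto simp: crossing_def)
  then have o: "ori u v x * ori u v y < 0" "ori x y u * ori x y v < 0"
    using s by (auto simp: sori_def)
  have ne: "u \<noteq> v" using o by auto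
  have "{u, v} \<noteq> {x, y}" using o by (auto simp: doubleton_eq_iff)
  then have cross: "segments_cross {u, v} {x, y}"
    unfolding segments_cross_def using segments_meetI[OF o] by blast
  define N where "N = {T. noncrossing_segments P T \<and> {u, v} \<in> T}"
  have segs: "{u, v} \<in> segments_of P" using uv ne by (auto simp: segments_of_def)
  have "segments_of P \<subseteq> Pow P" by (auto simp: segments_of_def)
  then have fs: "finite (segments_of P)" using planar_finite[OF P] by (meson finite_Pow_iff finite_subset)
  have sub: "T \<subseteq> segments_of P" if "T \<in> N" for T using that by (simp add: N_def noncrossing_segments_def)
  have "finite N" using fs sub by (meson Pow_iff finite_Pow_iff finite_subset subsetI)
  have "{{u, v}} \<in> N" using segs by (auto simp: N_def noncrossing_segments_def segments_cross_def)
  then obtain T where T: "T \<in> N" "\<And>T'. T' \<in> N \<Longrightarrow> card T' \<le> card T"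
  proof -
    have "Max (card ` N) \<in> card ` N" using \<open>finite N\<close> \<open>{{u, v}} \<in> N\<close> by (intro Max_in) auto
    then obtain T where "T \<in> N" "card T = Max (card ` N)" by auto
    then show thesis using that[of T] \<open>finite N\<close> by auto
  qed
  have "triangulation_on P T"
    unfolding triangulation_on_def
  proof (intro conjI allI impI)
    show "noncrossing_segments P T" using T(1) by (simp add: N_def)
    fix T' assume T': "noncrossing_segments P T' \<and> T \<subseteq> T'"
    then have N': "T' \<in> N" using T(1) by (auto simp: N_def)
    then have "finite T'" using sub fs finite_subset by blast
    then show "T' = T" using T' T(2)[OF N'] card_seteq by blast
  qed
  then have "{x, y} \<in> T" using c e unfolding unavoidable_spanning_cycle_def by blast
  then show False using T(1) cross unfolding N_def noncrossing_segments_def by blast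
qed

lemma closed_chain_edges_consecutive: "{x, y} \<in> closed_chain_edges (us @ x # y # vs)"
  unfolding closed_chain_edges_def by (intro CollectI exI[of _ "length us"]) (simp add: nth_append)

lemma closed_chain_edges_wrap: "{x, y} \<in> closed_chain_edges (y # us @ [x])"
  unfolding closed_chain_edges_def by (intro CollectI exI[of _ "Suc (length us)"]) (simp add: nth_append)

lemma consecutive_split:
  "Suc k < length L \<Longrightarrow> L = take k L @ L ! k # L ! Suc k # drop (Suc (Suc k)) L"
  by (metis Cons_nth_drop_Suc Suc_lessD append_take_drop_id)

text \<open>\<open>convex_polygon\<close> says that each edge has the other vertices on one side,
  but not on which. For the first edge this is decided by its inner end being to the left of
  \<open>pq\<close>, and three consecutive vertices pass the decision on from one edge to the
  next.\<close>

lemma chain_right_turning: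
  assumes s: "s = 1 \<or> s = - 1" and V: "planar_point_set V" "set L \<subseteq> V"
    and L: "L = p # A @ [q]" "A \<noteq> []" "convex_polygon L" and base: "\<And>x. x \<in> set A \<Longrightarrow> sori s p q x > 0"
    and kj: "Suc k < length L" "j < length L" "j \<noteq> k" "j \<noteq> Suc k"
  shows "sori s (L ! k) (L ! Suc k) (L ! j) < 0"
proof -
  interpret chiro "sori s" by (rule chiro_sori[OF s])
  have dist: "distinct L" and he: "\<And>k. Suc k < length L \<Longrightarrow> hull_edge (set L) (L ! k) (L ! Suc k)"
    using L(3) unfolding convex_polygon_def by (auto dest: Suc_lessD)
  have neq: "L ! i \<noteq> L ! j" if "i < length L" "j < length L" "i \<noteq> j" for i j
    using that dist nth_eq_iff_index_eq by blast
  have spread: "sori s (L ! k) (L ! Suc k) (L ! j) < 0"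
    if k: "Suc k < length L" and i: "i < length L" "sori s (L ! k) (L ! Suc k) (L ! i) < 0"
      and j: "j < length L" "j \<noteq> k" "j \<noteq> Suc k" for k i j
  proof (rule ccontr)
    assume no: "\<not> ?thesis"
    have "sori s (L ! k) (L ! Suc k) (L ! j) \<noteq> 0"
      using neq k j V(2) by (intro gpD[OF planar_gp[OF s V(1)]]) (auto intro: nth_mem)
    then have "sori s (L ! k) (L ! Suc k) (L ! j) > 0" using no by linarith
    moreover have "L ! k \<noteq> L ! Suc k" "L ! i \<in> set L" "L ! j \<in> set L" using neq[of k "Suc k"] k i j by auto
    ultimately show False
      using s hull_edge_one_side[OF he[OF k], of "L ! i" "L ! j"] hull_edge_one_side[OF he[OF k], of "L ! j" "L ! i"] i(2)
      unfolding sori_def by auto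
  qed
  have len: "length L \<ge> 3" using L(1,2) by (cases A) auto
  have "\<exists>i<length L. sori s (L ! k) (L ! Suc k) (L ! i) < 0" if "Suc k < length L" for k
    using that
  proof (induction k)
    case 0
    obtain x A' where A: "A = x # A'" using L(2) by (cases A) auto
    have "sori s p q x > 0" using base A by simp
    then have "sori s p x q < 0" using sw2[of p q x] by simp
    moreover have "L ! 0 = p" "L ! Suc 0 = x" "L ! (length L - 1) = q" using L(1) A by (simp_all add: nth_append)
    ultimately show ?case using len by (intro exI[of _ "length L - 1"]) auto
  next
    case (Suc k)
    then obtain i where "i < length L" "sori s (L ! k) (L ! Suc k) (L ! i) < 0" by auto
    then have "sori s (L ! k) (L ! Suc k) (L ! Suc (Suc k)) < 0" using spread[of k i "Suc (Suc k)"] Suc.prems by simp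
    then show ?case using rot[of "L ! k" "L ! Suc k" "L ! Suc (Suc k)"] Suc.prems by (intro exI[of _ k]) auto
  qed
  then show ?thesis using spread kj by blast
qed

lemma double_circle_of_generalized:
  assumes s: "s = 1 \<or> s = - 1" and P: "planar_point_set P"
    and A: "A1 \<noteq> []" "A2 \<noteq> []" "A3 \<noteq> []"
    and conv: "convex_polygon (p1 # A1 @ [p2])" "convex_polygon (p2 # A2 @ [p3])" "convex_polygon (p3 # A3 @ [p1])"
    and cyc: "unavoidable_spanning_cycle P (p1 # A1 @ p2 # A2 @ p3 # A3)"
    and pos: "sori s p1 p2 p3 > 0"
      "\<And>x. x \<in> P - {p1, p2, p3} \<Longrightarrow> sori s p1 p2 x > 0 \<and> sori s p2 p3 x > 0 \<and> sori s p3 p1 x > 0"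
  shows "chiro.double_circle (sori s) P p1 p2 p3 A1 A2 A3"
proof -
  interpret chiro "sori s" by (rule chiro_sori[OF s])
  let ?C = "p1 # A1 @ p2 # A2 @ p3 # A3"
  have C: "distinct ?C" "set ?C = P" using cyc by (auto simp: unavoidable_spanning_cycle_def)
  have in_P: "x \<in> P - {p1, p2, p3}" if "x \<in> set A1 \<or> x \<in> set A2 \<or> x \<in> set A3" for x
    using that C by auto
  have edge: "{L ! k, L ! Suc k} \<in> closed_chain_edges ?C"
    if L: "L \<in> {p1 # A1 @ [p2], p2 # A2 @ [p3], p3 # A3 @ [p1]}" and k: "Suc k < length L" for L k
  proof -
    have sp: "L = take k L @ L ! k # L ! Suc k # drop (Suc (Suc k)) L" using consecutive_split[OF k] .
    have mid: "{L ! k, L ! Suc k} \<in> closed_chain_edges ?C" if "?C = us @ L @ vs" for us vs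
    proof -
      have "?C = (us @ take k L) @ L ! k # L ! Suc k # (drop (Suc (Suc k)) L @ vs)"
        unfolding that by (subst sp) simp
      then show ?thesis by (metis closed_chain_edges_consecutive)
    qed
    consider "L = p1 # A1 @ [p2]" | "L = p2 # A2 @ [p3]" | "L = p3 # A3 @ [p1]" using L by blast
    then show ?thesis
    proof cases
      case 1
      then show ?thesis using mid[of "[]" "A2 @ p3 # A3"] by simp
    next
      case 2
      then show ?thesis using mid[of "p1 # A1" "A3"] by simp
    next
      case 3
      \<comment> \<open>The third chain closes the cycle, so its last edge is the wrap-around edge
        of the list instead of a pair of consecutive elements.\<close>
      define M where "M = p3 # A3"
      have LM: "L = M @ [p1]" and CM: "?C = (p1 # A1 @ p2 # A2) @ M" using 3 by (simp_all add: M_def)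
      show ?thesis
      proof (cases "Suc k < length M")
        case True
        have "?C = ((p1 # A1 @ p2 # A2) @ take k M) @ M ! k # M ! Suc k # drop (Suc (Suc k)) M"
          using consecutive_split[OF True] CM by simp
        then have "{M ! k, M ! Suc k} \<in> closed_chain_edges ?C" by (metis closed_chain_edges_consecutive)
        then show ?thesis using True by (simp add: LM nth_append)
      next
        case False
        then have kM: "Suc k = length M" using k LM by simp
        have Mn: "M = butlast M @ [M ! k]"
          using kM by (metis M_def append_butlast_last_id diff_Suc_1 last_conv_nth list.distinct(1))
        have "?C = p1 # (A1 @ p2 # A2 @ butlast M) @ [M ! k]"
          unfolding CM by (subst Mn) simp
        then have "{M ! k, p1} \<in> closed_chain_edges ?C" by (metis closed_chain_edges_wrap)
        then show ?thesis using kM by (simp add: LM nth_append)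
      qed
    qed
  qed
  have turn: "sori s (L ! k) (L ! Suc k) (L ! j) < 0"
    if L: "L \<in> {p1 # A1 @ [p2], p2 # A2 @ [p3], p3 # A3 @ [p1]}"
      and k: "Suc k < length L" "j < length L" "j \<noteq> k" "j \<noteq> Suc k" for L k j
  proof -
    have sub: "set L \<subseteq> P" using L C(2) by auto
    consider "L = p1 # A1 @ [p2]" | "L = p2 # A2 @ [p3]" | "L = p3 # A3 @ [p1]" using L by blast
    then show ?thesis
    proof cases
      case 1
      show ?thesis
        by (rule chain_right_turning[OF s P sub 1 A(1) conv(1)[folded 1] _ k]) (use pos(2)[OF in_P] in blast)
    next
      case 2
      show ?thesis
        by (rule chain_right_turning[OF s P sub 2 A(2) conv(2)[folded 2] _ k]) (use pos(2)[OF in_P] in blast)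
    next
      case 3
      show ?thesis
        by (rule chain_right_turning[OF s P sub 3 A(3) conv(3)[folded 3] _ k]) (use pos(2)[OF in_P] in blast)
    qed
  qed
  show ?thesis
    unfolding double_circle_def
    using planar_gp[OF s P] C pos turn unavoidable_not_crossed[OF P cyc edge _ _ s] by blast
qed

section \<open>Transfer of the tiling from \<open>Q\<close> to \<open>P\<close>\<close>

lemma map_of_zip_list:
  assumes "distinct xs" "length xs = length ys"
  shows "map (\<lambda>x. the (map_of (zip xs ys) x)) xs = ys"
  using assms by (intro nth_equalityI) (auto simp: map_of_zip_nth)

lemma map_fixed: "map h xs = xs \<Longrightarrow> x \<in> set xs \<Longrightarrow> h x = x"
  by (induction xs) auto

fun map_triple :: "('a \<Rightarrow> 'b) \<Rightarrow> 'a \<times> 'a \<times> 'a \<Rightarrow> 'b \<times> 'b \<times> 'b" where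
  "map_triple g (x, y, z) = (g x, g y, g z)"

lemma sides_map_triple: "sides (map_triple g t) = (`) g ` sides t"
  by (cases t) auto

lemma corners_map_triple: "corners (map_triple g t) = g ` corners t"
  by (cases t) auto

text \<open>A skew test function on the images pulls back along \<open>g\<close> to a skew test
  function.\<close>

lemma bounds_map_triple:
  assumes "bounds D h"
  shows "bounds (map (map_triple g) D) (map_triple g h)"
  unfolding bounds_def
proof (intro allI impI)
  fix \<phi> :: "'b \<Rightarrow> 'b \<Rightarrow> real" assume s: "skew \<phi>"
  define \<psi> where "\<psi> = (\<lambda>x y. \<phi> (g x) (g y))"
  have "skew \<psi>" using s unfolding skew_def \<psi>_def by blast
  moreover have "bd \<phi> (map_triple g t) = bd \<psi> t" for t by (cases t) (simp add: \<psi>_def)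
  ultimately show "(\<Sum>t\<leftarrow>map (map_triple g) D. bd \<phi> t) = bd \<phi> (map_triple g h)"
    using assms unfolding bounds_def by (simp add: comp_def)
qed

text \<open>Injectivity on \<open>V\<close> preserves the negative conditions, namely that a vertex
  is off a chain.\<close>

lemma allowed_map_triple:
  assumes a: "allowed L1 L2 L3 t" and g: "inj_on g V" and V: "corners t \<subseteq> V" "set L1 \<subseteq> V" "set L2 \<subseteq> V" "set L3 \<subseteq> V"
  shows "allowed (map g L1) (map g L2) (map g L3) (map_triple g t)"
proof -
  obtain x y z where t: "t = (x, y, z)" by (cases t)
  have mem: "g u \<in> set (map g L) \<longleftrightarrow> u \<in> set L" if "u \<in> V" "set L \<subseteq> V" for u L
    using that g by (auto dest: inj_onD)
  have sub: "subseq (map g us) (map g L)" if "subseq us L" for us L using that by (rule subseq_map)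
  have inn: "inner (map g L) (map_triple g t)" if "inner L t" "set L \<subseteq> V" for L
    using that V(1) mem[of _ L] sub[of "[x, y]" L] sub[of "[y, z]" L] sub[of "[z, x]" L] by (auto simp: t)
  have poc: "pocket (map g L) (map_triple g t)" if "pocket L t" for L
    using that sub[of "[z, y, x]" L] by (simp add: t)
  have spr: "spread (set (map g L1) - set (map g L2) - set (map g L3)) (set (map g L2) - set (map g L3) - set (map g L1))
     (set (map g L3) - set (map g L1) - set (map g L2)) (map_triple g t)"
    if "spread (set L1 - set L2 - set L3) (set L2 - set L3 - set L1) (set L3 - set L1 - set L2) t"
    using that V mem[of _ L1] mem[of _ L2] mem[of _ L3] by (simp add: t del: set_map)
  show ?thesis using a inn poc spr V(2-4) unfolding allowed_def by blast
qed

theorem theorem13: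
  fixes c\<^sub>1 c\<^sub>2 c\<^sub>3 :: nat and P :: "(real^2) set"
  assumes "c\<^sub>1 > 0" and "c\<^sub>2 > 0" and "c\<^sub>3 > 0"
    and "generalized_double_circle c\<^sub>1 c\<^sub>2 c\<^sub>3 P"
  shows "universal P"
  unfolding universal_def
proof (intro allI impI)
  fix Q f0 assume Q: "planar_point_set Q \<and> card Q = card P \<and> cyclic_bijection P Q f0"
  obtain p1 p2 p3 A1 A2 A3 where P: "planar_point_set P" "card P = 3 + c\<^sub>1 + c\<^sub>2 + c\<^sub>3"
      "length A1 = c\<^sub>1" "length A2 = c\<^sub>2" "length A3 = c\<^sub>3" "hull_vertices P = {p1, p2, p3}"
      and conv: "convex_polygon (p1 # A1 @ [p2])" "convex_polygon (p2 # A2 @ [p3])" "convex_polygon (p3 # A3 @ [p1])"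
      and cyc: "unavoidable_spanning_cycle P (p1 # A1 @ p2 # A2 @ p3 # A3)"
    using assms(4) unfolding generalized_double_circle_def by blast
  let ?C = "p1 # A1 @ p2 # A2 @ p3 # A3"
  have C: "distinct ?C" "set ?C = P" using cyc by (auto simp: unavoidable_spanning_cycle_def)
  have pne: "p1 \<noteq> p2" "p2 \<noteq> p3" "p3 \<noteq> p1" using C(1) by auto
  obtain s where s: "s = 1 \<or> s = - 1" "sori s p1 p2 p3 > 0"
     "\<And>x. x \<in> P - {p1, p2, p3} \<Longrightarrow> sori s p1 p2 x > 0 \<and> sori s p2 p3 x > 0 \<and> sori s p3 p1 x > 0"
    using triangular_hull(2)[OF P(1,6) pne] by blast
  interpret P: chiro "sori s" by (rule chiro_sori[OF s(1)])
  have dc: "P.double_circle P p1 p2 p3 A1 A2 A3"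
    using assms(1-3) P(3-5) by (intro double_circle_of_generalized[OF s(1) P(1) _ _ _ conv cyc s(2,3)]) auto
  define q1 q2 q3 where "q1 = f0 p1" and "q2 = f0 p2" and "q3 = f0 p3"
  have f0: "bij_betw f0 {p1, p2, p3} (hull_vertices Q)"
    using Q P(6) unfolding cyclic_bijection_def by simp
  then have hQ: "hull_vertices Q = {q1, q2, q3}" unfolding bij_betw_def by (auto simp: q1_def q2_def q3_def)
  have qne: "q1 \<noteq> q2" "q2 \<noteq> q3" "q3 \<noteq> q1"
    using f0 pne unfolding bij_betw_def inj_on_def q1_def q2_def q3_def by auto
  have Qp: "planar_point_set Q" "card Q = card P" using Q by auto
  have qQ: "{q1, q2, q3} \<subseteq> Q" by (rule triangular_hull(1)[OF Qp(1) hQ qne])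
  obtain r where r: "r = 1 \<or> r = - 1" "sori r q1 q2 q3 > 0"
     "\<And>x. x \<in> Q - {q1, q2, q3} \<Longrightarrow> sori r q1 q2 x > 0 \<and> sori r q2 q3 x > 0 \<and> sori r q3 q1 x > 0"
    using triangular_hull(2)[OF Qp(1) hQ qne] by blast
  interpret Q: chiro "sori r" by (rule chiro_sori[OF r(1)])
  have finQ: "finite Q" by (rule planar_finite[OF Qp(1)])
  have "card (Q - {q1, q2, q3}) = card Q - card {q1, q2, q3}" using qQ finQ by (intro card_Diff_subset) auto
  then have "card (Q - {q1, q2, q3}) = c\<^sub>1 + c\<^sub>2 + c\<^sub>3" using qne P(2) Qp(2) by simp
  moreover have "Q.gp ({q1, q2, q3} \<union> (Q - {q1, q2, q3}))"
    by (rule Q.gp_subset[OF planar_gp[OF r(1) Qp(1)]]) (use qQ in auto)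
  ultimately obtain B1 B2 B3 D where B: "Q.filling q1 q2 q3 B1 B2 B3 D" "set B1 \<union> set B2 \<union> set B3 = Q - {q1, q2, q3}"
      "length B1 = c\<^sub>1" "length B2 = c\<^sub>2" "length B3 = c\<^sub>3"
    using Q.filling_exists[of "Q - {q1, q2, q3}" c\<^sub>1 c\<^sub>2 c\<^sub>3 q1 q2 q3] finQ assms(1,3) r(2,3) by auto
  let ?E = "q1 # B1 @ q2 # B2 @ q3 # B3"
  have E: "distinct ?E" "set ?E = Q"
    using B(1,2) qQ unfolding Q.filling_def by auto
  have bnd: "bounds D (q1, q2, q3)" and cov: "Q \<subseteq> \<Union> (corners ` set D)"
    using B(1) E(2) unfolding Q.filling_def by auto
  have tri: "sori r x y z > 0" "allowed (q1 # B1 @ [q2]) (q2 # B2 @ [q3]) (q3 # B3 @ [q1]) (x, y, z)" "{x, y, z} \<subseteq> set ?E"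
    if "(x, y, z) \<in> set D" for x y z using B(1) that unfolding Q.filling_def by auto
  have len: "length ?C = length ?E" using P(3-5) B(3-5) by simp
  define f where "f = (\<lambda>x. the (map_of (zip ?C ?E) x))"
  define g where "g = (\<lambda>x. the (map_of (zip ?E ?C) x))"
  have fC: "map f ?C = ?E" unfolding f_def by (rule map_of_zip_list[OF C(1) len])
  have gE: "map g ?E = ?C" unfolding g_def by (rule map_of_zip_list[OF E(1) len[symmetric]])
  have gf: "g (f x) = x" if "x \<in> P" for x
  proof (rule map_fixed[of "\<lambda>x. g (f x)" ?C])
    show "map (\<lambda>x. g (f x)) ?C = ?C" using arg_cong[OF fC, of "map g"] unfolding gE map_map comp_def .
  qed (use that C(2) in simp)
  have fg: "f (g y) = y" if "y \<in> Q" for y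
  proof (rule map_fixed[of "\<lambda>y. f (g y)" ?E])
    show "map (\<lambda>y. f (g y)) ?E = ?E" using arg_cong[OF gE, of "map f"] unfolding fC map_map comp_def .
  qed (use that E(2) in simp)
  have fP: "f ` P = Q" and gQ: "g ` Q = P"
    using arg_cong[OF fC, of set] arg_cong[OF gE, of set] unfolding set_map C(2) E(2) by simp_all
  have bij: "bij_betw f P Q" using gf fg fP gQ by (intro bij_betw_byWitness[of _ g]) auto
  \<comment> \<open>Corresponding lists have the same length, so the equation between the two cycles
    splits into its parts.\<close>
  have gq: "g q1 = p1" "map g B1 = A1" "g q2 = p2" "map g B2 = A2" "g q3 = p3" "map g B3 = A3"
    using gE P(3-5) B(3-5) by (auto simp: append_eq_append_conv)
  have inj: "inj_on g Q" using fg by (metis inj_onI)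
  have DQ: "corners t \<subseteq> Q" if "t \<in> set D" for t
  proof -
    obtain x y z where "t = (x, y, z)" by (cases t)
    then show ?thesis using tri(3)[of x y z] that unfolding E(2) by simp
  qed
  define TQ where "TQ = \<Union> (sides ` set D)"
  \<comment> \<open>The same triangles, relabelled by \<open>g\<close>; whether they tile the hull
    of \<open>P\<close> depends only on their orientations there.\<close>
  define TP where "TP = \<Union> (sides ` set (map (map_triple g) D))"
  have "triangulation_on Q TQ"
    unfolding TQ_def using tri(1) r by (intro triangulation_of_bounds[OF r(1) Qp(1) qQ r(2,3) DQ _ bnd cov]) auto
  moreover have "triangulation_on P TP"
    unfolding TP_def
  proof (rule triangulation_of_bounds[OF s(1) P(1) _ s(2,3)])
    show "{p1, p2, p3} \<subseteq> P" using C(2) by auto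
    show cP: "corners t \<subseteq> P" if "t \<in> set (map (map_triple g) D)" for t
      using that DQ gQ by (auto simp: corners_map_triple)
    show "bounds (map (map_triple g) D) (p1, p2, p3)" using bounds_map_triple[OF bnd, of g] gq by simp
    show "P \<subseteq> \<Union> (corners ` set (map (map_triple g) D))"
    proof
      fix x assume "x \<in> P"
      then obtain y where y: "y \<in> Q" "x = g y" using gQ by auto
      then obtain t where "t \<in> set D" "y \<in> corners t" using cov by auto
      then have "map_triple g t \<in> set (map (map_triple g) D)" "x \<in> corners (map_triple g t)"
        using y(2) by (auto simp: corners_map_triple)
      then show "x \<in> \<Union> (corners ` set (map (map_triple g) D))" by blast
    qed
    fix x y z assume xyz: "(x, y, z) \<in> set (map (map_triple g) D)"
    then obtain x' y' z' where t: "(x', y', z') \<in> set D" "(x, y, z) = map_triple g (x', y', z')" by auto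
    have "allowed (map g (q1 # B1 @ [q2])) (map g (q2 # B2 @ [q3])) (map g (q3 # B3 @ [q1])) (map_triple g (x', y', z'))"
      using E(2) by (intro allowed_map_triple[OF tri(2)[OF t(1)] inj DQ[OF t(1)]]) auto
    then have "allowed (p1 # A1 @ [p2]) (p2 # A2 @ [p3]) (p3 # A3 @ [p1]) (x, y, z)" using gq t(2) by simp
    moreover have "corners (x, y, z) \<subseteq> P" by (rule cP[OF xyz])
    ultimately show "sori s x y z > 0" using P.double_circle_allowed[OF dc] by simp
  qed
  moreover have "{p, p'} \<in> TP \<longleftrightarrow> {f p, f p'} \<in> TQ" if pp: "p \<in> P" "p' \<in> P" for p p'
  proof -
    have TP: "TP = (`) g ` TQ" unfolding TP_def TQ_def by (auto simp: sides_map_triple)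
    have sub: "e \<subseteq> Q" if "e \<in> TQ" for e
    proof -
      have "e \<subseteq> corners t" if "e \<in> sides t" for t using that by (cases t) auto
      then show ?thesis using that DQ unfolding TQ_def by blast
    qed
    show ?thesis
    proof
      assume "{p, p'} \<in> TP"
      then obtain e where e: "e \<in> TQ" "{p, p'} = g ` e" unfolding TP by auto
      have "f ` {p, p'} = e" unfolding e(2) image_image using sub[OF e(1)] fg by force
      then show "{f p, f p'} \<in> TQ" using e(1) by simp
    next
      assume "{f p, f p'} \<in> TQ"
      then have "g ` {f p, f p'} \<in> TP" unfolding TP by blast
      then show "{p, p'} \<in> TP" using gf pp by simp
    qed
  qed
  ultimately have "compatible_triangulation P Q f TP TQ" unfolding compatible_triangulation_def by blast
  moreover have "f p = f0 p" if "p \<in> hull_vertices P" for p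
  proof -
    have "f p1 = q1" "f p2 = q2" "f p3 = q3" using fg[of q1] fg[of q2] fg[of q3] gq qQ by auto
    then show ?thesis using that P(6) by (auto simp: q1_def q2_def q3_def)
  qed
  ultimately show "\<exists>f. bij_betw f P Q \<and> (\<forall>p\<in>hull_vertices P. f p = f0 p) \<and>
      (\<exists>TP TQ. compatible_triangulation P Q f TP TQ)"
    using bij by blast
qed

end
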